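(* Assume: (A 1) $G(\theta,\cdot)$ is Borel measurable for every $\theta\in\Theta$; (A 2') there is a positive envelope $\xi$ of $\mathbb{F}^{\Theta}$ with $\xi(Z_{1})\in H^{\Phi^{*}}$; (A 3'') there exist an at most countable subset $\overline{\Theta}\subseteq\Theta$ and $(\mathbb{P}^{Z})^{n}$-null sets $N_{n}$ ($n\in\mathbb{N}$) such that $$\inf_{\vartheta\in\overline{\Theta}}\mathbb{E}\big[|G(\vartheta,Z_{1})-G(\theta,Z_{1})|\big]=\inf_{\vartheta\in\overline{\Theta}}\max_{j\in\{1,\dots,n\}}|G(\theta,z_{j})-G(\vartheta,z_{j})|=0$$ for all $n\in\mathbb{N}$, $\theta\in\Theta$, $(z_{1},\dots,z_{n})\in\mathbb{R}^{dn}\setminus N_{n}$. Suppose that for some $x_{0}\in\,]1,2[$ with $\Phi(x_{0})<\infty$ and some $\delta>0$ the mapping $$\xi_{x_{0},\xi,\delta}:=\big[\Phi^{*'}_{+}\big(\xi+x_{u}(x_{0},\xi,\delta)\big)+1\big]\sqrt{\xi^{2}+x_{u}(x_{0},\xi,\delta)^{2}}$$ is square $\mathbb{P}^{Z}$-integrable. If $G(\cdot,z)$ is lower semicontinuous for every $z\in\mathbb{R}^{d}$ and $J(\mathbb{F}^{\Theta},\xi,1/2)<\infty$, then: 1) For $\varepsilon,t>0$ and $n\in\mathbb{N}$ with $n\ge2\|\xi_{x_{0},\xi,\delta}\|_{\mathbb{P}^{Z},2}^{2}$ the inequality $$\mathbb{P}\Big(\Big|\inf_{\theta\in\Theta}\mathcal{R}_{\rho^{\Phi}}(\hat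 F_{n,\theta})-\inf_{\theta\in\Theta}\mathcal{R}_{\rho^{\Phi}}(F_{\theta})\Big|\ge\varepsilon\Big)\le\exp\Big(\frac{-t\sqrt n\,\varepsilon}{16(t+1)\|\xi_{x_{0},\xi,\delta}\|_{\mathbb{P}^{Z},2}}\mathfrak{f}_{n}(t)\Big)+\mathbb{P}(\Omega\setminus A_{n,\delta}^{\xi})+\mathbb{P}\big(\Omega\setminus B_{n}^{2\xi_{x_{0},\xi,\delta}}\big)$$ holds if $$\varepsilon>\frac{\|\xi_{x_{0},\xi,\delta}\|_{\mathbb{P}^{Z},2}}{\sqrt n}\Big[2+32(t+1)\big(4J(\mathbb{F}^{\Theta},\xi,1/4)+5\sqrt{\ln 2}\big)\Big].$$ 2) The sequence $\big(\sqrt n\,[\inf_{\theta\in\Theta}\mathcal{R}_{\rho^{\Phi}}(\hat F_{n,\theta})-\inf_{\theta\in\Theta}\mathcal{R}_{\rho^{\Phi}}(F_{\theta})]\big)_{n\in\mathbb{N}}$ is a uniformly tight sequence of random variables.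
   Context: Let $m,d\in\mathbb{N}$, let $\Theta\subseteq\mathbb{R}^{m}$ be nonempty and compact, let $(\Omega,\mathcal{F},\mathbb{P})$ be an atomless complete probability space, and let $(Z_{j})_{j\in\mathbb{N}}$ be i.i.d. $d$-dimensional random vectors on it with common distribution $\mathbb{P}^{Z}$. Let $G:\Theta\times\mathbb{R}^{d}\to\mathbb{R}$ and $\mathbb{F}^{\Theta}:=\{G(\theta,\cdot)\mid\theta\in\Theta\}$. Let $\Phi:[0,\infty[\to[0,\infty]$ be lower semicontinuous and convex with $\Phi(0)<\infty$, $\Phi(x)<\infty$ for some $x>1$, $\inf_{x\ge0}\Phi(x)=0$ and $\lim_{x\to\infty}\Phi(x)/x=\infty$. Its Fenchel–Legendre transform $\Phi^{*}(y)=\sup_{x\ge0}(xy-\Phi(x))$, $y\in\mathbb{R}$, is finite, convex, nondecreasing with $\Phi^{*}(0)=0$; $\Phi^{*'}_{+}$ is its right-sided derivative. $H^{\Phi^{*}}$ is the set of random variables $X$ on $(\Omega,\mathcal{F},\mathbb{P})$ with $\mathbb{E}[\Phi^{*}(c|X|)]<\infty$ for all $c>0$ (all of them are integrable). The divergence risk measure is $\rho^{\Phi}(X)=\sup_{\overline{\mathbb{P}}}\big(\mathbb{E}_{\overline{\mathbb{P}}}[X]-\mathbb{E}[\Phi(d\overline{\mathbb{P}}/d\mathbb{P})]\big)$, $X\in H^{\Phi^{*}}$, the supremum being over probability measures $\overline{\mathbb{P}}\ll\mathbb{P}$ with $\Phi(d\overline{\mathbb{P}}/d\mathbb{P})$ $\mathbb{P}$-integrable;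 it is known that $\rho^{\Phi}(X)=\inf_{x\in\mathbb{R}}\mathbb{E}[\Phi^{*}(X+x)-x]$. It depends only on the distribution of $X$; $\mathcal{R}_{\rho^{\Phi}}$ is the associated functional on distribution functions. $F_{\theta}$ is the distribution function of $G(\theta,Z_{1})$, $\hat F_{n,\theta}$ the empirical distribution function of $G(\theta,Z_{1}),\dots,G(\theta,Z_{n})$; so $\mathcal{R}_{\rho^{\Phi}}(F_{\theta})=\inf_{x\in\mathbb{R}}\mathbb{E}[\Phi^{*}(G(\theta,Z_{1})+x)-x]$ and $\mathcal{R}_{\rho^{\Phi}}(\hat F_{n,\theta})=\inf_{x\in\mathbb{R}}\big(\frac1n\sum_{i=1}^{n}\Phi^{*}(G(\theta,Z_{i})+x)-x\big)$. For $x_{0}>1$ with $\Phi(x_{0})<\infty$ and $\delta>0$, $$x_{u}(x_{0},\xi,\delta):=\frac{\Phi(x_{0})+(1+x_{0})\delta+\mathbb{E}[\Phi^{*}(\xi(Z_{1}))]+x_{0}\mathbb{E}[\xi(Z_{1})]}{x_{0}-1}+\Phi(0).$$ $A_{n,\delta}^{\xi}\in\mathcal F$ is the set of all $\omega\in\Omega$ with $\frac1n\sum_{j=1}^{n}\xi(Z_{j}(\omega))\le\mathbb{E}[\xi(Z_{1})]+\delta$ and $\frac1n\sum_{j=1}^{n}\Phi^{*}(\xi(Z_{j}(\omega)))\le\mathbb{E}[\Phi^{*}(\xi(Z_{1}))]+\delta$. For square $\mathbb{P}^{Z}$-integrable strictly positive $\zeta$: $B_{n}^{\zeta}:=\big\{\frac1n\sum_{j=1}^{n}\zeta(Z_{j})^{2}\le2\,\mathbb{E}[\zeta(Z_{1})^{2}]\big\}$.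 For a probability measure $\mathbb{Q}$ on $\mathcal{B}(\mathbb{R}^{d})$, $\|\cdot\|_{\mathbb{Q},2}$ is the $L^{2}(\mathbb{Q})$-norm. For a nonempty set $\mathbb{F}$ of Borel measurable functions $\mathbb{R}^{d}\to\mathbb{R}$, $N(\eta,\mathbb{F},L^{2}(\mathbb{Q}))$ is the minimal number of closed $L^{2}(\mathbb{Q})$-balls of radius $\eta>0$ with centers in $\mathbb{F}$ needed to cover $\mathbb{F}$ ($\infty$ if there is no finite cover). A positive envelope of $\mathbb{F}$ is a Borel measurable $C_{\mathbb{F}}:\mathbb{R}^{d}\to\,]0,\infty[$ with $\sup_{h\in\mathbb{F}}|h|\le C_{\mathbb{F}}$. $\mathcal{M}_{\mathrm{fin}}$ is the set of probability measures on $\mathcal{B}(\mathbb{R}^{d})$ with finite support, and $$J(\mathbb{F},C_{\mathbb{F}},\delta):=\int_{0}^{\delta}\sup_{\mathbb{Q}\in\mathcal{M}_{\mathrm{fin}}}\sqrt{\ln\big(2N(\varepsilon\|C_{\mathbb{F}}\|_{\mathbb{Q},2},\mathbb{F},L^{2}(\mathbb{Q}))\big)}\,d\varepsilon .$$ For $t>0$, with $\vee$ denoting maximum, $$\mathfrak{f}_{n}(t):=\frac{3\sqrt{n}\,\ln\big(1+t/(5t+17)\big)}{2(\sqrt{2n}+1)}\vee\frac{t}{5t+28}.$$ *)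

theory Defs
  imports "HOL-Probability.Probability"
begin

section \<open>Probability spaces and samples\<close>

definition atomless :: "'a measure \<Rightarrow> bool" where
  "atomless M \<longleftrightarrow> (\<forall>A\<in>sets M. emeasure M A > 0 \<longrightarrow>
     (\<exists>B\<in>sets M. B \<subseteq> A \<and> 0 < emeasure M B \<and> emeasure M B < emeasure M A))"

definition iid :: "'a measure \<Rightarrow> (nat \<Rightarrow> 'a \<Rightarrow> 'b::topological_space) \<Rightarrow> 'b measure \<Rightarrow> bool" where
  \<comment> \<open>Samples are indexed by the positive integers; the value at index 0 is irrelevant.\<close>
  "iid M Z PZ \<longleftrightarrow> prob_space.indep_vars M (\<lambda>_. borel) Z {1..} \<and> (\<forall>j\<ge>1. distr M borel (Z j) = PZ)"

definition emp_cdf :: "nat \<Rightarrow> (nat \<Rightarrow> real) \<Rightarrow> real \<Rightarrow> real" where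
  "emp_cdf n y = (\<lambda>t. real (card {j\<in>{1..n}. y j \<le> t}) / real n)"

definition lsc_on :: "'a::topological_space set \<Rightarrow> ('a \<Rightarrow> 'b::linorder) \<Rightarrow> bool" where
  "lsc_on S f \<longleftrightarrow> (\<forall>x\<in>S. \<forall>a<f x. \<forall>\<^sub>F y in at x within S. a < f y)"

section \<open>Divergence risk measures\<close>

text \<open>The divergence function is only relevant on the half line \<open>{0..}\<close>; its values at
  negative arguments are never used.\<close>

definition divergence_function :: "(real \<Rightarrow> ennreal) \<Rightarrow> bool" where
  "divergence_function \<Phi> \<longleftrightarrow>
     lsc_on {0..} \<Phi> \<and>
     (\<forall>x\<ge>0. \<forall>y\<ge>0. \<forall>u\<in>{0..1}.
        \<Phi> (u * x + (1 - u) * y) \<le> ennreal u * \<Phi> x + ennreal (1 - u) * \<Phi> y) \<and>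
     \<Phi> 0 < \<infinity> \<and> (\<exists>x>1. \<Phi> x < \<infinity>) \<and>
     (INF x\<in>{0..}. \<Phi> x) = 0 \<and>
     ((\<lambda>x. \<Phi> x / ennreal x) \<longlongrightarrow> \<infinity>) at_top"

text \<open>For a divergence function the supremum is finite at every point, so the conversion to
  \<^typ>\<open>real\<close> loses nothing.\<close>

definition legendre :: "(real \<Rightarrow> ennreal) \<Rightarrow> real \<Rightarrow> real" where
  "legendre \<Phi> y = real_of_ereal (SUP x\<in>{0..}. ereal (x * y) - enn2ereal (\<Phi> x))"

definition right_deriv :: "(real \<Rightarrow> real) \<Rightarrow> real \<Rightarrow> real" where
  "right_deriv f y = Lim (at_right 0) (\<lambda>h. (f (y + h) - f y) / h)"

definition orlicz_heart :: "'a measure \<Rightarrow> (real \<Rightarrow> ennreal) \<Rightarrow> ('a \<Rightarrow> real) set" where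
  "orlicz_heart M \<Phi> = {X \<in> borel_measurable M. \<forall>c>0. integrable M (\<lambda>\<omega>. legendre \<Phi> (c * \<bar>X \<omega>\<bar>))}"

definition divergence :: "'a measure \<Rightarrow> (real \<Rightarrow> ennreal) \<Rightarrow> 'a measure \<Rightarrow> ennreal" where
  "divergence M \<Phi> Q = (\<integral>\<^sup>+\<omega>. \<Phi> (enn2real (RN_deriv M Q \<omega>)) \<partial>M)"

definition divergence_risk :: "'a measure \<Rightarrow> (real \<Rightarrow> ennreal) \<Rightarrow> ('a \<Rightarrow> real) \<Rightarrow> real" where
  "divergence_risk M \<Phi> X =
     (SUP Q\<in>{Q. prob_space Q \<and> sets Q = sets M \<and> absolutely_continuous M Q \<and> divergence M \<Phi> Q < \<infinity>}.
        (\<integral>\<omega>. X \<omega> \<partial>Q) - enn2real (divergence M \<Phi> Q))"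

text \<open>The functional on distribution functions induced by the law-invariant
  \<^const>\<open>divergence_risk\<close>; meaningful for distribution functions of members of
  \<^const>\<open>orlicz_heart\<close>.\<close>

definition risk_functional :: "'a measure \<Rightarrow> (real \<Rightarrow> ennreal) \<Rightarrow> (real \<Rightarrow> real) \<Rightarrow> real" where
  "risk_functional M \<Phi> F =
     (THE r. \<exists>X\<in>orlicz_heart M \<Phi>. cdf (distr M borel X) = F \<and> r = divergence_risk M \<Phi> X)"

section \<open>Envelopes, covering numbers and entropy integrals\<close>

definition l2_norm :: "'z measure \<Rightarrow> ('z \<Rightarrow> real) \<Rightarrow> real" where
  "l2_norm Q f = sqrt (\<integral>z. (f z)\<^sup>2 \<partial>Q)"

definition positive_envelope :: "('z::topological_space \<Rightarrow> real) set \<Rightarrow> ('z \<Rightarrow> real) \<Rightarrow> bool" where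
  "positive_envelope H C \<longleftrightarrow>
     C \<in> borel_measurable borel \<and> (\<forall>z. 0 < C z) \<and> (\<forall>h\<in>H. \<forall>z. \<bar>h z\<bar> \<le> C z)"

text \<open>In \<^typ>\<open>enat\<close> the infimum over an empty set of covers is \<open>\<infinity>\<close>.\<close>

definition covering_number :: "real \<Rightarrow> ('z \<Rightarrow> real) set \<Rightarrow> 'z measure \<Rightarrow> enat" where
  "covering_number \<eta> H Q =
     (INF C\<in>{C. finite C \<and> C \<subseteq> H \<and>
               (\<forall>h\<in>H. \<exists>c\<in>C. integrable Q (\<lambda>z. (h z - c z)\<^sup>2) \<and> l2_norm Q (\<lambda>z. h z - c z) \<le> \<eta>)}.
        enat (card C))"

definition fin_supp_probs :: "'z::topological_space measure set" where
  "fin_supp_probs = {Q. prob_space Q \<and> sets Q = sets borel \<and> (\<exists>S. finite S \<and> emeasure Q S = 1)}"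

definition sqrt_ln_double :: "enat \<Rightarrow> ennreal" where
  "sqrt_ln_double N = (case N of enat k \<Rightarrow> ennreal (sqrt (ln (2 * real k))) | \<infinity> \<Rightarrow> \<infinity>)"

definition entropy_integral ::
  "('z::topological_space \<Rightarrow> real) set \<Rightarrow> ('z \<Rightarrow> real) \<Rightarrow> real \<Rightarrow> ennreal" where
  "entropy_integral H C \<delta> =
     (\<integral>\<^sup>+\<epsilon>\<in>{0<..\<delta>}. (SUP Q\<in>fin_supp_probs. sqrt_ln_double (covering_number (\<epsilon> * l2_norm Q C) H Q)) \<partial>lborel)"

section \<open>Quantities entering the deviation inequality\<close>

text \<open>Below, \<open>PZ\<close> is the common law of the sample, so that the integral of \<open>f\<close> with respect
  to \<open>PZ\<close> is the expectation of \<open>f (Z 1)\<close>.\<close>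

definition x_upper ::
  "(real \<Rightarrow> ennreal) \<Rightarrow> 'z measure \<Rightarrow> real \<Rightarrow> ('z \<Rightarrow> real) \<Rightarrow> real \<Rightarrow> real" where
  "x_upper \<Phi> PZ x0 \<xi> \<delta> =
     (enn2real (\<Phi> x0) + (1 + x0) * \<delta> + (\<integral>z. legendre \<Phi> (\<xi> z) \<partial>PZ) + x0 * (\<integral>z. \<xi> z \<partial>PZ)) / (x0 - 1)
     + enn2real (\<Phi> 0)"

definition xi_map ::
  "(real \<Rightarrow> ennreal) \<Rightarrow> 'z measure \<Rightarrow> real \<Rightarrow> ('z \<Rightarrow> real) \<Rightarrow> real \<Rightarrow> 'z \<Rightarrow> real" where
  "xi_map \<Phi> PZ x0 \<xi> \<delta> = (\<lambda>z.
     (right_deriv (legendre \<Phi>) (\<xi> z + x_upper \<Phi> PZ x0 \<xi> \<delta>) + 1)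
       * sqrt ((\<xi> z)\<^sup>2 + (x_upper \<Phi> PZ x0 \<xi> \<delta>)\<^sup>2))"

definition A_event ::
  "'a measure \<Rightarrow> (real \<Rightarrow> ennreal) \<Rightarrow> (nat \<Rightarrow> 'a \<Rightarrow> 'z) \<Rightarrow> 'z measure \<Rightarrow> ('z \<Rightarrow> real) \<Rightarrow> real \<Rightarrow> nat \<Rightarrow> 'a set"
  where
  "A_event M \<Phi> Z PZ \<xi> \<delta> n = {\<omega>\<in>space M.
     (\<Sum>j=1..n. \<xi> (Z j \<omega>)) / real n \<le> (\<integral>z. \<xi> z \<partial>PZ) + \<delta> \<and>
     (\<Sum>j=1..n. legendre \<Phi> (\<xi> (Z j \<omega>))) / real n \<le> (\<integral>z. legendre \<Phi> (\<xi> z) \<partial>PZ) + \<delta>}"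

definition B_event ::
  "'a measure \<Rightarrow> (nat \<Rightarrow> 'a \<Rightarrow> 'z) \<Rightarrow> 'z measure \<Rightarrow> ('z \<Rightarrow> real) \<Rightarrow> nat \<Rightarrow> 'a set" where
  "B_event M Z PZ \<zeta> n = {\<omega>\<in>space M.
     (\<Sum>j=1..n. (\<zeta> (Z j \<omega>))\<^sup>2) / real n \<le> 2 * (\<integral>z. (\<zeta> z)\<^sup>2 \<partial>PZ)}"

definition rate_f :: "nat \<Rightarrow> real \<Rightarrow> real" where
  "rate_f n t =
     max (3 * sqrt (real n) * ln (1 + t / (5 * t + 17)) / (2 * (sqrt (2 * real n) + 1)))
         (t / (5 * t + 28))"

end

theory Submission
  imports Defs
begin

text \<open>
  By duality the risk is \<open>inf\<^sub>x E[\<Phi>*(X + x) - x]\<close>: a density close to optimal is a convex combination of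
  two functions \<open>s(X + x\<^sub>1)\<close>, \<open>s(X + x\<^sub>2)\<close>, where \<open>s(y)\<close> is a maximiser in the definition of \<open>\<Phi>*(y)\<close>,
  hence monotone in \<open>y\<close>, and \<open>x\<^sub>1 < x\<^sub>2\<close> are close points at which \<open>E[s(X + x)]\<close> crosses \<open>1\<close>.
  On the event \<open>A\<close> the infimum over \<open>x\<close> is attained in a fixed compact interval, for the empirical
  as well as for the true distribution. There the functions \<open>\<Phi>*(G(\<theta>,z) + x) - x\<close> are Lipschitz in
  \<open>(G(\<theta>,z), x)\<close> with a constant \<open>L(z)\<close> depending on \<open>z\<close>; a covering of their class in \<open>L\<^sup>2\<close> of a sample
  comes from a covering of the original class in \<open>L\<^sup>2\<close> of the sample reweighted by \<open>L\<^sup>2\<close>, again a measure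
  of finite support.

  The deviation inequality needs no Talagrand-type concentration. The lower bound imposed on \<open>\<epsilon>\<close>
  puts \<open>u = sqrt n * \<epsilon> / \<parallel>\<xi>\<parallel>\<close> in a range where symmetrization with a ghost sample, followed by chaining
  for the conditional Rademacher process, gives the Gaussian bound \<open>exp (-(u / 64)\<^sup>2)\<close>. As the rate
  function is at most \<open>3/10\<close>, this is smaller than the exponential bound claimed. Tightness follows
  from the same bound and the weak law of large numbers for the events \<open>A\<close> and \<open>B\<close>.
\<close>

section \<open>The Legendre transform of a divergence function\<close>

text \<open>Three obstacles lie behind the plan. The functional \<open>risk_functional\<close> reads
  a distribution function only through a variable on \<open>M\<close> that has it, so every
  empirical distribution must be realised on \<open>M\<close>, which is what atomlessness provides.
  The mean of \<open>sel (X + x)\<close> is monotone in \<open>x\<close> but may jump past 1, so a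
  single maximiser need not be a density; this forces the mixture of two. The infimum over
  \<open>\<Theta>\<close> is uncountable, so deviation events are formed over a countable set of
  parameters and shifts; a null set and completeness carry the result back.

  The shape of \<open>xi_map\<close> is dictated by the covering step: a net of members crossed with
  a grid of shifts has squared error governed by
  \<open>L\<^sup>2 * (\<xi>\<^sup>2 + U\<^sup>2)\<close> summed over the sample, and
  \<open>xi_map\<close> is the root of this weight. Rademacher probabilities are treated as counts
  of subsets of \<open>{1..n}\<close>, which keeps the conditional part free of measure
  theory.\<close>

locale divergence_fun =
  fixes \<Phi> :: "real \<Rightarrow> ennreal"
  assumes div_fun: "divergence_function \<Phi>"
begin

text \<open>Since \<open>enn2real\<close> sends \<open>\<infinity>\<close> to 0,
  \<open>\<psi>\<close> stands for \<open>\<Phi>\<close> only at points where \<open>\<Phi>\<close>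
  is finite.\<close>

definition \<psi> :: "real \<Rightarrow> real"
  where "\<psi> x = enn2real (\<Phi> x)"

abbreviation fs :: "real \<Rightarrow> real"
  where "fs \<equiv> legendre \<Phi>"

lemma enn2real_Phi: "\<Phi> x < \<infinity> \<Longrightarrow> \<Phi> x = ennreal (\<psi> x)"
  by (simp add: \<psi>_def)

lemma psi_nonneg: "0 \<le> \<psi> x"
  by (simp add: \<psi>_def)

lemma Phi_0: "\<Phi> 0 < \<infinity>"
  using div_fun by (simp add: divergence_function_def)

lemma Phi_convex:
  assumes "0 \<le> x" "0 \<le> y" "0 \<le> u" "u \<le> 1"
  shows "\<Phi> (u * x + (1 - u) * y) \<le> ennreal u * \<Phi> x + ennreal (1 - u) * \<Phi> y"
  using div_fun assms by (auto simp: divergence_function_def)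

lemma Phi_finite_convex:
  assumes "0 \<le> x" "0 \<le> y" "0 \<le> u" "u \<le> 1" "\<Phi> x < \<infinity>" "\<Phi> y < \<infinity>"
  shows "\<Phi> (u * x + (1 - u) * y) < \<infinity>"
    and "\<psi> (u * x + (1 - u) * y) \<le> u * \<psi> x + (1 - u) * \<psi> y"
proof -
  have "\<Phi> (u * x + (1 - u) * y) \<le> ennreal u * \<Phi> x + ennreal (1 - u) * \<Phi> y"
    using Phi_convex assms by blast
  also have "\<dots> = ennreal (u * \<psi> x + (1 - u) * \<psi> y)"
    using assms psi_nonneg[of x] psi_nonneg[of y]
    by (simp add: enn2real_Phi[OF assms(5)] enn2real_Phi[OF assms(6)] ennreal_mult' ennreal_plus del: ennreal_plus[symmetric])
  finally have le: "\<Phi> (u * x + (1 - u) * y) \<le> ennreal (u * \<psi> x + (1 - u) * \<psi> y)" .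
  then show fin: "\<Phi> (u * x + (1 - u) * y) < \<infinity>"
    using ennreal_less_top le_less_trans by fastforce
  have "0 \<le> u * \<psi> x + (1 - u) * \<psi> y"
    using assms psi_nonneg[of x] psi_nonneg[of y] by simp
  then show "\<psi> (u * x + (1 - u) * y) \<le> u * \<psi> x + (1 - u) * \<psi> y"
    using le by (simp add: enn2real_Phi[OF fin])
qed

lemma Phi_1: "\<Phi> 1 < \<infinity>"
proof -
  obtain x where x: "x > 1" "\<Phi> x < \<infinity>"
    using div_fun by (auto simp: divergence_function_def)
  have "\<Phi> (1 / x * x + (1 - 1 / x) * 0) < \<infinity>"
    by (rule Phi_finite_convex) (use x Phi_0 in auto)
  then show ?thesis
    using x by simp
qed

lemma psi_Inf:
  assumes "e > 0"
  obtains x where "x \<ge> 0" "\<Phi> x < \<infinity>" "\<psi> x < e"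
proof -
  have "(INF x\<in>{0..}. \<Phi> x) < ennreal e"
    using div_fun assms by (simp add: divergence_function_def)
  then obtain x where x: "x \<ge> 0" "\<Phi> x < ennreal e"
    unfolding INF_less_iff by auto
  then have "\<Phi> x < \<infinity>"
    using less_trans[OF _ ennreal_less_top] by simp
  with x have "\<psi> x < e"
    using enn2real_Phi[of x] by (simp add: ennreal_less_iff psi_nonneg)
  with x \<open>\<Phi> x < \<infinity>\<close> that show ?thesis by blast
qed

lemma superlinear:
  obtains b where "b > 0" "\<And>x. x \<ge> b \<Longrightarrow> \<Phi> x < \<infinity> \<Longrightarrow> x * K \<le> \<psi> x"
proof -
  have "((\<lambda>x. \<Phi> x / ennreal x) \<longlongrightarrow> \<infinity>) at_top"
    using div_fun by (simp add: divergence_function_def)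
  then have "eventually (\<lambda>x. ennreal \<bar>K\<bar> < \<Phi> x / ennreal x) at_top"
    by (rule order_tendstoD) simp
  then obtain b where b: "\<And>x. x \<ge> b \<Longrightarrow> ennreal \<bar>K\<bar> < \<Phi> x / ennreal x"
    by (auto simp: eventually_at_top_linorder)
  have "x * K \<le> \<psi> x" if "x \<ge> max b 1" "\<Phi> x < \<infinity>" for x
  proof -
    have "ennreal \<bar>K\<bar> < ennreal (\<psi> x) / ennreal x"
      using b[of x] that enn2real_Phi by simp
    also have "\<dots> = ennreal (\<psi> x / x)"
      using that psi_nonneg by (simp add: divide_ennreal)
    finally have "\<bar>K\<bar> < \<psi> x / x"
      by (simp add: ennreal_less_iff)
    then have "\<bar>K\<bar> * x < \<psi> x"
      using that by (simp add: pos_less_divide_eq)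
    moreover have "K * x \<le> \<bar>K\<bar> * x"
      using that by (intro mult_right_mono) auto
    ultimately show ?thesis
      by (simp add: mult.commute)
  qed
  then show ?thesis
    using that[of "max b 1"] by auto
qed

text \<open>Together the two facts say that \<open>fs y\<close> is a genuine real least upper bound;
  \<open>legendre_def\<close> is not unfolded again. Finiteness: beyond some \<open>b\<close>
  superlinear growth makes \<open>x * y - \<psi> x\<close> nonpositive, below \<open>b\<close> the
  term is at most \<open>b * \<bar>y\<bar>\<close>, and \<open>\<Phi> 0 < \<infinity>\<close>
  excludes the value \<open>-\<infinity>\<close>.\<close>

lemma legendre_props:
  shows legendre_ge: "x \<ge> 0 \<Longrightarrow> \<Phi> x < \<infinity> \<Longrightarrow> x * y - \<psi> x \<le> fs y"
    and legendre_le: "(\<And>x. x \<ge> 0 \<Longrightarrow> \<Phi> x < \<infinity> \<Longrightarrow> x * y - \<psi> x \<le> B) \<Longrightarrow> fs y \<le> B"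
proof -
  define S where "S = (SUP x\<in>{0..}. ereal (x * y) - enn2ereal (\<Phi> x))"
  have fs: "fs y = real_of_ereal S"
    by (simp add: legendre_def S_def)
  have val: "ereal (x * y) - enn2ereal (\<Phi> x) = (if \<Phi> x < \<infinity> then ereal (x * y - \<psi> x) else -\<infinity>)"
    for x
  proof (cases "\<Phi> x < \<infinity>")
    case True
    then have "enn2ereal (\<Phi> x) = ereal (\<psi> x)"
      by (subst enn2real_Phi) (auto simp only: enn2ereal_ennreal[OF psi_nonneg])
    with True show ?thesis by simp
  next
    case False
    then have "\<Phi> x = \<infinity>" by (simp add: top.not_eq_extremum[symmetric] del: top.not_eq_extremum)
    then show ?thesis by simp
  qed
  obtain b where b: "b > 0" "\<And>x. x \<ge> b \<Longrightarrow> \<Phi> x < \<infinity> \<Longrightarrow> x * y \<le> \<psi> x"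
    using superlinear by blast
  have le: "S \<le> ereal B" if "\<And>x. x \<ge> 0 \<Longrightarrow> \<Phi> x < \<infinity> \<Longrightarrow> x * y - \<psi> x \<le> B" for B
    unfolding S_def using that by (intro SUP_least) (simp add: val)
  have "S \<le> ereal (b * \<bar>y\<bar>)"
  proof (rule le)
    fix x assume x: "x \<ge> 0" "\<Phi> x < \<infinity>"
    show "x * y - \<psi> x \<le> b * \<bar>y\<bar>"
    proof (cases "x \<ge> b")
      case True
      then have "x * y \<le> \<psi> x" "0 \<le> b * \<bar>y\<bar>" using b x by auto
      then show ?thesis by linarith
    next
      case False
      have "x * y \<le> x * \<bar>y\<bar>"
        using x by (intro mult_left_mono) auto
      also have "\<dots> \<le> b * \<bar>y\<bar>"
        using False by (intro mult_right_mono) auto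
      finally have "x * y \<le> b * \<bar>y\<bar>" .
      then show ?thesis using psi_nonneg[of x] by simp
    qed
  qed
  moreover have ge: "ereal (x * y - \<psi> x) \<le> S" if "x \<ge> 0" "\<Phi> x < \<infinity>" for x
    unfolding S_def using that by (intro SUP_upper2[of x]) (auto simp: val)
  moreover have "ereal (0 * y - \<psi> 0) \<le> S"
    using ge Phi_0 by blast
  ultimately have S: "S = ereal (fs y)"
    unfolding fs by (cases S) auto
  show "x \<ge> 0 \<Longrightarrow> \<Phi> x < \<infinity> \<Longrightarrow> x * y - \<psi> x \<le> fs y"
    using ge[of x] S by simp
  show "(\<And>x. x \<ge> 0 \<Longrightarrow> \<Phi> x < \<infinity> \<Longrightarrow> x * y - \<psi> x \<le> B) \<Longrightarrow> fs y \<le> B"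
    using le[of B] S by simp
qed

lemma legendre_attained: "\<exists>x\<ge>0. \<Phi> x < \<infinity> \<and> fs y = x * y - \<psi> x"
proof -
  have "\<exists>x\<ge>0. \<Phi> x < \<infinity> \<and> x * y - \<psi> x > fs y - inverse (real (Suc n))" for n
  proof (rule ccontr)
    assume "\<not> ?thesis"
    then have "fs y \<le> fs y - inverse (real (Suc n))"
      by (intro legendre_le) force
    then show False by simp
  qed
  then have "\<exists>s. \<forall>n. s n \<ge> 0 \<and> \<Phi> (s n) < \<infinity> \<and> s n * y - \<psi> (s n) > fs y - inverse (real (Suc n))"
    by (intro choice allI)
  then obtain s where s: "\<And>n. s n \<ge> 0" "\<And>n. \<Phi> (s n) < \<infinity>"
      "\<And>n. s n * y - \<psi> (s n) > fs y - inverse (real (Suc n))"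
    by blast
  \<comment> \<open>The slope is \<open>y + 1\<close> instead of \<open>y\<close>: the extra summand
    \<open>s n\<close> is then bounded by \<open>1 - fs y\<close>, which keeps the near-maximisers
    in a compact interval.\<close>
  obtain b where b: "b > 0" "\<And>x. x \<ge> b \<Longrightarrow> \<Phi> x < \<infinity> \<Longrightarrow> x * (y + 1) \<le> \<psi> x"
    using superlinear by blast
  have "s n \<in> {0..max b (1 - fs y)}" for n
  proof -
    have "s n \<le> 1 - fs y" if "s n \<ge> b"
    proof -
      have "s n * y + s n \<le> \<psi> (s n)"
        using b(2)[OF that s(2)] by (simp add: algebra_simps)
      moreover have "inverse (real (Suc n)) \<le> 1"
        by (simp add: field_simps)
      ultimately show ?thesis using s(3)[of n] by linarith
    qed
    then show ?thesis using s(1)[of n] by (cases "s n \<ge> b") (auto simp: le_max_iff_disj)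
  qed
  then obtain l r where l: "l \<in> {0..max b (1 - fs y)}" and r: "strict_mono r" "(s \<circ> r) \<longlonglongrightarrow> l"
    using compact_Icc[of 0 "max b (1 - fs y)"] unfolding compact_def by blast
  have l0: "l \<ge> 0" using l by simp
  have inv: "(\<lambda>n. inverse (real (Suc (r n)))) \<longlonglongrightarrow> 0"
    using LIMSEQ_subseq_LIMSEQ[OF LIMSEQ_inverse_real_of_nat r(1)] by (simp add: o_def)
  have lim: "(\<lambda>n. s (r n) * y - fs y + inverse (real (Suc (r n)))) \<longlonglongrightarrow> l * y - fs y + 0"
    using r(2) inv by (intro tendsto_intros) (auto simp: o_def)
  \<comment> \<open>Lower semicontinuity at the limit \<open>l\<close>: a value above
    \<open>a\<close> would persist along the subsequence, whereas near-maximality pushes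
    \<open>\<psi>\<close> down to \<open>l * y - fs y\<close>, which is below
    \<open>a\<close>.\<close>
  have "\<Phi> l \<le> ennreal a" if a: "a \<ge> 0" "a > l * y - fs y" for a
  proof (rule ccontr)
    assume "\<not> ?thesis"
    then have less: "ennreal a < \<Phi> l" by simp
    have "lsc_on {0..} \<Phi>"
      using div_fun by (simp add: divergence_function_def)
    then have "\<forall>\<^sub>F x in at l within {0..}. ennreal a < \<Phi> x"
      using less l0 by (auto simp: lsc_on_def)
    then have "\<forall>\<^sub>F x in nhds l. x \<noteq> l \<longrightarrow> x \<in> {0..} \<longrightarrow> ennreal a < \<Phi> x"
      by (simp add: eventually_at_filter)
    \<comment> \<open>The punctured neighbourhood is completed by \<open>l\<close> itself, since the
      subsequence may hit its limit.\<close>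
    then have "\<forall>\<^sub>F x in nhds l. x \<in> {0..} \<longrightarrow> ennreal a < \<Phi> x"
      by eventually_elim (use less in blast)
    then have "\<forall>\<^sub>F n in sequentially. (s \<circ> r) n \<in> {0..} \<longrightarrow> ennreal a < \<Phi> ((s \<circ> r) n)"
      using r(2) by (auto simp: filterlim_iff)
    then have "\<forall>\<^sub>F n in sequentially. a < s (r n) * y - fs y + inverse (real (Suc (r n)))"
    proof eventually_elim
      case (elim n)
      then have "ennreal a < ennreal (\<psi> (s (r n)))"
        using s(1) enn2real_Phi[OF s(2)] by simp
      then have "a < \<psi> (s (r n))"
        using a by (simp add: ennreal_less_iff)
      then show ?case using s(3)[of "r n"] by linarith
    qed
    then have "a \<le> l * y - fs y + 0"
      by (intro tendsto_lowerbound[OF lim]) (auto elim: eventually_mono)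
    with a show False by simp
  qed note bound = this
  have "\<Phi> l \<le> ennreal (max 0 (l * y - fs y) + 1)"
    by (rule bound) auto
  then have fin: "\<Phi> l < \<infinity>"
    using ennreal_less_top le_less_trans by fastforce
  have "\<psi> l \<le> l * y - fs y"
  proof (rule ccontr)
    assume "\<not> ?thesis"
    then obtain a where a: "l * y - fs y < a" "a < \<psi> l"
      using dense[of "l * y - fs y" "\<psi> l"] by (auto simp: not_le)
    have "0 \<le> l * y - fs y + 0"
    proof (rule tendsto_lowerbound[OF lim], rule always_eventually, rule allI)
      fix n show "0 \<le> s (r n) * y - fs y + inverse (real (Suc (r n)))"
        using s(3)[of "r n"] psi_nonneg[of "s (r n)"] by linarith
    qed simp
    then have "0 \<le> a" using a(1) by linarith
    then have "ennreal (\<psi> l) \<le> ennreal a"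
      using bound[of a] a(1) by (simp only: enn2real_Phi[OF fin])
    with a(2) \<open>0 \<le> a\<close> show False by simp
  qed
  then show ?thesis
    using l0 fin legendre_ge[OF l0 fin, of y] by (intro exI[of _ l]) auto
qed

section \<open>A selection of maximisers as subgradient of the conjugate\<close>

definition sel :: "real \<Rightarrow> real"
  where "sel y = (SOME x. x \<ge> 0 \<and> \<Phi> x < \<infinity> \<and> fs y = x * y - \<psi> x)"

lemma sel_props:
  shows sel_nonneg: "sel y \<ge> 0" and Phi_sel: "\<Phi> (sel y) < \<infinity>"
    and fs_sel: "fs y = sel y * y - \<psi> (sel y)"
  using someI_ex[OF legendre_attained[of y]] by (auto simp: sel_def)

lemma sel_subgradient: "fs y + sel y * (z - y) \<le> fs z"
  using legendre_ge[OF sel_nonneg Phi_sel, of y z] fs_sel[of y] by (simp add: algebra_simps)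

text \<open>Adding the subgradient inequalities at \<open>y\<close> and at \<open>z\<close> gives
  monotonicity for any choice of maximisers. It also makes the arbitrary choice \<open>sel\<close>
  Borel measurable.\<close>

lemma sel_mono: "y \<le> z \<Longrightarrow> sel y \<le> sel z"
proof -
  assume "y \<le> z"
  have "(sel z - sel y) * (z - y) \<ge> 0"
    using sel_subgradient[of y z] sel_subgradient[of z y] by (simp add: algebra_simps)
  then show ?thesis
    using \<open>y \<le> z\<close> by (cases "y = z") (auto simp: zero_le_mult_iff)
qed

lemma fs_mono: "y \<le> z \<Longrightarrow> fs y \<le> fs z"
  using sel_subgradient[of y z] mult_nonneg_nonneg[OF sel_nonneg[of y], of "z - y"] by simp

lemma fs_0: "fs 0 = 0"
proof (rule antisym)
  show "fs 0 \<le> 0"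
    by (rule legendre_le) (simp add: psi_nonneg)
  show "0 \<le> fs 0"
  proof (rule field_le_epsilon)
    fix e :: real assume "e > 0"
    then obtain x where "x \<ge> 0" "\<Phi> x < \<infinity>" "\<psi> x < e"
      by (rule psi_Inf)
    then show "0 \<le> fs 0 + e"
      using legendre_ge[of x 0] by simp
  qed
qed

lemma fs_nonneg: "y \<ge> 0 \<Longrightarrow> fs y \<ge> 0"
  using fs_mono[of 0 y] fs_0 by simp

lemma fs_ge_psi_0: "- \<psi> 0 \<le> fs y"
  using legendre_ge[of 0 y] Phi_0 by simp

lemma fs_ge_psi_1: "y - \<psi> 1 \<le> fs y"
  using legendre_ge[of 1 y] Phi_1 by simp

lemma abs_fs_le: "\<bar>fs y\<bar> \<le> fs \<bar>y\<bar> + \<psi> 0"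
  using fs_mono[of y "\<bar>y\<bar>"] fs_ge_psi_0[of y] fs_nonneg[of "\<bar>y\<bar>"] psi_nonneg[of 0] by linarith

lemma fs_convex: "convex_on UNIV fs"
proof (rule convex_onI)
  fix t x y :: real
  assume t: "t > 0" "t < 1"
  define w where "w = (1 - t) * x + t * y"
  have "(1 - t) * (fs w + sel w * (x - w)) + t * (fs w + sel w * (y - w))
      = fs w + sel w * (((1 - t) * x + t * y) - w)"
    by (simp add: algebra_simps)
  then have "fs w = (1 - t) * (fs w + sel w * (x - w)) + t * (fs w + sel w * (y - w))"
    by (simp add: w_def)
  also have "\<dots> \<le> (1 - t) * fs x + t * fs y"
    using t by (intro add_mono mult_left_mono sel_subgradient) auto
  finally show "fs ((1 - t) *\<^sub>R x + t *\<^sub>R y) \<le> (1 - t) * fs x + t * fs y"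
    by (simp add: w_def)
qed auto

lemma fs_continuous: "continuous_on A fs"
  using convex_on_continuous[OF open_UNIV fs_convex] continuous_on_subset by blast

lemma borel_measurable_fs [measurable]: "fs \<in> borel_measurable borel"
  by (rule borel_measurable_continuous_onI[OF fs_continuous])

lemma borel_measurable_sel [measurable]: "sel \<in> borel_measurable borel"
  by (rule borel_measurable_mono) (simp add: mono_def sel_mono)

text \<open>By convexity the difference quotients \<open>q h\<close> shrink as \<open>h\<close>
  decreases to 0, and \<open>sel y\<close> bounds them from below. So the limit exists and equals
  their infimum, which yields both inequalities.\<close>

lemma right_deriv_props:
  shows sel_le_right_deriv: "sel y \<le> right_deriv fs y"
    and right_deriv_le_slope: "y < z \<Longrightarrow> right_deriv fs y * (z - y) \<le> fs z - fs y"
proof -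
  define q where "q h = (fs (y + h) - fs y) / h" for h
  have q_ge: "sel y \<le> q h" if "h > 0" for h
    using sel_subgradient[of y "y + h"] that by (simp add: q_def field_simps)
  have q_mono: "q h \<le> q k" if "0 < h" "h \<le> k" for h k
  proof -
    have "fs ((1 - h / k) *\<^sub>R y + (h / k) *\<^sub>R (y + k)) \<le> (1 - h / k) * fs y + h / k * fs (y + k)"
      by (rule convex_onD[OF fs_convex]) (use that in \<open>auto simp: field_simps\<close>)
    moreover have "(1 - h / k) *\<^sub>R y + (h / k) *\<^sub>R (y + k) = y + h"
      using that by (simp add: field_simps)
    ultimately have "fs (y + h) \<le> (1 - h / k) * fs y + h / k * fs (y + k)"
      by metis
    then show ?thesis
      using that by (simp add: q_def field_simps)
  qed
  define r where "r = Inf (q ` {0<..})"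
  have bdd: "bdd_below (q ` {0<..})"
    by (rule bdd_belowI[of _ "sel y"]) (auto intro: q_ge)
  have r_le: "r \<le> q h" if "h > 0" for h
    unfolding r_def using that bdd by (intro cInf_lower) auto
  have "(q \<longlongrightarrow> r) (at_right 0)"
  proof (rule order_tendstoI)
    fix a assume "a < r"
    then have "a < q h" if "h > 0" for h
      using r_le[OF that] by simp
    then show "\<forall>\<^sub>F h in at_right 0. a < q h"
      by (auto simp: eventually_at_right_field intro!: exI[of _ 1])
  next
    fix a assume "r < a"
    then obtain k where k: "k > 0" "q k < a"
      unfolding r_def by (subst (asm) cInf_less_iff) (use bdd in auto)
    then show "\<forall>\<^sub>F h in at_right 0. q h < a"
      unfolding eventually_at_right_field
      using le_less_trans[OF q_mono[of _ k]] by (intro exI[of _ k]) auto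
  qed
  then have r: "right_deriv fs y = r"
    unfolding right_deriv_def q_def[symmetric] by (intro tendsto_Lim) auto
  show "sel y \<le> right_deriv fs y"
    unfolding r r_def by (rule cInf_greatest) (auto intro: q_ge)
  show "right_deriv fs y * (z - y) \<le> fs z - fs y" if "y < z"
    using r_le[of "z - y"] that unfolding r by (simp add: q_def field_simps)
qed

lemma right_deriv_nonneg: "0 \<le> right_deriv fs y"
  using sel_nonneg[of y] sel_le_right_deriv[of y] by simp

lemma right_deriv_mono:
  assumes "y \<le> z"
  shows "right_deriv fs y \<le> right_deriv fs z"
proof (cases "y = z")
  case False
  with assms have "y < z" by simp
  have "right_deriv fs y * (z - y) \<le> sel z * (z - y)"
    using right_deriv_le_slope[OF \<open>y < z\<close>] sel_subgradient[of z y] by (simp add: algebra_simps)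
  then have "right_deriv fs y \<le> sel z"
    using \<open>y < z\<close> by simp
  then show ?thesis using sel_le_right_deriv[of z] by simp
qed simp

lemma fs_diff_le:
  assumes "a \<le> b" "b \<le> c"
  shows "fs b - fs a \<le> right_deriv fs c * (b - a)"
proof -
  have "fs b - fs a \<le> sel b * (b - a)"
    using sel_subgradient[of b a] by (simp add: algebra_simps)
  also have "\<dots> \<le> right_deriv fs c * (b - a)"
    using assms sel_le_right_deriv[of b] right_deriv_mono[of b c]
    by (intro mult_right_mono) auto
  finally show ?thesis .
qed

lemma fs_Lipschitz:
  assumes "a \<le> c" "b \<le> c"
  shows "\<bar>fs a - fs b\<bar> \<le> right_deriv fs c * \<bar>a - b\<bar>"
  using fs_diff_le[of a b c] fs_diff_le[of b a c] fs_mono[of a b] fs_mono[of b a] assms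
  by (cases "a \<le> b") (auto simp: abs_if)

text \<open>Trades the subgradient for a value of \<open>fs\<close> a step \<open>r\<close> further
  on. With \<open>r = 1\<close> and \<open>r = \<bar>X \<omega>\<bar>\<close> it gives the
  integrability of \<open>sel (X + x)\<close> and of \<open>sel (X + x) * X\<close>.\<close>

lemma sel_le_slope: "0 \<le> r \<Longrightarrow> sel y * r \<le> fs (y + r) + \<psi> 0"
  using sel_subgradient[of y "y + r"] fs_ge_psi_0[of y] by simp

lemma sel_ge_slope: "fs y - fs (y - r) \<le> sel y * r"
  using sel_subgradient[of y "y - r"] by simp

text \<open>Convexity turns the sublevel sets of \<open>\<Phi>\<close> on the half line into
  intervals, hence Borel sets. Nothing is known about \<open>\<Phi>\<close> at negative arguments,
  so \<open>D\<close> is required to be nonnegative.\<close>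

lemma measurable_Phi:
  assumes D: "D \<in> borel_measurable M" "\<And>\<omega>. 0 \<le> D \<omega>"
  shows "(\<lambda>\<omega>. \<Phi> (D \<omega>)) \<in> borel_measurable M"
proof (rule borel_measurableI_le)
  fix a
  have "is_interval {x. x \<ge> 0 \<and> \<Phi> x \<le> a}"
    unfolding is_interval_convex_1
  proof (rule convexI)
    fix x y u v :: real
    assume xy: "x \<in> {x. x \<ge> 0 \<and> \<Phi> x \<le> a}" "y \<in> {x. x \<ge> 0 \<and> \<Phi> x \<le> a}"
      and uv: "0 \<le> u" "0 \<le> v" "u + v = 1"
    have v: "v = 1 - u" using uv by simp
    have "\<Phi> (u * x + (1 - u) * y) \<le> ennreal u * \<Phi> x + ennreal (1 - u) * \<Phi> y"
      using xy uv by (intro Phi_convex) auto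
    also have "\<dots> \<le> ennreal u * a + ennreal (1 - u) * a"
      using xy by (intro add_mono mult_left_mono) auto
    also have "\<dots> = a"
      using uv by (simp flip: distrib_right ennreal_plus)
    finally show "u *\<^sub>R x + v *\<^sub>R y \<in> {x. x \<ge> 0 \<and> \<Phi> x \<le> a}"
      using xy uv v by auto
  qed
  then have "{x. x \<ge> 0 \<and> \<Phi> x \<le> a} \<in> sets borel"
    by (rule real_interval_borel_measurable)
  then have "D -` {x. x \<ge> 0 \<and> \<Phi> x \<le> a} \<inter> space M \<in> sets M"
    by (rule measurable_sets[OF D(1)])
  also have "D -` {x. x \<ge> 0 \<and> \<Phi> x \<le> a} \<inter> space M = {\<omega> \<in> space M. \<Phi> (D \<omega>) \<le> a}"
    using D(2) by auto
  finally show "{\<omega> \<in> space M. \<Phi> (D \<omega>) \<le> a} \<in> sets M" .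
qed

end

section \<open>Dual representation of the divergence risk measure\<close>

locale divergence_prob = divergence_fun \<Phi> + prob_space M
  for \<Phi> :: "real \<Rightarrow> ennreal" and M :: "'a measure"
begin

section \<open>Integrability in the Orlicz heart\<close>

lemma heart_measurable: "X \<in> orlicz_heart M \<Phi> \<Longrightarrow> X \<in> borel_measurable M"
  by (simp add: orlicz_heart_def)

text \<open>The bound \<open>a * \<bar>X\<bar> + c\<close> is the midpoint of
  \<open>2 * a * \<bar>X\<bar>\<close> and \<open>2 * c\<close>, so convexity separates the
  constant; the heart admits every positive multiple of \<open>\<bar>X\<bar>\<close>.\<close>

lemma heart_integrable_fs:
  assumes X: "X \<in> orlicz_heart M \<Phi>" and Y: "Y \<in> borel_measurable M"
    and le: "\<And>\<omega>. \<omega> \<in> space M \<Longrightarrow> \<bar>Y \<omega>\<bar> \<le> a * \<bar>X \<omega>\<bar> + c" and "a > 0" "c \<ge> 0"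
  shows "integrable M (\<lambda>\<omega>. fs (Y \<omega>))"
proof (rule Bochner_Integration.integrable_bound)
  show "integrable M (\<lambda>\<omega>. fs ((2 * a) * \<bar>X \<omega>\<bar>) + (fs (2 * c) + \<psi> 0))"
    using X \<open>a > 0\<close> by (auto simp: orlicz_heart_def)
  show "(\<lambda>\<omega>. fs (Y \<omega>)) \<in> borel_measurable M"
    using Y by measurable
  show "AE \<omega> in M. norm (fs (Y \<omega>)) \<le> norm (fs ((2 * a) * \<bar>X \<omega>\<bar>) + (fs (2 * c) + \<psi> 0))"
  proof (rule AE_I2)
    fix \<omega> assume "\<omega> \<in> space M"
    then have "fs \<bar>Y \<omega>\<bar> \<le> fs (a * \<bar>X \<omega>\<bar> + c)"
      by (intro fs_mono le)
    also have "\<dots> = fs ((1 - 1/2) *\<^sub>R (2 * a * \<bar>X \<omega>\<bar>) + (1/2) *\<^sub>R (2 * c))"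
      by simp
    also have "\<dots> \<le> (1 - 1/2) * fs (2 * a * \<bar>X \<omega>\<bar>) + 1/2 * fs (2 * c)"
      by (rule convex_onD[OF fs_convex]) auto
    also have "\<dots> \<le> fs (2 * a * \<bar>X \<omega>\<bar>) + fs (2 * c)"
      using fs_nonneg[of "2 * c"] fs_nonneg[of "2 * a * \<bar>X \<omega>\<bar>"] \<open>a > 0\<close> \<open>c \<ge> 0\<close> by simp
    finally show "norm (fs (Y \<omega>)) \<le> norm (fs ((2 * a) * \<bar>X \<omega>\<bar>) + (fs (2 * c) + \<psi> 0))"
      using abs_fs_le[of "Y \<omega>"] by simp
  qed
qed

lemma heart_integrable_fs_add: "X \<in> orlicz_heart M \<Phi> \<Longrightarrow> integrable M (\<lambda>\<omega>. fs (X \<omega> + x))"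
  by (rule heart_integrable_fs[of X _ 1 "\<bar>x\<bar>"])
    (use heart_measurable[of X] in \<open>auto intro!: borel_measurable_add\<close>)

lemma heart_integrable_fs_abs: "X \<in> orlicz_heart M \<Phi> \<Longrightarrow> integrable M (\<lambda>\<omega>. fs \<bar>X \<omega>\<bar>)"
  by (rule heart_integrable_fs[of X _ 1 0]) (auto dest: heart_measurable)

lemma heart_integrable: 
  assumes X: "X \<in> orlicz_heart M \<Phi>"
  shows "integrable M X"
proof (rule Bochner_Integration.integrable_bound)
  show "integrable M (\<lambda>\<omega>. fs \<bar>X \<omega>\<bar> + \<psi> 1)"
    using heart_integrable_fs_abs[OF X] by simp
  show "AE \<omega> in M. norm (X \<omega>) \<le> norm (fs \<bar>X \<omega>\<bar> + \<psi> 1)"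
    using fs_ge_psi_1 by (auto intro!: AE_I2) (smt (verit))
qed (simp add: heart_measurable[OF X])

lemma heart_dominated:
  assumes X: "X \<in> orlicz_heart M \<Phi>" and Y: "Y \<in> borel_measurable M"
    and le: "\<And>\<omega>. \<omega> \<in> space M \<Longrightarrow> \<bar>Y \<omega>\<bar> \<le> \<bar>X \<omega>\<bar>"
  shows "Y \<in> orlicz_heart M \<Phi>"
  unfolding orlicz_heart_def
proof (intro CollectI conjI allI impI)
  fix c :: real assume "c > 0"
  then show "integrable M (\<lambda>\<omega>. fs (c * \<bar>Y \<omega>\<bar>))"
    using le Y by (intro heart_integrable_fs[OF X, of _ c 0]) (auto simp: abs_mult)
qed fact

section \<open>Weak and strong duality\<close>

definition feasible :: "'a measure set"
  where "feasible = {Q. prob_space Q \<and> sets Q = sets M \<and> absolutely_continuous M Q \<and> divergence M \<Phi> Q < \<infinity>}"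

text \<open>Weak duality: Young's inequality \<open>D * (X + x) \<le> fs (X + x) + \<psi> D\<close>
  for the density \<open>D\<close>, integrated using that \<open>D\<close> has mean 1. The
  extended-valued \<open>RN_deriv\<close> and \<open>\<Phi> (D \<omega>)\<close> are finite only
  almost everywhere, hence the \<open>AE\<close> arguments.\<close>

lemma feasible_le:
  assumes X: "X \<in> orlicz_heart M \<Phi>" and Q: "Q \<in> feasible"
  shows "(\<integral>\<omega>. X \<omega> \<partial>Q) - enn2real (divergence M \<Phi> Q) \<le> (\<integral>\<omega>. fs (X \<omega> + x) \<partial>M) - x"
proof -
  have Q': "prob_space Q" "sets Q = sets M" "absolutely_continuous M Q" "divergence M \<Phi> Q < \<infinity>"
    using Q by (auto simp: feasible_def)
  interpret Q: prob_space Q by fact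
  note [measurable] = heart_measurable[OF X]
  define D where "D \<omega> = enn2real (RN_deriv M Q \<omega>)" for \<omega>
  have D[measurable]: "D \<in> borel_measurable M" and D0: "\<And>\<omega>. 0 \<le> D \<omega>"
    unfolding D_def by auto
  have dens: "density M (RN_deriv M Q) = Q"
    using Q' by (intro density_RN_deriv) auto
  have one: "(\<integral>\<^sup>+\<omega>. RN_deriv M Q \<omega> \<partial>M) = 1"
  proof -
    have "emeasure Q (space Q) = (\<integral>\<^sup>+\<omega>. RN_deriv M Q \<omega> * indicator (space M) \<omega> \<partial>M)"
      using sets_eq_imp_space_eq[OF Q'(2)] by (subst dens[symmetric]) (simp add: emeasure_density)
    also have "\<dots> = (\<integral>\<^sup>+\<omega>. RN_deriv M Q \<omega> \<partial>M)"
      by (intro nn_integral_cong) simp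
    finally show ?thesis by (simp add: Q.emeasure_space_1)
  qed
  then have "AE \<omega> in M. RN_deriv M Q \<omega> \<noteq> \<infinity>"
    by (intro nn_integral_PInf_AE) auto
  then have AED: "AE \<omega> in M. RN_deriv M Q \<omega> = ennreal (D \<omega>)"
    unfolding D_def by eventually_elim (simp add: less_top)
  have densD: "density M (\<lambda>\<omega>. ennreal (D \<omega>)) = Q"
    using AED by (subst dens[symmetric], intro density_cong) (auto elim: eventually_mono)
  have nnD: "(\<integral>\<^sup>+\<omega>. ennreal (D \<omega>) \<partial>M) = 1"
    unfolding one[symmetric] using AED by (intro nn_integral_cong_AE) (auto elim: eventually_mono)
  then have intD: "integrable M D"
    using D0 by (intro integrableI_nn_integral_finite[of _ _ 1]) auto
  have ED: "(\<integral>\<omega>. D \<omega> \<partial>M) = 1"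
    using nnD D0 by (simp add: integral_eq_nn_integral)
  have mPhi[measurable]: "(\<lambda>\<omega>. \<Phi> (D \<omega>)) \<in> borel_measurable M"
    using D D0 by (rule measurable_Phi)
  have divD: "divergence M \<Phi> Q = (\<integral>\<^sup>+\<omega>. \<Phi> (D \<omega>) \<partial>M)"
    unfolding divergence_def D_def ..
  then have "AE \<omega> in M. \<Phi> (D \<omega>) \<noteq> \<infinity>"
    using Q'(4) by (intro nn_integral_PInf_AE) auto
  then have AEfin: "AE \<omega> in M. \<Phi> (D \<omega>) < \<infinity>"
    by eventually_elim (simp add: less_top)
  have m\<psi>[measurable]: "(\<lambda>\<omega>. \<psi> (D \<omega>)) \<in> borel_measurable M"
    unfolding \<psi>_def by measurable
  have nn\<psi>: "(\<integral>\<^sup>+\<omega>. ennreal (\<psi> (D \<omega>)) \<partial>M) = divergence M \<Phi> Q"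
    unfolding divD using AEfin enn2real_Phi
    by (intro nn_integral_cong_AE) (auto elim!: eventually_mono)
  then have int\<psi>: "integrable M (\<lambda>\<omega>. \<psi> (D \<omega>))"
    using psi_nonneg Q'(4) by (intro integrableI_nonneg) auto
  have E\<psi>: "(\<integral>\<omega>. \<psi> (D \<omega>) \<partial>M) = enn2real (divergence M \<Phi> Q)"
    using nn\<psi> psi_nonneg by (simp add: integral_eq_nn_integral)
  have intDX: "integrable M (\<lambda>\<omega>. D \<omega> * X \<omega>)"
  proof (rule Bochner_Integration.integrable_bound)
    show "integrable M (\<lambda>\<omega>. fs \<bar>X \<omega>\<bar> + \<psi> (D \<omega>))"
      using int\<psi> heart_integrable_fs_abs[OF X] by simp
    show "AE \<omega> in M. norm (D \<omega> * X \<omega>) \<le> norm (fs \<bar>X \<omega>\<bar> + \<psi> (D \<omega>))"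
      using AEfin
    proof eventually_elim
      case (elim \<omega>)
      show ?case
        using legendre_ge[OF D0 elim, of "\<bar>X \<omega>\<bar>"] D0[of \<omega>] by (simp add: abs_mult)
    qed
  qed measurable
  have "(\<integral>\<omega>. X \<omega> \<partial>Q) = (\<integral>\<omega>. D \<omega> * X \<omega> \<partial>M)"
    by (subst densD[symmetric], rule integral_real_density) (auto simp: D0)
  also have "\<dots> \<le> (\<integral>\<omega>. fs (X \<omega> + x) + \<psi> (D \<omega>) - x * D \<omega> \<partial>M)"
  proof (rule integral_mono_AE)
    show "integrable M (\<lambda>\<omega>. fs (X \<omega> + x) + \<psi> (D \<omega>) - x * D \<omega>)"
      using heart_integrable_fs_add[OF X] int\<psi> intD by simp
    show "AE \<omega> in M. D \<omega> * X \<omega> \<le> fs (X \<omega> + x) + \<psi> (D \<omega>) - x * D \<omega>"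
      using AEfin
    proof eventually_elim
      case (elim \<omega>)
      show ?case
        using legendre_ge[OF D0 elim, of "X \<omega> + x"] by (simp add: algebra_simps)
    qed
  qed fact
  also have "\<dots> = (\<integral>\<omega>. fs (X \<omega> + x) \<partial>M) + enn2real (divergence M \<Phi> Q) - x"
    using heart_integrable_fs_add[OF X] int\<psi> intD E\<psi> ED by simp
  finally show ?thesis by simp
qed

text \<open>The penalty is only bounded by \<open>e\<close>, because for a convex combination of
  maximisers convexity supplies an upper bound and not the value of
  \<open>\<psi> (D \<omega>)\<close>.\<close>

lemma feasible_density:
  assumes D[measurable]: "D \<in> borel_measurable M" and D0: "\<And>\<omega>. 0 \<le> D \<omega>"
    and int: "integrable M D" "(\<integral>\<omega>. D \<omega> \<partial>M) = 1"
    and fin: "\<And>\<omega>. \<Phi> (D \<omega>) < \<infinity>" and e: "integrable M e" "\<And>\<omega>. \<psi> (D \<omega>) \<le> e \<omega>"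
    and X[measurable]: "X \<in> borel_measurable M"
  shows "density M D \<in> feasible"
    and "(\<integral>\<omega>. X \<omega> \<partial>density M D) - enn2real (divergence M \<Phi> (density M D)) \<ge> (\<integral>\<omega>. D \<omega> * X \<omega> \<partial>M) - (\<integral>\<omega>. e \<omega> \<partial>M)"
proof -
  let ?Q = "density M (\<lambda>\<omega>. ennreal (D \<omega>))"
  have nn: "(\<integral>\<^sup>+\<omega>. ennreal (D \<omega>) \<partial>M) = 1"
    using int D0 by (simp add: nn_integral_eq_integral)
  have p: "prob_space ?Q"
    by (rule prob_spaceI) (simp add: emeasure_density nn cong: nn_integral_cong)
  have ac: "absolutely_continuous M ?Q"
    by (intro absolutely_continuousI_density) simp
  have RN: "AE \<omega> in M. ennreal (D \<omega>) = RN_deriv M ?Q \<omega>"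
    by (rule RN_deriv_unique) auto
  have m[measurable]: "(\<lambda>\<omega>. \<psi> (D \<omega>)) \<in> borel_measurable M"
    unfolding \<psi>_def using measurable_Phi[OF D D0] by measurable
  have int\<psi>: "integrable M (\<lambda>\<omega>. \<psi> (D \<omega>))"
    using e psi_nonneg by (intro Bochner_Integration.integrable_bound[OF e(1)])
      (auto intro!: AE_I2 order_trans[OF _ abs_ge_self])
  have "divergence M \<Phi> ?Q = (\<integral>\<^sup>+\<omega>. ennreal (\<psi> (D \<omega>)) \<partial>M)"
    unfolding divergence_def using RN
  proof (intro nn_integral_cong_AE, eventually_elim)
    case (elim \<omega>)
    then have "enn2real (RN_deriv M ?Q \<omega>) = D \<omega>"
      using D0[of \<omega>] by (metis enn2real_ennreal)
    then show ?case
      by (simp only: enn2real_Phi[OF fin[of \<omega>]])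
  qed
  also have "\<dots> = ennreal (\<integral>\<omega>. \<psi> (D \<omega>) \<partial>M)"
    using int\<psi> psi_nonneg by (simp add: nn_integral_eq_integral)
  finally have div: "divergence M \<Phi> ?Q = ennreal (\<integral>\<omega>. \<psi> (D \<omega>) \<partial>M)" .
  show "?Q \<in> feasible"
    using p ac div by (simp add: feasible_def)
  have "enn2real (divergence M \<Phi> ?Q) = (\<integral>\<omega>. \<psi> (D \<omega>) \<partial>M)"
    unfolding div using psi_nonneg by (simp add: integral_nonneg_AE)
  also have "\<dots> \<le> (\<integral>\<omega>. e \<omega> \<partial>M)"
    using int\<psi> e by (intro Bochner_Integration.integral_mono) auto
  finally show "(\<integral>\<omega>. X \<omega> \<partial>?Q) - enn2real (divergence M \<Phi> ?Q) \<ge> (\<integral>\<omega>. D \<omega> * X \<omega> \<partial>M) - (\<integral>\<omega>. e \<omega> \<partial>M)"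
    by (simp add: integral_real_density D0)
qed

lemma risk_objective_bdd_below:
  assumes X: "X \<in> orlicz_heart M \<Phi>"
  shows "(\<integral>\<omega>. X \<omega> \<partial>M) - \<psi> 1 \<le> (\<integral>\<omega>. fs (X \<omega> + x) \<partial>M) - x"
proof -
  have "(\<integral>\<omega>. X \<omega> + x - \<psi> 1 \<partial>M) \<le> (\<integral>\<omega>. fs (X \<omega> + x) \<partial>M)"
    using heart_integrable[OF X] heart_integrable_fs_add[OF X]
    by (intro Bochner_Integration.integral_mono) (auto intro: fs_ge_psi_1)
  then show ?thesis
    using heart_integrable[OF X] by (simp add: prob_space)
qed

text \<open>Were \<open>m x = 1\<close> for some \<open>x\<close>, the density
  \<open>sel (X + x)\<close> would give exactly \<open>h x\<close>. As \<open>m\<close> may jump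
  past 1, points on both sides of the jump are mixed, and the loss is at most their
  distance.\<close>

lemma divergence_risk_eq:
  assumes X: "X \<in> orlicz_heart M \<Phi>"
  shows "divergence_risk M \<Phi> X = (INF x. (\<integral>\<omega>. fs (X \<omega> + x) \<partial>M) - x)"
proof -
  define h where "h x = (\<integral>\<omega>. fs (X \<omega> + x) \<partial>M) - x" for x
  note mX[measurable] = heart_measurable[OF X]
  define m where "m x = (\<integral>\<omega>. sel (X \<omega> + x) \<partial>M)" for x
  have int_sel: "integrable M (\<lambda>\<omega>. sel (X \<omega> + x))" for x
  proof (rule Bochner_Integration.integrable_bound)
    show "integrable M (\<lambda>\<omega>. fs (X \<omega> + (x + 1)) + \<psi> 0)"
      using heart_integrable_fs_add[OF X] by simp
    show "AE \<omega> in M. norm (sel (X \<omega> + x)) \<le> norm (fs (X \<omega> + (x + 1)) + \<psi> 0)"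
    proof (rule AE_I2)
      fix \<omega>
      show "norm (sel (X \<omega> + x)) \<le> norm (fs (X \<omega> + (x + 1)) + \<psi> 0)"
        using sel_le_slope[of 1 "X \<omega> + x"] sel_nonneg[of "X \<omega> + x"] by (simp add: algebra_simps)
    qed
  qed measurable
  have int_selX: "integrable M (\<lambda>\<omega>. sel (X \<omega> + x) * X \<omega>)" for x
  proof (rule Bochner_Integration.integrable_bound)
    have "integrable M (\<lambda>\<omega>. fs (X \<omega> + x + \<bar>X \<omega>\<bar>))"
      by (rule heart_integrable_fs[OF X, of _ 2 "\<bar>x\<bar>"]) auto
    then show "integrable M (\<lambda>\<omega>. fs (X \<omega> + x + \<bar>X \<omega>\<bar>) + \<psi> 0)"
      by simp
    show "AE \<omega> in M. norm (sel (X \<omega> + x) * X \<omega>) \<le> norm (fs (X \<omega> + x + \<bar>X \<omega>\<bar>) + \<psi> 0)"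
    proof (rule AE_I2)
      fix \<omega>
      show "norm (sel (X \<omega> + x) * X \<omega>) \<le> norm (fs (X \<omega> + x + \<bar>X \<omega>\<bar>) + \<psi> 0)"
        using sel_le_slope[of "\<bar>X \<omega>\<bar>" "X \<omega> + x"] sel_nonneg[of "X \<omega> + x"]
        by (simp add: abs_mult)
    qed
  qed measurable
  have psi_sel: "\<psi> (sel (X \<omega> + x)) = sel (X \<omega> + x) * X \<omega> + x * sel (X \<omega> + x) - fs (X \<omega> + x)" for \<omega> x
    using fs_sel[of "X \<omega> + x"] by (simp add: algebra_simps)
  have int_psi_sel: "integrable M (\<lambda>\<omega>. \<psi> (sel (X \<omega> + x)))" for x
    unfolding psi_sel using int_sel int_selX heart_integrable_fs_add[OF X] by simp
  \<comment> \<open>The equality case \<open>fs_sel\<close> of Young's inequality, integrated. The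
    term \<open>x * (1 - m x)\<close> is the price for a total mass different from 1.\<close>
  have E_sel: "(\<integral>\<omega>. sel (X \<omega> + x) * X \<omega> \<partial>M) - (\<integral>\<omega>. \<psi> (sel (X \<omega> + x)) \<partial>M) = h x + x * (1 - m x)" for x
    unfolding psi_sel h_def m_def using int_sel int_selX heart_integrable_fs_add[OF X]
    by (simp add: algebra_simps)
  have m0: "0 \<le> m x" for x
    unfolding m_def by (rule Bochner_Integration.integral_nonneg) (simp add: sel_nonneg)
  have m_mono: "m x \<le> m y" if "x \<le> y" for x y
    unfolding m_def using that by (intro Bochner_Integration.integral_mono int_sel sel_mono) simp
  \<comment> \<open>Moving down by \<open>c\<close> and using \<open>sel_le_slope\<close> with
    \<open>r = c\<close> bounds \<open>c * m (- c)\<close> by a constant; \<open>c\<close> is taken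
    larger than that constant.\<close>
  have m_low: "\<exists>x. m x \<le> 1"
  proof -
    define c where "c = \<bar>(\<integral>\<omega>. fs (X \<omega> + 0) \<partial>M) + \<psi> 0\<bar> + 1"
    have "c > 0" by (simp add: c_def)
    have "c * m (- c) = (\<integral>\<omega>. sel (X \<omega> + - c) * c \<partial>M)"
      by (simp add: m_def mult.commute)
    also have "\<dots> \<le> (\<integral>\<omega>. fs (X \<omega> + 0) + \<psi> 0 \<partial>M)"
    proof (intro Bochner_Integration.integral_mono)
      fix \<omega>
      show "sel (X \<omega> + - c) * c \<le> fs (X \<omega> + 0) + \<psi> 0"
        using sel_le_slope[of c "X \<omega> + - c"] \<open>c > 0\<close> by simp
    qed (use int_sel[of "- c"] heart_integrable_fs_add[OF X, of 0] in simp_all)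
    also have "\<dots> = (\<integral>\<omega>. fs (X \<omega> + 0) \<partial>M) + \<psi> 0"
      using heart_integrable_fs_add[OF X, of 0] by (simp add: prob_space)
    finally have "c * m (- c) \<le> (\<integral>\<omega>. fs (X \<omega> + 0) \<partial>M) + \<psi> 0" .
    then have "c * m (- c) \<le> c * 1"
      unfolding c_def by (simp only: mult_1_right)
    then have "m (- c) \<le> 1"
      by (rule mult_left_le_imp_le) fact
    then show ?thesis by (rule exI)
  qed
  have m_high: "\<exists>x. m x > 1"
  proof -
    obtain a where a: "a > 1" "\<Phi> a < \<infinity>"
      using div_fun by (auto simp: divergence_function_def)
    \<comment> \<open>A point \<open>a > 1\<close> with \<open>\<Phi> a < \<infinity>\<close> makes
      \<open>fs\<close> grow with slope at least \<open>a\<close> in the long run: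
      \<open>a * c + b \<le> c * m c\<close>. The choice of \<open>c\<close> makes the left side
      exceed \<open>c\<close>.\<close>
    define b where "b = a * (\<integral>\<omega>. X \<omega> \<partial>M) - \<psi> a - (\<integral>\<omega>. fs (X \<omega> + 0) \<partial>M)"
    define c where "c = (\<bar>b\<bar> + 1) / (a - 1)"
    have "c > 0" and ac: "a * c = c + \<bar>b\<bar> + 1"
      using a by (auto simp: c_def field_simps)
    have "a * c + b = (\<integral>\<omega>. a * (X \<omega> + c) - \<psi> a - fs (X \<omega> + 0) \<partial>M)"
      using heart_integrable[OF X] heart_integrable_fs_add[OF X, of 0]
      by (simp add: b_def prob_space algebra_simps)
    also have "\<dots> \<le> (\<integral>\<omega>. sel (X \<omega> + c) * c \<partial>M)"
    proof (rule Bochner_Integration.integral_mono)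
      fix \<omega>
      show "a * (X \<omega> + c) - \<psi> a - fs (X \<omega> + 0) \<le> sel (X \<omega> + c) * c"
        using sel_ge_slope[of "X \<omega> + c" c] legendre_ge[of a "X \<omega> + c"] a by simp
    qed (use heart_integrable[OF X] heart_integrable_fs_add[OF X, of 0] int_sel[of c] in simp_all)
    also have "\<dots> = c * m c"
      by (simp add: m_def mult.commute)
    finally have "c * 1 < c * m c"
      using ac by linarith
    then have "1 < m c"
      by (rule mult_left_less_imp_less) (use \<open>c > 0\<close> in simp)
    then show ?thesis by (rule exI)
  qed
  have bdd: "bdd_below (range h)"
    using risk_objective_bdd_below[OF X] by (intro bdd_belowI2) (auto simp: h_def)
  have "\<exists>Q\<in>feasible. (\<integral>\<omega>. X \<omega> \<partial>Q) - enn2real (divergence M \<Phi> Q) \<ge> Inf (range h) - \<epsilon>"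
    if "\<epsilon> > 0" for \<epsilon>
  proof -
    define S where "S = {x. m x \<le> 1}"
    obtain y where y: "m y > 1" using m_high by blast
    have Sy: "x < y" if "x \<in> S" for x
      using that y m_mono[of y x] by (force simp: S_def)
    have S: "S \<noteq> {}" "bdd_above S"
      using m_low Sy by (auto simp: S_def intro!: bdd_aboveI[of _ y] less_imp_le)
    obtain x1 where x1: "m x1 \<le> 1" "Sup S - \<epsilon> / 2 < x1"
      using less_cSup_iff[OF S, of "Sup S - \<epsilon> / 2"] \<open>\<epsilon> > 0\<close> by (auto simp: S_def)
    define x2 where "x2 = Sup S + \<epsilon> / 2"
    have x2: "m x2 > 1"
    proof (rule ccontr)
      assume "\<not> ?thesis"
      then have "x2 \<le> Sup S" using S by (intro cSup_upper) (auto simp: S_def)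
      then show False using \<open>\<epsilon> > 0\<close> by (simp add: x2_def)
    qed
    have x12: "x1 \<le> Sup S" "x2 - x1 < \<epsilon>" "x1 < x2"
      using x1 S \<open>\<epsilon> > 0\<close> cSup_upper[of x1 S] by (auto simp: x2_def S_def)
    define l where "l = (m x2 - 1) / (m x2 - m x1)"
    have pos: "m x2 - m x1 > 0" using x1(1) x2 by simp
    then have l: "0 \<le> l" "l \<le> 1"
      using x1(1) x2 by (auto simp: l_def)
    have "l * (m x2 - m x1) = m x2 - 1"
      using pos by (simp add: l_def)
    then have lm: "l * m x1 + (1 - l) * m x2 = 1"
      by (simp add: algebra_simps)
    define D where "D \<omega> = l * sel (X \<omega> + x1) + (1 - l) * sel (X \<omega> + x2)" for \<omega>
    define e where "e \<omega> = l * \<psi> (sel (X \<omega> + x1)) + (1 - l) * \<psi> (sel (X \<omega> + x2))" for \<omega>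
    have D: "D \<in> borel_measurable M" unfolding D_def by measurable
    have D0: "0 \<le> D \<omega>" for \<omega> unfolding D_def using l by (auto intro!: add_nonneg_nonneg mult_nonneg_nonneg sel_nonneg)
    have iD: "integrable M D" unfolding D_def using int_sel by simp
    have ED: "(\<integral>\<omega>. D \<omega> \<partial>M) = 1" unfolding D_def using int_sel lm by (simp flip: m_def)
    have fin: "\<Phi> (D \<omega>) < \<infinity>" "\<psi> (D \<omega>) \<le> e \<omega>" for \<omega>
      unfolding D_def e_def using l by (auto intro!: Phi_finite_convex sel_nonneg Phi_sel simp del: infinity_ennreal_def)
    have ie: "integrable M e" unfolding e_def using int_psi_sel by simp
    note F = feasible_density[OF D D0 iD ED fin(1) ie fin(2) mX]
    have "(\<integral>\<omega>. D \<omega> * X \<omega> \<partial>M) - (\<integral>\<omega>. e \<omega> \<partial>M)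
        = l * ((\<integral>\<omega>. sel (X \<omega> + x1) * X \<omega> \<partial>M) - (\<integral>\<omega>. \<psi> (sel (X \<omega> + x1)) \<partial>M))
        + (1 - l) * ((\<integral>\<omega>. sel (X \<omega> + x2) * X \<omega> \<partial>M) - (\<integral>\<omega>. \<psi> (sel (X \<omega> + x2)) \<partial>M))"
      unfolding D_def e_def distrib_right mult.assoc using int_selX int_psi_sel
      by (simp add: algebra_simps)
    also have "\<dots> = l * h x1 + (1 - l) * h x2 + (l * x1 * (1 - m x1) + (1 - l) * x2 * (1 - m x2))"
      unfolding E_sel by (simp add: algebra_simps)
    \<comment> \<open>By \<open>lm\<close> the weighted mass defects at \<open>x1\<close> and
      \<open>x2\<close> are opposite, so only the factor \<open>x2 - x1\<close> times one defect
      survives.\<close>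
    also have "(1 - l) * x2 * (1 - m x2) = - x2 * (l * (1 - m x1))"
    proof -
      have "(1 - l) * (1 - m x2) = - (l * (1 - m x1))"
        using lm by (simp add: algebra_simps)
      then have "x2 * ((1 - l) * (1 - m x2)) = x2 * - (l * (1 - m x1))"
        by presburger
      then show ?thesis by (simp add: mult.assoc mult.left_commute)
    qed
    finally have eq: "(\<integral>\<omega>. D \<omega> * X \<omega> \<partial>M) - (\<integral>\<omega>. e \<omega> \<partial>M)
        = l * h x1 + (1 - l) * h x2 - (x2 - x1) * (l * (1 - m x1))"
      by (simp add: algebra_simps)
    have "l * (1 - m x1) \<le> 1 * 1"
      using l x1 m0[of x1] by (intro mult_mono) auto
    then have "(x2 - x1) * (l * (1 - m x1)) \<le> \<epsilon> * 1"
      using x12 l x1 by (intro mult_mono) auto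
    moreover have "l * Inf (range h) + (1 - l) * Inf (range h) \<le> l * h x1 + (1 - l) * h x2"
      using l bdd by (intro add_mono mult_left_mono cInf_lower) auto
    ultimately have "Inf (range h) - \<epsilon> \<le> (\<integral>\<omega>. D \<omega> * X \<omega> \<partial>M) - (\<integral>\<omega>. e \<omega> \<partial>M)"
      unfolding eq by (simp add: algebra_simps)
    with F show ?thesis by force
  qed note lower = this
  let ?S = "(\<lambda>Q. (\<integral>\<omega>. X \<omega> \<partial>Q) - enn2real (divergence M \<Phi> Q)) ` feasible"
  have ne: "?S \<noteq> {}" using lower[of 1] by auto
  have upper: "s \<le> Inf (range h)" if "s \<in> ?S" for s
    using that feasible_le[OF X] by (auto intro!: cINF_greatest simp: h_def)
  have "Sup ?S = Inf (range h)"
  proof (rule antisym)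
    show "Sup ?S \<le> Inf (range h)"
      using ne upper by (rule cSup_least)
    show "Inf (range h) \<le> Sup ?S"
    proof (rule field_le_epsilon)
      fix \<epsilon> :: real assume "\<epsilon> > 0"
      then obtain Q where Q: "Q \<in> feasible" "(\<integral>\<omega>. X \<omega> \<partial>Q) - enn2real (divergence M \<Phi> Q) \<ge> Inf (range h) - \<epsilon>"
        using lower by blast
      have "(\<integral>\<omega>. X \<omega> \<partial>Q) - enn2real (divergence M \<Phi> Q) \<le> Sup ?S"
        using Q(1) upper by (intro cSup_upper imageI bdd_aboveI[of _ "Inf (range h)"])
      with Q(2) show "Inf (range h) \<le> Sup ?S + \<epsilon>" by simp
    qed
  qed
  then show ?thesis
    unfolding divergence_risk_def feasible_def[symmetric] h_def .
qed

text \<open>The description operator is well defined: the dual formula depends on \<open>X\<close>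
  only through its law, and \<open>cdf_unique\<close> recovers the law from the distribution
  function.\<close>

lemma risk_functional_cdf:
  assumes X: "X \<in> orlicz_heart M \<Phi>"
  shows "risk_functional M \<Phi> (cdf (distr M borel X)) = (INF x. (\<integral>\<omega>. fs (X \<omega> + x) \<partial>M) - x)"
  unfolding risk_functional_def
proof (rule the_equality)
  show "\<exists>Y\<in>orlicz_heart M \<Phi>. cdf (distr M borel Y) = cdf (distr M borel X)
      \<and> (INF x. (\<integral>\<omega>. fs (X \<omega> + x) \<partial>M) - x) = divergence_risk M \<Phi> Y"
    using X divergence_risk_eq[OF X] by auto
next
  fix r
  assume "\<exists>Y\<in>orlicz_heart M \<Phi>. cdf (distr M borel Y) = cdf (distr M borel X) \<and> r = divergence_risk M \<Phi> Y"
  then obtain Y where Y: "Y \<in> orlicz_heart M \<Phi>" "cdf (distr M borel Y) = cdf (distr M borel X)"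
    "r = divergence_risk M \<Phi> Y" by blast
  note [measurable] = heart_measurable[OF X] heart_measurable[OF Y(1)]
  have "distr M borel Y = distr M borel X"
    using Y(2) by (intro cdf_unique real_distribution_distr) auto
  then have "(\<integral>\<omega>. fs (Y \<omega> + x) \<partial>M) = (\<integral>\<omega>. fs (X \<omega> + x) \<partial>M)" for x
    using integral_distr[of Y M borel "\<lambda>t. fs (t + x)"] integral_distr[of X M borel "\<lambda>t. fs (t + x)"]
    by simp
  then show "r = (INF x. (\<integral>\<omega>. fs (X \<omega> + x) \<partial>M) - x)"
    using Y divergence_risk_eq[OF Y(1)] by simp
qed

end

section \<open>Atomless spaces realise empirical distributions\<close>

text \<open>Of a proper part of \<open>C\<close> and its complement in \<open>C\<close>, one has at
  most half the mass of \<open>C\<close>; halving is then iterated.\<close>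

lemma (in prob_space) atomless_small_subset:
  assumes "atomless M" "A \<in> events" "0 < prob A" "0 < e"
  shows "\<exists>B\<in>events. B \<subseteq> A \<and> 0 < prob B \<and> prob B \<le> e"
proof -
  have half: "\<exists>B\<in>events. B \<subseteq> C \<and> 0 < prob B \<and> prob B \<le> prob C / 2"
    if C: "C \<in> events" "0 < prob C" for C
  proof -
    have "emeasure M C > 0"
      using C by (simp add: emeasure_eq_measure)
    then obtain B where B: "B \<in> events" "B \<subseteq> C" "0 < emeasure M B" "emeasure M B < emeasure M C"
      using assms(1) C unfolding atomless_def by blast
    then have "0 < prob B" "prob B < prob C"
      by (simp_all add: emeasure_eq_measure ennreal_less_iff)
    moreover have "prob (C - B) = prob C - prob B"
      using B C by (intro finite_measure_Diff) auto
    ultimately have "prob B \<le> prob C / 2 \<or> C - B \<in> events \<and> 0 < prob (C - B) \<and> prob (C - B) \<le> prob C / 2"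
      using B C by auto
    then show ?thesis
      using B \<open>0 < prob B\<close> by blast
  qed
  have iter: "\<exists>B\<in>events. B \<subseteq> A \<and> 0 < prob B \<and> prob B \<le> prob A / 2 ^ n" for n
  proof (induction n)
    case 0
    then show ?case using assms by auto
  next
    case (Suc n)
    then obtain B where B: "B \<in> events" "B \<subseteq> A" "0 < prob B" "prob B \<le> prob A / 2 ^ n" by blast
    then obtain C where "C \<in> events" "C \<subseteq> B" "0 < prob C" "prob C \<le> prob B / 2"
      using half by blast
    with B show ?case by (intro bexI[of _ C]) auto
  qed
  obtain n where "(1 / 2) ^ n < e"
    using real_arch_pow_inv[of e "1 / 2"] assms by auto
  moreover have "prob A / 2 ^ n \<le> (1 / 2) ^ n"
    by (simp add: power_one_over divide_right_mono)
  ultimately have "prob A / 2 ^ n < e" by (rule order_le_less_trans[rotated])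
  then show ?thesis
    using iter[of n] by (meson less_imp_le order_trans)
qed

text \<open>Sierpinski's theorem by greedy exhaustion: \<open>Q\<close> asks each step to add at
  least half of the largest mass that still fits below \<open>t\<close>. If the union fell short of
  \<open>t\<close>, a small piece of the remainder would fit at every step, yet its mass is at most
  twice the increments, which tend to 0.\<close>

lemma (in prob_space) atomless_intermediate:
  assumes atomless: "atomless M" and A: "A \<in> events" and t: "0 \<le> t" "t \<le> prob A"
  shows "\<exists>B\<in>events. B \<subseteq> A \<and> prob B = t"
proof -
  define P where "P C \<longleftrightarrow> C \<in> events \<and> C \<subseteq> A \<and> prob C \<le> t" for C
  define Q where "Q C C' \<longleftrightarrow> C \<subseteq> C' \<and>
    (\<forall>D\<in>events. D \<subseteq> A - C \<longrightarrow> prob C + prob D \<le> t \<longrightarrow> prob D \<le> 2 * (prob C' - prob C))" for C C'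
  have "\<exists>C. \<forall>n. P (C n) \<and> Q (C n) (C (Suc n))"
  proof (rule dependent_nat_choice)
    show "\<exists>C. P C"
      using t by (intro exI[of _ "{}"]) (simp add: P_def)
  next
    fix C and n :: nat assume C: "P C"
    define S where "S = {prob D | D. D \<in> events \<and> D \<subseteq> A - C \<and> prob C + prob D \<le> t}"
    have bdd: "bdd_above S"
      by (auto simp: S_def intro!: bdd_aboveI[of _ 1])
    have "prob {} \<in> S"
      unfolding S_def using C by (intro CollectI exI[of _ "{}"]) (auto simp: P_def)
    then have "0 \<in> S" by simp
    then have "0 \<le> Sup S"
      using bdd by (rule cSup_upper)
    have "\<exists>s\<in>S. Sup S \<le> 2 * s"
    proof (cases "Sup S = 0")
      case False
      with \<open>0 \<le> Sup S\<close> have "Sup S / 2 < Sup S" by simp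
      then obtain s where "s \<in> S" "Sup S / 2 < s"
        using \<open>0 \<in> S\<close> bdd less_cSup_iff by blast
      then show ?thesis by (intro bexI[of _ s]) auto
    qed (use \<open>0 \<in> S\<close> in auto)
    then obtain D where D: "D \<in> events" "D \<subseteq> A - C" "prob C + prob D \<le> t" "Sup S \<le> 2 * prob D"
      by (auto simp: S_def)
    have eq: "prob (C \<union> D) = prob C + prob D"
      using C D by (intro finite_measure_Union) (auto simp: P_def)
    have "P (C \<union> D)"
      using C D eq by (auto simp: P_def)
    moreover have "Q C (C \<union> D)"
      unfolding Q_def
    proof (intro conjI ballI impI)
      fix D' assume "D' \<in> events" "D' \<subseteq> A - C" "prob C + prob D' \<le> t"
      then have "prob D' \<le> Sup S"
        using bdd by (intro cSup_upper) (auto simp: S_def)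
      with D eq show "prob D' \<le> 2 * (prob (C \<union> D) - prob C)" by simp
    qed auto
    ultimately show "\<exists>C'. P C' \<and> Q C C'" by blast
  qed
  then obtain C where C: "\<And>n. P (C n)" "\<And>n. Q (C n) (C (Suc n))" by blast
  have inc: "incseq C"
    using C(2) by (intro incseq_SucI) (auto simp: Q_def)
  have ev: "range C \<subseteq> events" using C(1) by (auto simp: P_def)
  have lim: "(\<lambda>n. prob (C n)) \<longlonglongrightarrow> prob (\<Union>n. C n)"
    using ev inc by (rule finite_Lim_measure_incseq)
  have U: "(\<Union>n. C n) \<in> events" "(\<Union>n. C n) \<subseteq> A"
    using ev C(1) by (auto simp: P_def)
  have le: "prob (\<Union>n. C n) \<le> t"
    using C(1) by (intro LIMSEQ_le_const2[OF lim]) (auto simp: P_def)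
  have "prob (\<Union>n. C n) = t"
  proof (rule ccontr)
    assume "prob (\<Union>n. C n) \<noteq> t"
    with le have less: "prob (\<Union>n. C n) < t" by simp
    have "prob (A - (\<Union>n. C n)) = prob A - prob (\<Union>n. C n)"
      using A U by (intro finite_measure_Diff) auto
    with less t have "0 < prob (A - (\<Union>n. C n))" by simp
    then obtain D where D: "D \<in> events" "D \<subseteq> A - (\<Union>n. C n)" "0 < prob D" "prob D \<le> t - prob (\<Union>n. C n)"
      using atomless_small_subset[OF atomless, of "A - (\<Union>n. C n)" "t - prob (\<Union>n. C n)"] A U less by auto
    have "prob D \<le> 2 * (prob (C (Suc n)) - prob (C n))" for n
    proof -
      have "prob (C n) \<le> prob (\<Union>n. C n)"
        using U(1) by (intro finite_measure_mono) auto
      then have "D \<in> events" "D \<subseteq> A - C n" "prob (C n) + prob D \<le> t"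
        using D by auto
      then show ?thesis
        using C(2)[of n] unfolding Q_def by blast
    qed
    moreover have "(\<lambda>n. 2 * (prob (C (Suc n)) - prob (C n))) \<longlonglongrightarrow> 2 * (prob (\<Union>n. C n) - prob (\<Union>n. C n))"
      by (intro tendsto_intros lim LIMSEQ_Suc)
    ultimately have "prob D \<le> 2 * (prob (\<Union>n. C n) - prob (\<Union>n. C n))"
      by (intro LIMSEQ_le_const) auto
    with D(3) show False by simp
  qed
  with U show ?thesis by blast
qed

text \<open>Nested events of probability \<open>k / n\<close> are cut into layers \<open>A j\<close>
  of mass \<open>1 / n\<close>, on which the variable takes the value \<open>y j\<close>. The
  \<open>min k n\<close> in \<open>p\<close> lets the chain run through all natural numbers, as the
  choice principle requires.\<close>

lemma (in prob_space) atomless_empirical_variable: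
  fixes y :: "nat \<Rightarrow> real"
  assumes atomless: "atomless M" and n: "n \<ge> 1"
  obtains X where "X \<in> borel_measurable M" "\<And>\<omega>. \<bar>X \<omega>\<bar> \<le> (\<Sum>j=1..n. \<bar>y j\<bar>)"
    "\<And>g::real \<Rightarrow> real. g \<in> borel_measurable borel \<Longrightarrow> (\<integral>\<omega>. g (X \<omega>) \<partial>M) = (\<Sum>j=1..n. g (y j)) / real n"
proof -
  define p where "p k = real (min k n) / real n" for k
  have p_mono: "p k \<le> p (Suc k)" for k
    by (auto simp: p_def divide_right_mono)
  have p_le: "p k \<le> 1" for k
    using n by (auto simp: p_def)
  have "\<exists>B. \<forall>k. (B k \<in> events \<and> prob (B k) = p k) \<and> B k \<subseteq> B (Suc k)"
  proof (rule dependent_nat_choice)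
    show "\<exists>B. B \<in> events \<and> prob B = p 0"
      by (intro exI[of _ "{}"]) (simp add: p_def)
  next
    fix B k assume B: "B \<in> events \<and> prob B = p k"
    have "prob (space M - B) = 1 - p k"
      using B by (simp add: prob_compl)
    then obtain D where D: "D \<in> events" "D \<subseteq> space M - B" "prob D = p (Suc k) - p k"
      using atomless_intermediate[OF atomless, of "space M - B" "p (Suc k) - p k"] B p_mono[of k] p_le[of "Suc k"]
      by auto
    have "prob (B \<union> D) = prob B + prob D"
      using B D by (intro finite_measure_Union) auto
    then show "\<exists>B'. (B' \<in> events \<and> prob B' = p (Suc k)) \<and> B \<subseteq> B'"
      using B D by (intro exI[of _ "B \<union> D"]) auto
  qed
  then obtain B where B[measurable]: "\<And>k. B k \<in> events" and pB: "\<And>k. prob (B k) = p k"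
    and B_Suc: "\<And>k. B k \<subseteq> B (Suc k)" by blast
  have B_mono: "B k \<subseteq> B l" if "k \<le> l" for k l
    using that B_Suc by (rule lift_Suc_mono_le[rotated])
  define A where "A j = B j - B (j - 1)" for j
  have A[measurable]: "A j \<in> events" for j
    unfolding A_def by measurable
  have pA: "prob (A j) = 1 / real n" if "j \<in> {1..n}" for j
  proof -
    have "prob (A j) = p j - p (j - 1)"
      unfolding A_def pB[symmetric] using B_mono[of "j - 1" j] by (intro finite_measure_Diff) auto
    also have "\<dots> = 1 / real n"
      using that n by (auto simp: p_def of_nat_diff field_simps)
    finally show ?thesis .
  qed
  have uniq: "i = j" if "\<omega> \<in> A i" "\<omega> \<in> A j" for \<omega> i j
  proof (rule ccontr)
    have *: False if "i < j" "\<omega> \<in> A i" "\<omega> \<in> A j" for i j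
    proof -
      have "B i \<subseteq> B (j - 1)" using that(1) by (intro B_mono) simp
      then show False using that by (auto simp: A_def)
    qed
    assume "i \<noteq> j"
    then show False using *[of i j] *[of j i] that by linarith
  qed
  have ind: "(\<Sum>j=1..n. h j * indicator (A j) \<omega>) = h i" if "\<omega> \<in> A i" "i \<in> {1..n}" for h :: "nat \<Rightarrow> real" and i \<omega>
  proof -
    have "(\<Sum>j=1..n. h j * indicator (A j) \<omega>) = (\<Sum>j\<in>{1..n}. if j = i then h i else 0)"
      using that uniq by (intro sum.cong) (auto simp: indicator_def)
    then show ?thesis using that by simp
  qed
  \<comment> \<open>Off the layers \<open>X\<close> is 0, so the bound by the sum of the
    \<open>\<bar>y j\<bar>\<close> holds everywhere although the layers cover only almost all of the
    space.\<close>
  define X where "X \<omega> = (\<Sum>j=1..n. y j * indicator (A j) \<omega>)" for \<omega>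
  have "AE \<omega> in M. \<omega> \<in> B n"
    using pB[of n] n by (intro AE_prob_1) (simp add: p_def)
  moreover have "AE \<omega> in M. \<omega> \<notin> B 0"
    using pB[of 0] B by (intro AE_not_in) (auto simp: null_sets_def emeasure_eq_measure p_def)
  ultimately have AE_A: "AE \<omega> in M. \<exists>i\<in>{1..n}. \<omega> \<in> A i"
  proof eventually_elim
    case (elim \<omega>)
    define i where "i = (LEAST k. \<omega> \<in> B k)"
    have i: "\<omega> \<in> B i" "i \<le> n"
      unfolding i_def using elim by (auto intro: LeastI Least_le)
    have "i \<noteq> 0" using i elim by (cases i) auto
    moreover from this have "\<omega> \<notin> B (i - 1)"
      unfolding i_def by (intro not_less_Least) auto
    ultimately show ?case
      using i by (intro bexI[of _ i]) (auto simp: A_def)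
  qed
  show ?thesis
  proof
    show [measurable]: "X \<in> borel_measurable M"
      unfolding X_def by measurable
    show "\<bar>X \<omega>\<bar> \<le> (\<Sum>j=1..n. \<bar>y j\<bar>)" for \<omega>
    proof -
      have "\<bar>X \<omega>\<bar> \<le> (\<Sum>j=1..n. \<bar>y j * indicator (A j) \<omega>\<bar>)"
        unfolding X_def by (rule sum_abs)
      also have "\<dots> \<le> (\<Sum>j=1..n. \<bar>y j\<bar>)"
        by (intro sum_mono) (auto simp: indicator_def)
      finally show ?thesis .
    qed
    fix g :: "real \<Rightarrow> real" assume [measurable]: "g \<in> borel_measurable borel"
    have "(\<integral>\<omega>. g (X \<omega>) \<partial>M) = (\<integral>\<omega>. (\<Sum>j=1..n. g (y j) * indicator (A j) \<omega>) \<partial>M)"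
    proof (rule integral_cong_AE)
      show "AE \<omega> in M. g (X \<omega>) = (\<Sum>j=1..n. g (y j) * indicator (A j) \<omega>)"
        using AE_A
      proof eventually_elim
        case (elim \<omega>)
        then obtain i where i: "i \<in> {1..n}" "\<omega> \<in> A i" by blast
        show ?case
          unfolding X_def ind[OF i(2,1), of y] ind[OF i(2,1), of "\<lambda>j. g (y j)"] ..
      qed
    qed measurable
    also have "\<dots> = (\<Sum>j=1..n. g (y j) * prob (A j))"
      by (subst Bochner_Integration.integral_sum) (auto simp: emeasure_eq_measure)
    also have "\<dots> = (\<Sum>j=1..n. g (y j)) / real n"
      unfolding sum_divide_distrib by (intro sum.cong) (auto simp: pA)
    finally show "(\<integral>\<omega>. g (X \<omega>) \<partial>M) = (\<Sum>j=1..n. g (y j)) / real n" .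
  qed
qed

lemma (in divergence_prob) heart_bounded:
  assumes [measurable]: "X \<in> borel_measurable M" and K: "\<And>\<omega>. \<bar>X \<omega>\<bar> \<le> K"
  shows "X \<in> orlicz_heart M \<Phi>"
  unfolding orlicz_heart_def
proof (intro CollectI conjI allI impI)
  fix c :: real assume "c > 0"
  show "integrable M (\<lambda>\<omega>. fs (c * \<bar>X \<omega>\<bar>))"
  proof (rule integrable_const_bound)
    show "AE \<omega> in M. norm (fs (c * \<bar>X \<omega>\<bar>)) \<le> fs (c * K)"
    proof (rule AE_I2)
      fix \<omega>
      show "norm (fs (c * \<bar>X \<omega>\<bar>)) \<le> fs (c * K)"
        using fs_nonneg[of "c * \<bar>X \<omega>\<bar>"] fs_mono[of "c * \<bar>X \<omega>\<bar>" "c * K"] K[of \<omega>] \<open>c > 0\<close>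
        by simp
    qed
  qed measurable
qed measurable

lemma (in divergence_prob) risk_functional_emp_cdf:
  assumes atomless: "atomless M" and n: "n \<ge> 1"
  shows "risk_functional M \<Phi> (emp_cdf n y) = (INF x. (\<Sum>j=1..n. fs (y j + x)) / real n - x)"
proof -
  obtain X where X: "X \<in> borel_measurable M" and K: "\<And>\<omega>. \<bar>X \<omega>\<bar> \<le> (\<Sum>j=1..n. \<bar>y j\<bar>)"
    and E: "\<And>g::real \<Rightarrow> real. g \<in> borel_measurable borel \<Longrightarrow> (\<integral>\<omega>. g (X \<omega>) \<partial>M) = (\<Sum>j=1..n. g (y j)) / real n"
    using atomless_empirical_variable[OF atomless n, of y] by blast
  note [measurable] = X
  have heart: "X \<in> orlicz_heart M \<Phi>"
    using X K by (rule heart_bounded)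
  have "cdf (distr M borel X) = emp_cdf n y"
  proof
    fix t
    have "cdf (distr M borel X) t = prob (X -` {..t} \<inter> space M)"
      by (simp add: cdf_def measure_distr)
    also have "\<dots> = (\<integral>\<omega>. indicator (X -` {..t} \<inter> space M) \<omega> \<partial>M)"
      by simp
    also have "\<dots> = (\<integral>\<omega>. indicator {..t} (X \<omega>) \<partial>M)"
      by (intro Bochner_Integration.integral_cong) (auto simp: indicator_def)
    also have "\<dots> = (\<Sum>j=1..n. indicator {..t} (y j)) / real n"
      by (rule E) measurable
    also have "(\<Sum>j=1..n. indicator {..t} (y j)) = real (card {j\<in>{1..n}. y j \<le> t})"
      by (simp add: indicator_def of_bool_def sum.If_cases Int_def)
    finally show "cdf (distr M borel X) t = emp_cdf n y t"
      by (simp add: emp_cdf_def)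
  qed
  then show ?thesis
    using risk_functional_cdf[OF heart] E[of "\<lambda>t. fs (t + x)" for x] by simp
qed

section \<open>Rademacher sums and chaining\<close>

text \<open>The bound for \<open>cosh\<close>, read off the auxiliary inequality of Hoeffding's
  lemma at parameter \<open>2 * x\<close> and success probability \<open>1 / 2\<close>.\<close>

lemma exp_plus_exp_minus_le: "exp x + exp (- x) \<le> 2 * exp (x\<^sup>2 / 2)" for x :: real
proof -
  have *: "exp x + exp (- x) \<le> 2 * exp (x\<^sup>2 / 2)" if "x \<ge> 0" for x :: real
  proof -
    have "- (2 * x) * (1 / 2) + ln (1 + 1 / 2 * (exp (2 * x) - 1)) \<le> (2 * x)\<^sup>2 / 8"
      using Hoeffdings_lemma_aux[of "2 * x" "1 / 2"] that by simp
    then have "exp (ln ((1 + exp (2 * x)) / 2)) \<le> exp (x + x\<^sup>2 / 2)"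
      unfolding exp_le_cancel_iff by (simp add: power2_eq_square field_simps)
    moreover have "exp (ln ((1 + exp (2 * x)) / 2)) = (1 + exp (2 * x)) / 2"
      by (intro exp_ln) (simp add: add_pos_pos)
    ultimately have "(1 + exp (2 * x)) / 2 * exp (- x) \<le> exp (x + x\<^sup>2 / 2) * exp (- x)"
      by (intro mult_right_mono) simp_all
    also have "exp (x + x\<^sup>2 / 2) * exp (- x) = exp (x\<^sup>2 / 2)"
      by (simp flip: exp_add)
    also have "(1 + exp (2 * x)) / 2 * exp (- x) = (exp (- x) + exp (2 * x + - x)) / 2"
      unfolding exp_add by (simp add: algebra_simps)
    finally show ?thesis by simp
  qed
  show ?thesis
    using *[of x] *[of "- x"] by (cases "x \<ge> 0") (auto simp: add.commute)
qed

text \<open>A sign vector is encoded by the set of its positive coordinates, so a uniformly random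
  sign vector becomes counting over \<open>Pow J\<close>.\<close>

definition sgs :: "'j set \<Rightarrow> 'j \<Rightarrow> real"
  where "sgs s j = (if j \<in> s then 1 else - 1)"

text \<open>Expanding the product of the \<open>exp (a j) + exp (- a j)\<close> by
  \<open>prod_add\<close> gives one summand for each set of positive signs; this replaces
  independence.\<close>

lemma rademacher_mgf:
  fixes a :: "'j \<Rightarrow> real"
  assumes J: "finite J"
  shows "(\<Sum>s\<in>Pow J. exp (\<Sum>j\<in>J. sgs s j * a j)) \<le> 2 ^ card J * exp ((\<Sum>j\<in>J. (a j)\<^sup>2) / 2)"
proof -
  have "(\<Sum>s\<in>Pow J. exp (\<Sum>j\<in>J. sgs s j * a j))
      = (\<Sum>s\<in>Pow J. (\<Prod>j\<in>s. exp (a j)) * (\<Prod>j\<in>J - s. exp (- a j)))"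
  proof (rule sum.cong)
    fix s assume s: "s \<in> Pow J"
    then have "(\<Sum>j\<in>J. sgs s j * a j) = (\<Sum>j\<in>s. sgs s j * a j) + (\<Sum>j\<in>J - s. sgs s j * a j)"
      using J by (intro sum.subset_diff[THEN trans, OF _ _ add.commute]) auto
    also have "\<dots> = (\<Sum>j\<in>s. a j) + (\<Sum>j\<in>J - s. - a j)"
      by (intro arg_cong2[of _ _ _ _ "(+)"] sum.cong) (auto simp: sgs_def)
    finally show "exp (\<Sum>j\<in>J. sgs s j * a j) = (\<Prod>j\<in>s. exp (a j)) * (\<Prod>j\<in>J - s. exp (- a j))"
      using s J finite_subset[of s J] by (simp add: exp_add exp_sum del: sum_negf)
  qed simp
  also have "\<dots> = (\<Prod>j\<in>J. exp (a j) + exp (- a j))"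
    using J by (simp add: prod_add)
  also have "\<dots> \<le> (\<Prod>j\<in>J. 2 * exp ((a j)\<^sup>2 / 2))"
    by (intro prod_mono conjI exp_plus_exp_minus_le) (simp add: add_nonneg_nonneg)
  also have "\<dots> = 2 ^ card J * exp ((\<Sum>j\<in>J. (a j)\<^sup>2) / 2)"
    using J by (simp add: prod.distrib exp_sum[symmetric] sum_divide_distrib)
  finally show ?thesis .
qed

text \<open>Chernoff's method with the parameter \<open>l = \<tau> / V\<close>, which minimises the
  exponent \<open>l\<^sup>2 * V / 2 - l * \<tau>\<close>.\<close>

lemma rademacher_tail1:
  fixes a :: "'j \<Rightarrow> real"
  assumes J: "finite J" and V: "(\<Sum>j\<in>J. (a j)\<^sup>2) \<le> V" "V > 0" and \<tau>: "\<tau> \<ge> 0"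
  shows "real (card {s\<in>Pow J. \<tau> \<le> (\<Sum>j\<in>J. sgs s j * a j)}) \<le> 2 ^ card J * exp (- \<tau>\<^sup>2 / (2 * V))"
proof -
  define l where "l = \<tau> / V"
  have l: "l \<ge> 0" using V \<tau> by (simp add: l_def)
  let ?S = "{s\<in>Pow J. \<tau> \<le> (\<Sum>j\<in>J. sgs s j * a j)}"
  have "real (card ?S) * exp (l * \<tau>) = (\<Sum>s\<in>?S. exp (l * \<tau>))"
    by simp
  also have "\<dots> \<le> (\<Sum>s\<in>?S. exp (\<Sum>j\<in>J. sgs s j * (l * a j)))"
  proof (rule sum_mono)
    fix s assume "s \<in> ?S"
    then have "l * \<tau> \<le> l * (\<Sum>j\<in>J. sgs s j * a j)"
      using l by (intro mult_left_mono) auto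
    then show "exp (l * \<tau>) \<le> exp (\<Sum>j\<in>J. sgs s j * (l * a j))"
      by (simp add: sum_distrib_left mult.left_commute)
  qed
  also have "\<dots> \<le> (\<Sum>s\<in>Pow J. exp (\<Sum>j\<in>J. sgs s j * (l * a j)))"
    using J by (intro sum_mono2) auto
  also have "\<dots> \<le> 2 ^ card J * exp ((\<Sum>j\<in>J. (l * a j)\<^sup>2) / 2)"
    using J by (rule rademacher_mgf)
  also have "\<dots> \<le> 2 ^ card J * exp (l\<^sup>2 * V / 2)"
    using V(1) by (simp add: power_mult_distrib mult_left_mono flip: sum_distrib_left)
  finally have "real (card ?S) * exp (l * \<tau>) * exp (- (l * \<tau>)) \<le> 2 ^ card J * exp (l\<^sup>2 * V / 2) * exp (- (l * \<tau>))"
    by (rule mult_right_mono) simp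
  moreover have "l\<^sup>2 * V / 2 + - (l * \<tau>) = - \<tau>\<^sup>2 / (2 * V)"
    using V(2) by (simp add: l_def power2_eq_square field_simps)
  ultimately show ?thesis
    by (simp only: mult.assoc exp_add[symmetric]) simp
qed

lemma rademacher_tail:
  fixes a :: "'j \<Rightarrow> real"
  assumes J: "finite J" and V: "(\<Sum>j\<in>J. (a j)\<^sup>2) \<le> V" "V > 0" and \<tau>: "\<tau> \<ge> 0"
  shows "real (card {s\<in>Pow J. \<tau> \<le> \<bar>\<Sum>j\<in>J. sgs s j * a j\<bar>}) \<le> 2 ^ card J * (2 * exp (- \<tau>\<^sup>2 / (2 * V)))"
proof -
  have "{s\<in>Pow J. \<tau> \<le> \<bar>\<Sum>j\<in>J. sgs s j * a j\<bar>}
      \<subseteq> {s\<in>Pow J. \<tau> \<le> (\<Sum>j\<in>J. sgs s j * a j)} \<union> {s\<in>Pow J. \<tau> \<le> (\<Sum>j\<in>J. sgs s j * - a j)}"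
    by (auto simp: sum_negf abs_if split: if_splits)
  then have "card {s\<in>Pow J. \<tau> \<le> \<bar>\<Sum>j\<in>J. sgs s j * a j\<bar>}
      \<le> card {s\<in>Pow J. \<tau> \<le> (\<Sum>j\<in>J. sgs s j * a j)} + card {s\<in>Pow J. \<tau> \<le> (\<Sum>j\<in>J. sgs s j * - a j)}"
    using J by (intro order_trans[OF card_mono card_Un_le]) auto
  then have "real (card {s\<in>Pow J. \<tau> \<le> \<bar>\<Sum>j\<in>J. sgs s j * a j\<bar>})
      \<le> real (card {s\<in>Pow J. \<tau> \<le> (\<Sum>j\<in>J. sgs s j * a j)})
        + real (card {s\<in>Pow J. \<tau> \<le> (\<Sum>j\<in>J. sgs s j * - a j)})"
    by linarith
  also have "\<dots> \<le> 2 ^ card J * exp (- \<tau>\<^sup>2 / (2 * V)) + 2 ^ card J * exp (- \<tau>\<^sup>2 / (2 * V))"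
    using assms by (intro add_mono rademacher_tail1) auto
  finally show ?thesis by simp
qed

text \<open>A point of level \<open>Suc K\<close> that exceeds the summed thresholds either has a
  projection to level \<open>K\<close> that already exceeds its sum, or its link to the projection
  exceeds \<open>\<tau> (Suc K)\<close>. The union bound counts one link for each point of a
  net.\<close>

lemma rademacher_chaining:
  fixes a :: "'c \<Rightarrow> 'j \<Rightarrow> real" and C :: "nat \<Rightarrow> 'c set"
  assumes J: "finite J" and mK: "m \<le> K"
    and fin: "\<And>k. finite (C k)" and v: "\<And>k. v k > 0" and \<tau>: "\<And>k. \<tau> k \<ge> 0"
    and base: "\<And>c. c \<in> C m \<Longrightarrow> (\<Sum>j\<in>J. (a c j)\<^sup>2) \<le> v m"
    and link: "\<And>k c. m \<le> k \<Longrightarrow> c \<in> C (Suc k) \<Longrightarrow> \<exists>c'\<in>C k. (\<Sum>j\<in>J. (a c j - a c' j)\<^sup>2) \<le> v (Suc k)"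
  shows "real (card {s\<in>Pow J. \<exists>c\<in>C K. (\<Sum>k=m..K. \<tau> k) < \<bar>\<Sum>j\<in>J. sgs s j * a c j\<bar>})
    \<le> 2 ^ card J * (\<Sum>k=m..K. 2 * real (card (C k)) * exp (- (\<tau> k)\<^sup>2 / (2 * v k)))"
  using mK
proof (induction K rule: dec_induct)
  have union: "real (card (\<Union>c\<in>C k. {s\<in>Pow J. \<tau> k \<le> \<bar>\<Sum>j\<in>J. sgs s j * b c j\<bar>}))
      \<le> 2 ^ card J * (2 * real (card (C k)) * exp (- (\<tau> k)\<^sup>2 / (2 * v k)))"
    if "\<And>c. c \<in> C k \<Longrightarrow> (\<Sum>j\<in>J. (b c j)\<^sup>2) \<le> v k" for k and b :: "'c \<Rightarrow> 'j \<Rightarrow> real"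
  proof -
    have "real (card (\<Union>c\<in>C k. {s\<in>Pow J. \<tau> k \<le> \<bar>\<Sum>j\<in>J. sgs s j * b c j\<bar>}))
        \<le> real (\<Sum>c\<in>C k. card {s\<in>Pow J. \<tau> k \<le> \<bar>\<Sum>j\<in>J. sgs s j * b c j\<bar>})"
      using fin by (intro of_nat_mono card_UN_le)
    also have "\<dots> \<le> (\<Sum>c\<in>C k. 2 ^ card J * (2 * exp (- (\<tau> k)\<^sup>2 / (2 * v k))))"
      unfolding of_nat_sum using that v \<tau> J by (intro sum_mono rademacher_tail) auto
    finally show ?thesis by (simp add: mult_ac)
  qed
  {
    case base
    have "real (card {s\<in>Pow J. \<exists>c\<in>C m. (\<Sum>k=m..m. \<tau> k) < \<bar>\<Sum>j\<in>J. sgs s j * a c j\<bar>})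
        \<le> real (card (\<Union>c\<in>C m. {s\<in>Pow J. \<tau> m \<le> \<bar>\<Sum>j\<in>J. sgs s j * a c j\<bar>}))"
      using fin J by (intro of_nat_mono card_mono) (auto intro: finite_subset[of _ "Pow J"])
    also have "\<dots> \<le> 2 ^ card J * (2 * real (card (C m)) * exp (- (\<tau> m)\<^sup>2 / (2 * v m)))"
      using assms(6) by (rule union)
    finally show ?case by simp
  next
    case (step K)
    obtain p where p: "\<And>c. c \<in> C (Suc K) \<Longrightarrow> p c \<in> C K \<and> (\<Sum>j\<in>J. (a c j - a (p c) j)\<^sup>2) \<le> v (Suc K)"
      using link[OF step.hyps(1)] by metis
    let ?A = "{s\<in>Pow J. \<exists>c\<in>C K. (\<Sum>k=m..K. \<tau> k) < \<bar>\<Sum>j\<in>J. sgs s j * a c j\<bar>}"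
    let ?B = "\<Union>c\<in>C (Suc K). {s\<in>Pow J. \<tau> (Suc K) \<le> \<bar>\<Sum>j\<in>J. sgs s j * (a c j - a (p c) j)\<bar>}"
    have sub: "{s\<in>Pow J. \<exists>c\<in>C (Suc K). (\<Sum>k=m..Suc K. \<tau> k) < \<bar>\<Sum>j\<in>J. sgs s j * a c j\<bar>} \<subseteq> ?A \<union> ?B"
    proof
      fix s assume "s \<in> {s\<in>Pow J. \<exists>c\<in>C (Suc K). (\<Sum>k=m..Suc K. \<tau> k) < \<bar>\<Sum>j\<in>J. sgs s j * a c j\<bar>}"
      then obtain c where c: "s \<in> Pow J" "c \<in> C (Suc K)" "(\<Sum>k=m..K. \<tau> k) + \<tau> (Suc K) < \<bar>\<Sum>j\<in>J. sgs s j * a c j\<bar>"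
        using step.hyps by auto
      have "(\<Sum>j\<in>J. sgs s j * a c j) = (\<Sum>j\<in>J. sgs s j * a (p c) j) + (\<Sum>j\<in>J. sgs s j * (a c j - a (p c) j))"
        by (simp add: algebra_simps flip: sum.distrib)
      then have "(\<Sum>k=m..K. \<tau> k) < \<bar>\<Sum>j\<in>J. sgs s j * a (p c) j\<bar> \<or> \<tau> (Suc K) \<le> \<bar>\<Sum>j\<in>J. sgs s j * (a c j - a (p c) j)\<bar>"
        using c(3) by linarith
      then show "s \<in> ?A \<union> ?B"
        using c p[OF c(2)] by blast
    qed
    have "real (card {s\<in>Pow J. \<exists>c\<in>C (Suc K). (\<Sum>k=m..Suc K. \<tau> k) < \<bar>\<Sum>j\<in>J. sgs s j * a c j\<bar>})
        \<le> real (card (?A \<union> ?B))"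
      using J by (intro of_nat_mono card_mono sub) (auto intro: finite_subset[of _ "Pow J"])
    also have "\<dots> \<le> real (card ?A) + real (card ?B)"
      using card_Un_le[of ?A ?B] by linarith
    also have "\<dots> \<le> 2 ^ card J * (\<Sum>k=m..K. 2 * real (card (C k)) * exp (- (\<tau> k)\<^sup>2 / (2 * v k)))
        + 2 ^ card J * (2 * real (card (C (Suc K))) * exp (- (\<tau> (Suc K))\<^sup>2 / (2 * v (Suc K))))"
      using p by (intro add_mono step.IH union) auto
    also have "\<dots> = 2 ^ card J * (\<Sum>k=m..Suc K. 2 * real (card (C k)) * exp (- (\<tau> k)\<^sup>2 / (2 * v k)))"
      using step.hyps by (simp add: distrib_left)
    finally show ?case .
  }
qed

section \<open>Entropy integrals and nets\<close>

definition entropy :: "('z::topological_space \<Rightarrow> real) set \<Rightarrow> ('z \<Rightarrow> real) \<Rightarrow> real \<Rightarrow> ennreal"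
  where "entropy H C \<epsilon> = (SUP Q\<in>fin_supp_probs. sqrt_ln_double (covering_number (\<epsilon> * l2_norm Q C) H Q))"

lemma entropy_integral_eq:
  "entropy_integral H C \<delta> = (\<integral>\<^sup>+\<epsilon>. entropy H C \<epsilon> * indicator {0<..\<delta>} \<epsilon> \<partial>lborel)"
  by (simp add: entropy_integral_def entropy_def)

text \<open>As a covering number, 0 occurs only for an empty class; \<open>ln\<close> of 0 is then a
  default value and has to be treated separately.\<close>

lemma sqrt_ln_double_mono: "a \<le> b \<Longrightarrow> sqrt_ln_double a \<le> sqrt_ln_double b"
proof (cases a; cases b)
  fix k l assume *: "a \<le> b" "a = enat k" "b = enat l"
  then show ?thesis
    by (cases "k = 0") (auto simp: sqrt_ln_double_def intro!: ennreal_leI)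
qed (auto simp: sqrt_ln_double_def)

lemma covering_number_antimono: "\<eta> \<le> \<eta>' \<Longrightarrow> covering_number \<eta>' H Q \<le> covering_number \<eta> H Q"
  unfolding covering_number_def
proof (rule INF_superset_mono)
  assume le: "\<eta> \<le> \<eta>'"
  show "{C. finite C \<and> C \<subseteq> H \<and> (\<forall>h\<in>H. \<exists>c\<in>C. integrable Q (\<lambda>z. (h z - c z)\<^sup>2) \<and> l2_norm Q (\<lambda>z. h z - c z) \<le> \<eta>)}
      \<subseteq> {C. finite C \<and> C \<subseteq> H \<and> (\<forall>h\<in>H. \<exists>c\<in>C. integrable Q (\<lambda>z. (h z - c z)\<^sup>2) \<and> l2_norm Q (\<lambda>z. h z - c z) \<le> \<eta>')}"
    using order_trans[OF _ le] by blast
qed simp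

lemma entropy_antimono:
  assumes "\<epsilon> \<le> \<epsilon>'"
  shows "entropy H C \<epsilon>' \<le> entropy H C \<epsilon>"
  unfolding entropy_def
proof (rule SUP_mono)
  fix Q :: "'a measure" assume "Q \<in> fin_supp_probs"
  moreover have "\<epsilon> * l2_norm Q C \<le> \<epsilon>' * l2_norm Q C"
    using assms by (intro mult_right_mono) (auto simp: l2_norm_def)
  ultimately show "\<exists>Q'\<in>fin_supp_probs. sqrt_ln_double (covering_number (\<epsilon>' * l2_norm Q C) H Q)
      \<le> sqrt_ln_double (covering_number (\<epsilon> * l2_norm Q' C) H Q')"
    by (intro bexI[of _ Q] sqrt_ln_double_mono covering_number_antimono)
qed

text \<open>As \<open>entropy\<close> is antitone, its value at \<open>(1/2)^k\<close> is a lower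
  bound on the dyadic interval \<open>I k\<close> below that point, and \<open>(1/2)^Suc k\<close>
  is the length of this interval.\<close>

lemma entropy_dyadic_sum_nn:
  "(\<Sum>k=m..K. entropy H C ((1/2)^k) * ennreal ((1/2)^Suc k)) \<le> entropy_integral H C ((1/2)^m)"
proof -
  define I where "I k = {(1/2::real)^Suc k<..(1/2)^k}" for k
  have disj: "i = j" if "\<epsilon> \<in> I i" "\<epsilon> \<in> I j" for i j \<epsilon>
  proof (rule ccontr)
    have *: False if "i < j" "\<epsilon> \<in> I i" "\<epsilon> \<in> I j" for i j
    proof -
      have "(1/2::real)^j \<le> (1/2)^Suc i"
        using that(1) by (intro power_decreasing) auto
      then show False using that(2,3) by (auto simp: I_def)
    qed
    assume "i \<noteq> j"
    then show False using *[of i j] *[of j i] that by linarith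
  qed
  have "(\<Sum>k=m..K. entropy H C ((1/2)^k) * ennreal ((1/2)^Suc k))
      = (\<Sum>k=m..K. \<integral>\<^sup>+\<epsilon>. entropy H C ((1/2)^k) * indicator (I k) \<epsilon> \<partial>lborel)"
  proof (intro sum.cong refl)
    fix k
    have "emeasure lborel (I k) = ennreal ((1/2)^k - (1/2)^Suc k)"
      unfolding I_def by (subst emeasure_lborel_Ioc) (auto intro: power_decreasing)
    also have "(1/2::real)^k - (1/2)^Suc k = (1/2)^Suc k"
      by simp
    finally show "entropy H C ((1/2)^k) * ennreal ((1/2)^Suc k)
        = (\<integral>\<^sup>+\<epsilon>. entropy H C ((1/2)^k) * indicator (I k) \<epsilon> \<partial>lborel)"
      by (subst nn_integral_cmult_indicator) (auto simp: I_def)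
  qed
  also have "\<dots> = (\<integral>\<^sup>+\<epsilon>. (\<Sum>k=m..K. entropy H C ((1/2)^k) * indicator (I k) \<epsilon>) \<partial>lborel)"
    by (intro nn_integral_sum[symmetric]) (auto simp: I_def)
  also have "\<dots> \<le> (\<integral>\<^sup>+\<epsilon>. entropy H C \<epsilon> * indicator {0<..(1/2)^m} \<epsilon> \<partial>lborel)"
  proof (rule nn_integral_mono)
    fix \<epsilon> :: real
    show "(\<Sum>k=m..K. entropy H C ((1/2)^k) * indicator (I k) \<epsilon>) \<le> entropy H C \<epsilon> * indicator {0<..(1/2)^m} \<epsilon>"
    proof (cases "\<exists>k\<in>{m..K}. \<epsilon> \<in> I k")
      case True
      then obtain k where k: "k \<in> {m..K}" "\<epsilon> \<in> I k" by blast
      have "(\<Sum>i=m..K. entropy H C ((1/2)^i) * indicator (I i) \<epsilon>)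
          = (\<Sum>i\<in>{m..K}. if i = k then entropy H C ((1/2)^k) else 0)"
        using k(2) disj by (intro sum.cong) (auto simp: indicator_def)
      also have "\<dots> = entropy H C ((1/2)^k)"
        using k by simp
      also have "\<dots> \<le> entropy H C \<epsilon>"
        using k by (intro entropy_antimono) (auto simp: I_def)
      also have "\<dots> = entropy H C \<epsilon> * indicator {0<..(1/2)^m} \<epsilon>"
      proof -
        have "(1/2::real)^k \<le> (1/2)^m" using k by (intro power_decreasing) auto
        moreover have "(0::real) < (1/2)^Suc k" by simp
        ultimately have "\<epsilon> \<in> {0<..(1/2)^m}"
          using k(2) unfolding I_def greaterThanAtMost_iff by linarith
        then show ?thesis by simp
      qed
      finally show ?thesis .
    next
      case False
      then have "(\<Sum>i=m..K. entropy H C ((1/2)^i) * indicator (I i) \<epsilon>) = 0"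
        by (intro sum.neutral) (auto simp: indicator_def)
      then show ?thesis by simp
    qed
  qed
  finally show ?thesis
    by (simp add: entropy_integral_eq)
qed

lemma entropy_finite:
  assumes "entropy_integral H C ((1/2)^m) < \<infinity>" "m \<le> k"
  shows "entropy H C ((1/2)^k) < \<infinity>"
proof -
  have "entropy H C ((1/2)^k) * ennreal ((1/2)^Suc k) \<le> (\<Sum>k=m..k. entropy H C ((1/2)^k) * ennreal ((1/2)^Suc k))"
    using assms(2) by (intro member_le_sum) auto
  also have "\<dots> < \<infinity>"
    using entropy_dyadic_sum_nn assms(1) by (rule order.strict_trans1)
  finally have "entropy H C ((1/2)^k) * ennreal ((1/2)^Suc k) < \<top>" by simp
  then show ?thesis
    by (auto simp: ennreal_mult_less_top)
qed

lemma entropy_dyadic_sum: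
  assumes "entropy_integral H C ((1/2)^m) < \<infinity>"
  shows "(\<Sum>k=m..K. (1/2)^k * enn2real (entropy H C ((1/2)^k))) \<le> 2 * enn2real (entropy_integral H C ((1/2)^m))"
proof -
  let ?h = "\<lambda>k. enn2real (entropy H C ((1/2)^k))"
  have "ennreal (\<Sum>k=m..K. ?h k * (1/2)^Suc k) = (\<Sum>k=m..K. ennreal (?h k * (1/2)^Suc k))"
    by (rule sum_ennreal[symmetric]) simp
  also have "\<dots> = (\<Sum>k=m..K. entropy H C ((1/2)^k) * ennreal ((1/2)^Suc k))"
    using entropy_finite[OF assms]
    by (intro sum.cong refl, subst ennreal_mult) (auto simp del: power_Suc)
  also have "\<dots> \<le> entropy_integral H C ((1/2)^m)"
    by (rule entropy_dyadic_sum_nn)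
  also have "\<dots> = ennreal (enn2real (entropy_integral H C ((1/2)^m)))"
    using assms by simp
  finally have "(\<Sum>k=m..K. ?h k * (1/2)^Suc k) \<le> enn2real (entropy_integral H C ((1/2)^m))"
    by simp
  then show ?thesis
    by (simp add: mult.commute flip: sum_divide_distrib)
qed

text \<open>A minimal cover exists because infima of nonempty sets of \<open>enat\<close> are
  attained. The factor 2 inherited from \<open>sqrt_ln_double\<close> is kept: it later pays for the
  two tails of a Rademacher sum.\<close>

lemma entropy_cover:
  assumes Q: "Q \<in> fin_supp_probs" and fin: "entropy H C \<epsilon> < \<infinity>"
  obtains D where "finite D" "D \<subseteq> H" "2 * real (card D) \<le> exp ((enn2real (entropy H C \<epsilon>))\<^sup>2)"
    "\<And>h. h \<in> H \<Longrightarrow> \<exists>c\<in>D. l2_norm Q (\<lambda>z. h z - c z) \<le> \<epsilon> * l2_norm Q C"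
proof -
  define \<D> where "\<D> = {D. finite D \<and> D \<subseteq> H \<and>
     (\<forall>h\<in>H. \<exists>c\<in>D. integrable Q (\<lambda>z. (h z - c z)\<^sup>2) \<and> l2_norm Q (\<lambda>z. h z - c z) \<le> \<epsilon> * l2_norm Q C)}"
  let ?N = "covering_number (\<epsilon> * l2_norm Q C) H Q"
  have N: "?N = Inf ((\<lambda>D. enat (card D)) ` \<D>)"
    unfolding covering_number_def \<D>_def ..
  have le: "sqrt_ln_double ?N \<le> entropy H C \<epsilon>"
    unfolding entropy_def using Q by (intro SUP_upper)
  have "?N \<noteq> \<infinity>"
  proof
    assume "?N = \<infinity>"
    then have "sqrt_ln_double ?N = \<infinity>" by (simp add: sqrt_ln_double_def)
    with le fin show False by simp
  qed
  then have "\<D> \<noteq> {}"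
    unfolding N by (auto simp: top_enat_def)
  then have "?N \<in> (\<lambda>D. enat (card D)) ` \<D>"
    unfolding N using wellorder_InfI by (metis all_not_in_conv image_is_empty)
  then obtain D where D: "D \<in> \<D>" "?N = enat (card D)" by auto
  have "2 * real (card D) \<le> exp ((enn2real (entropy H C \<epsilon>))\<^sup>2)"
  proof (cases "card D = 0")
    case False
    have "ennreal (sqrt (ln (2 * real (card D)))) \<le> ennreal (enn2real (entropy H C \<epsilon>))"
      using le fin unfolding D(2) by (simp add: sqrt_ln_double_def)
    then have "sqrt (ln (2 * real (card D))) \<le> enn2real (entropy H C \<epsilon>)"
      by simp
    then have "(sqrt (ln (2 * real (card D))))\<^sup>2 \<le> (enn2real (entropy H C \<epsilon>))\<^sup>2"
      using False by (intro power_mono) auto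
    then have "ln (2 * real (card D)) \<le> (enn2real (entropy H C \<epsilon>))\<^sup>2"
      using False by simp
    then show ?thesis
      using False exp_le_cancel_iff[of "ln (2 * real (card D))"] by (simp del: exp_le_cancel_iff)
  qed simp
  with D(1) show ?thesis
    by (intro that[of D]) (auto simp: \<D>_def)
qed

section \<open>Nets for Lipschitz images of a function class\<close>

lemma weighted_point_measure:
  fixes w :: "'j \<Rightarrow> 'z::t1_space"
  assumes I: "finite I" and p: "\<And>j. j \<in> I \<Longrightarrow> 0 \<le> p j" "(\<Sum>j\<in>I. p j) = 1"
  obtains Q where "Q \<in> fin_supp_probs"
    "\<And>g::'z \<Rightarrow> real. g \<in> borel_measurable borel \<Longrightarrow> (\<integral>z. g z \<partial>Q) = (\<Sum>j\<in>I. p j * g (w j))"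
proof -
  let ?P = "point_measure I (\<lambda>j. ennreal (p j))"
  have one: "(\<Sum>j\<in>I. ennreal (p j)) = 1"
    using p by (subst sum_ennreal) auto
  interpret P: prob_space ?P
    using I one by (intro prob_space_point_measure) auto
  have w: "w \<in> measurable ?P borel" by simp
  interpret Q: prob_space "distr ?P borel w"
    using w by (rule P.prob_space_distr)
  have "w ` I \<in> sets borel"
    using I by (intro borel_closed finite_imp_closed) auto
  then have "emeasure (distr ?P borel w) (w ` I) = emeasure ?P (w -` (w ` I) \<inter> space ?P)"
    by (rule emeasure_distr[OF w])
  also have "w -` (w ` I) \<inter> space ?P = space ?P"
    by (auto simp: space_point_measure)
  finally have "emeasure (distr ?P borel w) (w ` I) = 1"
    by (simp add: P.emeasure_space_1)
  then have "distr ?P borel w \<in> fin_supp_probs"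
    unfolding fin_supp_probs_def using I Q.prob_space_axioms by auto
  moreover have "(\<integral>z. g z \<partial>distr ?P borel w) = (\<Sum>j\<in>I. p j * g (w j))"
    if "g \<in> borel_measurable borel" for g :: "'z \<Rightarrow> real"
    using that I p by (subst integral_distr[OF w]) (auto simp: lebesgue_integral_point_measure_finite)
  ultimately show ?thesis
    by (rule that)
qed

text \<open>The grid consists of the midpoints of \<open>N\<close> equal subintervals of length
  \<open>2 * U / N\<close>, hence the radius \<open>U / N\<close>.\<close>

lemma interval_grid:
  fixes U :: real
  assumes U: "U > 0" and N: "N \<ge> 1"
  obtains S where "finite S" "card S \<le> N" "S \<subseteq> {-U..U}"
    "\<And>x. \<bar>x\<bar> \<le> U \<Longrightarrow> \<exists>y\<in>S. \<bar>x - y\<bar> \<le> U / real N"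
proof -
  define y where "y i = U / real N * (2 * real i + 1 - real N)" for i
  have N0: "real N > 0" using N by simp
  show ?thesis
  proof
    show "finite (y ` {..<N})" "card (y ` {..<N}) \<le> N"
      using card_image_le[of "{..<N}" y] by auto
    show "y ` {..<N} \<subseteq> {-U..U}"
    proof (rule image_subsetI)
      fix i assume "i \<in> {..<N}"
      then have "\<bar>2 * real i + 1 - real N\<bar> \<le> real N" by auto
      then have "U / real N * \<bar>2 * real i + 1 - real N\<bar> \<le> U / real N * real N"
        using U by (intro mult_left_mono) auto
      then have "\<bar>y i\<bar> \<le> U"
        using U N0 by (simp add: y_def abs_mult)
      then show "y i \<in> {-U..U}" by auto
    qed
    fix x assume x: "\<bar>x\<bar> \<le> U"
    define t where "t = (x + U) / (2 * U) * real N"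
    have x_eq: "x = U / real N * (2 * t - real N)"
      using U N0 by (simp add: t_def field_simps)
    have t: "0 \<le> t" "t \<le> real N"
    proof -
      show "0 \<le> t" using x U by (auto simp: t_def)
      have "(x + U) / (2 * U) \<le> 1" using x U by auto
      then have "(x + U) / (2 * U) * real N \<le> 1 * real N"
        by (intro mult_right_mono) auto
      then show "t \<le> real N" unfolding t_def by simp
    qed
    obtain i where i: "i < N" "\<bar>2 * t - 2 * real i - 1\<bar> \<le> 1"
    proof (cases "t = real N")
      case True
      then show ?thesis using N by (intro that[of "N - 1"]) (auto simp: of_nat_diff)
    next
      case False
      define i where "i = nat \<lfloor>t\<rfloor>"
      have "real i \<le> t" "t < real i + 1"
        using t by (auto simp: i_def)
      then show ?thesis
        using False t by (intro that[of i]) auto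
    qed
    have "x - y i = U / real N * (2 * t - 2 * real i - 1)"
      unfolding x_eq y_def by (simp add: algebra_simps)
    then have "\<bar>x - y i\<bar> = U / real N * \<bar>2 * t - 2 * real i - 1\<bar>"
      using U by (simp add: abs_mult)
    also have "\<dots> \<le> U / real N * 1"
      using i U by (intro mult_left_mono) auto
    finally show "\<exists>y\<in>y ` {..<N}. \<bar>x - y\<bar> \<le> U / real N"
      using i by auto
  qed
qed

lemma sum_square_le: "(a + b)\<^sup>2 \<le> 2 * (a\<^sup>2 + b\<^sup>2)" for a b :: real
  using sum_squares_bound[of a b] by (simp add: power2_sum)

text \<open>Abstracts the class of losses: \<open>F h x\<close> will be the loss of the member
  \<open>h\<close> at shift \<open>x\<close>, \<open>L\<close> the slope of the conjugate, and
  \<open>U\<close> the bound \<open>x_upper\<close> on the shifts.\<close>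

locale lipschitz_class =
  fixes H :: "('z::t1_space \<Rightarrow> real) set" and \<xi> L :: "'z \<Rightarrow> real"
    and F :: "('z \<Rightarrow> real) \<Rightarrow> real \<Rightarrow> 'z \<Rightarrow> real" and U :: real
  assumes H_measurable: "\<And>h. h \<in> H \<Longrightarrow> h \<in> borel_measurable borel"
    and \<xi>_measurable: "\<xi> \<in> borel_measurable borel" and \<xi>_pos: "\<And>z. 0 < \<xi> z"
    and L_pos: "\<And>z. 0 < L z" and U_pos: "0 < U"
    and F_lipschitz: "\<And>h h' x x' z. h \<in> H \<Longrightarrow> h' \<in> H \<Longrightarrow> \<bar>x\<bar> \<le> U \<Longrightarrow> \<bar>x'\<bar> \<le> U \<Longrightarrow>
      \<bar>F h x z - F h' x' z\<bar> \<le> L z * (\<bar>h z - h' z\<bar> + \<bar>x - x'\<bar>)"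
    and F_bound: "\<And>h x z. h \<in> H \<Longrightarrow> \<bar>x\<bar> \<le> U \<Longrightarrow> \<bar>F h x z\<bar> \<le> L z * (\<xi> z + U)"
begin

text \<open>Up to a factor 2 the squared envelope of the class. For the losses it is exactly the
  square of \<open>xi_map\<close>.\<close>

definition env2 :: "'z \<Rightarrow> real"
  where "env2 z = (L z)\<^sup>2 * ((\<xi> z)\<^sup>2 + U\<^sup>2)"

lemma F_square_le: "h \<in> H \<Longrightarrow> \<bar>x\<bar> \<le> U \<Longrightarrow> (F h x z)\<^sup>2 \<le> 2 * env2 z"
proof -
  assume "h \<in> H" "\<bar>x\<bar> \<le> U"
  then have "\<bar>F h x z\<bar>\<^sup>2 \<le> (L z * (\<xi> z + U))\<^sup>2"
    by (intro power_mono F_bound) auto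
  also have "\<dots> \<le> (L z)\<^sup>2 * (2 * ((\<xi> z)\<^sup>2 + U\<^sup>2))"
    unfolding power_mult_distrib by (intro mult_left_mono sum_square_le) auto
  finally show ?thesis by (simp add: env2_def algebra_simps)
qed

text \<open>By \<open>WQ\<close>, with weights proportional to \<open>(L (w j))\<^sup>2\<close> a
  squared norm in \<open>L\<^sup>2(Q)\<close> times \<open>W\<close> is the sum of squares damaged
  by the Lipschitz factor. The net is a cover of \<open>H\<close> times a grid of
  \<open>2 ^ k\<close> shifts: the cover contributes the \<open>\<xi>\<close> part of
  \<open>env2\<close>, the grid the \<open>U\<close> part, both scaled by the same power of
  1/4.\<close>

lemma net:
  fixes w :: "'j \<Rightarrow> 'z"
  assumes I: "finite I" "I \<noteq> {}" and fin: "entropy H \<xi> ((1/2)^k) < \<infinity>"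
  obtains C where "finite C" "C \<subseteq> H \<times> {-U..U}"
    "2 * real (card C) \<le> exp ((enn2real (entropy H \<xi> ((1/2)^k)))\<^sup>2) * 2 ^ k"
    "\<And>h x. h \<in> H \<Longrightarrow> \<bar>x\<bar> \<le> U \<Longrightarrow> \<exists>c\<in>C.
      (\<Sum>j\<in>I. (F h x (w j) - F (fst c) (snd c) (w j))\<^sup>2) \<le> 2 * ((1/2)^k)\<^sup>2 * (\<Sum>j\<in>I. env2 (w j))"
proof -
  define W where "W = (\<Sum>j\<in>I. (L (w j))\<^sup>2)"
  have W: "W > 0"
    unfolding W_def using I L_pos by (intro sum_pos) (auto simp: less_imp_neq[symmetric])
  define p where "p j = (L (w j))\<^sup>2 / W" for j
  have p: "0 \<le> p j" for j using W by (simp add: p_def)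
  have p1: "(\<Sum>j\<in>I. p j) = 1"
    unfolding p_def sum_divide_distrib[symmetric] W_def[symmetric] using W by simp
  obtain Q where Q: "Q \<in> fin_supp_probs"
    and EQ: "\<And>g::'z \<Rightarrow> real. g \<in> borel_measurable borel \<Longrightarrow> (\<integral>z. g z \<partial>Q) = (\<Sum>j\<in>I. p j * g (w j))"
    using weighted_point_measure[OF I(1) p p1] by blast
  have WQ: "W * (l2_norm Q g)\<^sup>2 = (\<Sum>j\<in>I. (L (w j))\<^sup>2 * (g (w j))\<^sup>2)" if [measurable]: "g \<in> borel_measurable borel" for g
  proof -
    have "(\<integral>z. (g z)\<^sup>2 \<partial>Q) = (\<Sum>j\<in>I. p j * (g (w j))\<^sup>2)"
      by (rule EQ) measurable
    moreover have "0 \<le> (\<integral>z. (g z)\<^sup>2 \<partial>Q)" by simp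
    ultimately have "(l2_norm Q g)\<^sup>2 = (\<Sum>j\<in>I. p j * (g (w j))\<^sup>2)"
      by (simp add: l2_norm_def)
    then show ?thesis
      using W by (simp add: p_def sum_distrib_left)
  qed
  obtain D where D: "finite D" "D \<subseteq> H" "2 * real (card D) \<le> exp ((enn2real (entropy H \<xi> ((1/2)^k)))\<^sup>2)"
    and Dc: "\<And>h. h \<in> H \<Longrightarrow> \<exists>c\<in>D. l2_norm Q (\<lambda>z. h z - c z) \<le> (1/2)^k * l2_norm Q \<xi>"
    using entropy_cover[OF Q fin] by blast
  obtain S where S: "finite S" "card S \<le> 2 ^ k" "S \<subseteq> {-U..U}"
    and Sc: "\<And>x. \<bar>x\<bar> \<le> U \<Longrightarrow> \<exists>y\<in>S. \<bar>x - y\<bar> \<le> U / real (2 ^ k)"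
    by (rule interval_grid[OF U_pos, of "2 ^ k"]) auto
  show ?thesis
  proof
    show "finite (D \<times> S)" "D \<times> S \<subseteq> H \<times> {-U..U}"
      using D S by auto
    have "2 * real (card (D \<times> S)) = (2 * real (card D)) * real (card S)"
      by (simp add: card_cartesian_product)
    also have "\<dots> \<le> exp ((enn2real (entropy H \<xi> ((1/2)^k)))\<^sup>2) * 2 ^ k"
    proof (rule mult_mono[OF D(3)])
      show "real (card S) \<le> 2 ^ k"
        using of_nat_mono[OF S(2), where 'a=real] by simp
    qed simp_all
    finally show "2 * real (card (D \<times> S)) \<le> exp ((enn2real (entropy H \<xi> ((1/2)^k)))\<^sup>2) * 2 ^ k" .
    fix h x assume h: "h \<in> H" and x: "\<bar>x\<bar> \<le> U"
    obtain c where c: "c \<in> D" "l2_norm Q (\<lambda>z. h z - c z) \<le> (1/2)^k * l2_norm Q \<xi>"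
      using Dc[OF h] by blast
    obtain y where y: "y \<in> S" "\<bar>x - y\<bar> \<le> U / real (2 ^ k)"
      using Sc[OF x] by blast
    have cH: "c \<in> H" using c(1) D(2) by blast
    have "y \<in> {-U..U}" using y(1) S(3) by blast
    then have yU: "\<bar>y\<bar> \<le> U" by auto
    have "(\<Sum>j\<in>I. (F h x (w j) - F c y (w j))\<^sup>2)
        \<le> (\<Sum>j\<in>I. 2 * ((L (w j))\<^sup>2 * (h (w j) - c (w j))\<^sup>2) + 2 * ((L (w j))\<^sup>2 * (x - y)\<^sup>2))"
    proof (rule sum_mono)
      fix j
      have "\<bar>F h x (w j) - F c y (w j)\<bar>\<^sup>2 \<le> (L (w j) * (\<bar>h (w j) - c (w j)\<bar> + \<bar>x - y\<bar>))\<^sup>2"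
        by (intro power_mono F_lipschitz h cH x yU) auto
      also have "\<dots> \<le> (L (w j))\<^sup>2 * (2 * (\<bar>h (w j) - c (w j)\<bar>\<^sup>2 + \<bar>x - y\<bar>\<^sup>2))"
        unfolding power_mult_distrib by (intro mult_left_mono sum_square_le) auto
      finally show "(F h x (w j) - F c y (w j))\<^sup>2
          \<le> 2 * ((L (w j))\<^sup>2 * (h (w j) - c (w j))\<^sup>2) + 2 * ((L (w j))\<^sup>2 * (x - y)\<^sup>2)"
        by (simp add: algebra_simps)
    qed
    also have "\<dots> = 2 * (W * (l2_norm Q (\<lambda>z. h z - c z))\<^sup>2) + 2 * (W * (x - y)\<^sup>2)"
      using H_measurable[OF h] H_measurable[OF cH]
      by (subst WQ) (auto simp: sum.distrib sum_distrib_left W_def sum_distrib_right)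
    also have "\<dots> \<le> 2 * (W * ((1/2)^k * l2_norm Q \<xi>)\<^sup>2) + 2 * (W * (U / 2 ^ k)\<^sup>2)"
    proof (intro add_mono mult_left_mono)
      show "(l2_norm Q (\<lambda>z. h z - c z))\<^sup>2 \<le> ((1/2)^k * l2_norm Q \<xi>)\<^sup>2"
        using c(2) by (intro power_mono) (auto simp: l2_norm_def)
      show "(x - y)\<^sup>2 \<le> (U / 2 ^ k)\<^sup>2"
        using power_mono[OF y(2), of 2] by simp
    qed (use W in auto)
    also have "\<dots> = 2 * ((1/2)^k)\<^sup>2 * (W * (l2_norm Q \<xi>)\<^sup>2 + W * U\<^sup>2)"
      by (simp add: power_mult_distrib power_divide algebra_simps)
    also have "W * (l2_norm Q \<xi>)\<^sup>2 + W * U\<^sup>2 = (\<Sum>j\<in>I. env2 (w j))"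
      unfolding WQ[OF \<xi>_measurable] unfolding W_def env2_def
      by (simp add: sum_distrib_right sum.distrib distrib_left)
    finally show "\<exists>c\<in>D \<times> S. (\<Sum>j\<in>I. (F h x (w j) - F (fst c) (snd c) (w j))\<^sup>2)
        \<le> 2 * ((1/2)^k)\<^sup>2 * (\<Sum>j\<in>I. env2 (w j))"
      using c(1) y(1) by (intro bexI[of _ "(c, y)"]) auto
  qed
qed

end

section \<open>Numerical bounds for the chaining and the chained class\<close>

lemma sum_half_powers: "(\<Sum>k=2..K. (1/2::real)^k) \<le> 1/2"
proof -
  have "(\<Sum>k=2..K. (1/2::real)^k) = 1/2 - (1/2)^K" if "K \<ge> 1" for K
    using that by (induction K rule: dec_induct) auto
  then show ?thesis
    by (cases "K \<ge> 1") auto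
qed

lemma sum_linear_half_powers: "(\<Sum>k=2..K. (1/2::real)^k * real k) \<le> 3/2"
proof -
  have "(\<Sum>k=2..K. (1/2::real)^k * real k) = 3/2 - (1/2)^K * (real K + 2)" if "K \<ge> 1" for K
    using that
  proof (induction K rule: dec_induct)
    case (step n)
    define p :: real where "p = (1/2)^n"
    have "(\<Sum>k=2..Suc n. (1/2::real)^k * real k) = 3/2 - p * (real n + 2) + p / 2 * real (Suc n)"
      using step by (simp add: p_def)
    also have "\<dots> = 3/2 - p / 2 * (real (Suc n) + 2)"
      by (simp add: algebra_simps)
    finally show ?case by (simp add: p_def)
  qed simp
  then show ?thesis
    by (cases "K \<ge> 1") auto
qed

lemma sum_paired_diff_square:
  fixes b :: "nat \<Rightarrow> real"
  shows "(\<Sum>j=1..n. (b j - b (j + n))\<^sup>2) \<le> 2 * (\<Sum>j=1..2*n. (b j)\<^sup>2)"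
proof -
  have "(\<Sum>j=1..n. (b j - b (j + n))\<^sup>2) \<le> (\<Sum>j=1..n. 2 * ((b j)\<^sup>2 + (b (j + n))\<^sup>2))"
    using sum_square_le[of "b j" "- b (j + n)" for j] by (intro sum_mono) simp
  also have "\<dots> = 2 * ((\<Sum>j=1..n. (b j)\<^sup>2) + (\<Sum>j=1..n. (b (j + n))\<^sup>2))"
    by (simp add: sum.distrib sum_distrib_left)
  also have "(\<Sum>j=1..n. (b (j + n))\<^sup>2) = (\<Sum>j=1+n..n+n. (b j)\<^sup>2)"
    by (rule sum.shift_bounds_cl_nat_ivl[symmetric])
  also have "(\<Sum>j=1..n. (b j)\<^sup>2) + (\<Sum>j=1+n..n+n. (b j)\<^sup>2) = (\<Sum>j=1..2*n. (b j)\<^sup>2)"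
    using sum.ub_add_nat[of 1 n "\<lambda>j. (b j)\<^sup>2" n] by (simp add: mult_2)
  finally show ?thesis .
qed

lemma four_power_le_exp_square:
  assumes "k \<ge> 2"
  shows "(4::real) ^ k \<le> exp ((real k)\<^sup>2)"
proof -
  have "(2::real) \<le> exp 1"
    using exp_ge_add_one_self[of 1] by simp
  then have "(2::real) ^ (2 * k) \<le> exp 1 ^ (2 * k)"
    by (rule power_mono) simp
  also have "\<dots> = exp (2 * real k)"
    by (simp flip: exp_of_nat_mult)
  also have "\<dots> \<le> exp ((real k)\<^sup>2)"
    using assms by (simp add: power2_eq_square)
  finally show ?thesis by (simp add: power_mult)
qed

context lipschitz_class
begin

text \<open>The summed thresholds are \<open>28\<close> times
  \<open>2 * J0 + 3/2 + \<omega>/2\<close> in units of \<open>sqrt (real n) * \<sigma>\<close>,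
  which explains 56, 42 and 14; one more unit covers the passage from the class to its finest net.
  The bound 6 on the weights is the budget left by the ghost sample argument.\<close>

lemma rademacher_class_bound:
  fixes w :: "nat \<Rightarrow> 'z"
  assumes n: "n \<ge> 1" and \<sigma>: "\<sigma> > 0" and \<omega>: "\<omega> \<ge> 0"
    and J: "entropy_integral H \<xi> (1/4) < \<infinity>"
    and S: "(\<Sum>j=1..2*n. env2 (w j)) \<le> 6 * real n * \<sigma>\<^sup>2"
    and \<kappa>: "sqrt (real n) * \<sigma> * (56 * enn2real (entropy_integral H \<xi> (1/4)) + 43 + 14 * \<omega>) \<le> \<kappa>"
  shows "real (card {s\<in>Pow {1..n}. \<exists>h\<in>H. \<exists>x. \<bar>x\<bar> \<le> U \<and>
      \<kappa> < \<bar>\<Sum>j=1..n. sgs s j * (F h x (w j) - F h x (w (j + n)))\<bar>}) \<le> 2 ^ n * (1/2 * exp (- \<omega>\<^sup>2))"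
proof -
  define J0 where "J0 = enn2real (entropy_integral H \<xi> (1/4))"
  define R where "R = real n * \<sigma>\<^sup>2"
  have R: "R > 0" and sqrtR: "sqrt R = sqrt (real n) * \<sigma>" "(sqrt (real n) * \<sigma>)\<^sup>2 = R"
    using n \<sigma> by (auto simp: R_def real_sqrt_mult power_mult_distrib)
  define Sw where "Sw = (\<Sum>j=1..2*n. env2 (w j))"
  have Sw: "Sw \<le> 6 * R" using S by (simp add: Sw_def R_def)
  define h where "h k = enn2real (entropy H \<xi> ((1/2)^k))" for k
  have h0: "h k \<ge> 0" for k by (simp add: h_def)
  \<comment> \<open>The scale 1/4 is dyadic level 2, so every sum over levels starts at 2 and the
    entropies are controlled by the integral up to 1/4.\<close>
  have quarter: "(1/4::real) = (1/2)^2" by (simp add: power2_eq_square)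
  have J': "entropy_integral H \<xi> ((1/2)^2) < \<infinity>" using J by (simp add: quarter)
  have fin: "entropy H \<xi> ((1/2)^k) < \<infinity>" if "k \<ge> 2" for k
    using entropy_finite[OF J' that] .
  have hsum: "(\<Sum>k=2..K. (1/2)^k * h k) \<le> 2 * J0" for K
    using entropy_dyadic_sum[OF J'] by (simp add: h_def J0_def quarter)
  have "\<forall>k. \<exists>C. finite C \<and> C \<subseteq> H \<times> {-U..U} \<and> (k \<ge> 2 \<longrightarrow> 2 * real (card C) \<le> exp ((h k)\<^sup>2) * 2 ^ k \<and>
      (\<forall>h x. h \<in> H \<longrightarrow> \<bar>x\<bar> \<le> U \<longrightarrow> (\<exists>c\<in>C.
      (\<Sum>j=1..2*n. (F h x (w j) - F (fst c) (snd c) (w j))\<^sup>2) \<le> 2 * ((1/2)^k)\<^sup>2 * Sw)))"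
  proof
    fix k
    show "\<exists>C. finite C \<and> C \<subseteq> H \<times> {-U..U} \<and> (k \<ge> 2 \<longrightarrow> 2 * real (card C) \<le> exp ((h k)\<^sup>2) * 2 ^ k \<and>
      (\<forall>h x. h \<in> H \<longrightarrow> \<bar>x\<bar> \<le> U \<longrightarrow> (\<exists>c\<in>C.
      (\<Sum>j=1..2*n. (F h x (w j) - F (fst c) (snd c) (w j))\<^sup>2) \<le> 2 * ((1/2)^k)\<^sup>2 * Sw)))"
    proof (cases "k \<ge> 2")
      case True
      have I: "finite {1..2*n}" "{1..2*n} \<noteq> {}" using n by auto
      obtain C where "finite C" "C \<subseteq> H \<times> {-U..U}" "2 * real (card C) \<le> exp ((h k)\<^sup>2) * 2 ^ k"
        "\<And>h x. h \<in> H \<Longrightarrow> \<bar>x\<bar> \<le> U \<Longrightarrow> \<exists>c\<in>C.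
          (\<Sum>j=1..2*n. (F h x (w j) - F (fst c) (snd c) (w j))\<^sup>2) \<le> 2 * ((1/2)^k)\<^sup>2 * Sw"
        unfolding h_def Sw_def using net[OF I fin[OF True], of w] by blast
      then show ?thesis by blast
    qed (auto intro: exI[of _ "{}"])
  qed
  then obtain C where C: "\<And>k. finite (C k)" "\<And>k. C k \<subseteq> H \<times> {-U..U}"
    and Ccard: "\<And>k. k \<ge> 2 \<Longrightarrow> 2 * real (card (C k)) \<le> exp ((h k)\<^sup>2) * 2 ^ k"
    and Ccov: "\<And>k h x. k \<ge> 2 \<Longrightarrow> h \<in> H \<Longrightarrow> \<bar>x\<bar> \<le> U \<Longrightarrow> \<exists>c\<in>C k.
      (\<Sum>j=1..2*n. (F h x (w j) - F (fst c) (snd c) (w j))\<^sup>2) \<le> 2 * ((1/2)^k)\<^sup>2 * Sw"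
    unfolding choice_iff by blast
  define a where "a c j = F (fst c) (snd c) (w j) - F (fst c) (snd c) (w (j + n))" for c j
  txt \<open>The links of level \<open>k\<close> have squared length at most \<open>v k\<close>. With the threshold \<open>\<tau> k\<close> the exponent
    \<open>(\<tau> k)\<^sup>2 / (2 * v k)\<close> dominates \<open>(h k)\<^sup>2 + k\<^sup>2 + \<omega>\<^sup>2\<close>: the first two terms pay for the cardinality of
    the net and for the sum over \<open>k\<close>.\<close>
  define v where "v k = 384 * ((1/2)^k)\<^sup>2 * R" for k
  define \<tau> where "\<tau> k = 28 * sqrt R * (1/2)^k * (h k + real k + \<omega>)" for k
  have v: "v k > 0" for k using R by (simp add: v_def)
  have \<tau>0: "\<tau> k \<ge> 0" for k using R h0[of k] \<omega> by (simp add: \<tau>_def)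
  have close: "\<exists>c'\<in>C k. (\<Sum>j=1..n. (a c j - a c' j)\<^sup>2) \<le> 24 * ((1/2)^k)\<^sup>2 * R"
    if k: "k \<ge> 2" and c: "fst c \<in> H" "\<bar>snd c\<bar> \<le> U" for k c
  proof -
    obtain c' where c': "c' \<in> C k"
      "(\<Sum>j=1..2*n. (F (fst c) (snd c) (w j) - F (fst c') (snd c') (w j))\<^sup>2) \<le> 2 * ((1/2)^k)\<^sup>2 * Sw"
      using Ccov[OF k c] by blast
    let ?b = "\<lambda>j. F (fst c) (snd c) (w j) - F (fst c') (snd c') (w j)"
    have "(\<Sum>j=1..n. (a c j - a c' j)\<^sup>2) = (\<Sum>j=1..n. (?b j - ?b (j + n))\<^sup>2)"
      by (intro sum.cong refl arg_cong[where f="\<lambda>x. x\<^sup>2"]) (simp add: a_def)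
    also have "\<dots> \<le> 2 * (\<Sum>j=1..2*n. (?b j)\<^sup>2)"
      by (rule sum_paired_diff_square)
    also have "\<dots> \<le> 2 * (2 * ((1/2)^k)\<^sup>2 * Sw)"
      by (rule mult_left_mono[OF c'(2)]) simp
    also have "\<dots> = 4 * ((1/2)^k)\<^sup>2 * Sw"
      by simp
    also have "\<dots> \<le> 4 * ((1/2)^k)\<^sup>2 * (6 * R)"
      using Sw by (intro mult_left_mono) auto
    finally show ?thesis
      using c'(1) by (intro bexI[of _ c']) (auto simp: mult_ac)
  qed
  have inC: "fst c \<in> H" "\<bar>snd c\<bar> \<le> U" if "c \<in> C k" for c k
  proof -
    have "c \<in> H \<times> {-U..U}" using C(2) that by blast
    then show "fst c \<in> H" "\<bar>snd c\<bar> \<le> U" by (auto simp: mem_Times_iff)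
  qed
  \<comment> \<open>The finest level is chosen so that the Cauchy-Schwarz error
    \<open>5 * sqrt n * (1/2)^K * sqrt R\<close> of the final approximation is at most
    \<open>sqrt R\<close>.\<close>
  obtain K0 where K0: "(1/2::real) ^ K0 < 1 / (5 * sqrt (real n))"
    using real_arch_pow_inv[of "1 / (5 * sqrt (real n))" "1/2"] n by auto
  define K where "K = K0 + 2"
  have K: "K \<ge> 2" by (simp add: K_def)
  have "(1/2::real) ^ K \<le> (1/2) ^ K0"
    unfolding K_def by (rule power_decreasing) auto
  then have "(1/2) ^ K \<le> 1 / (5 * sqrt (real n))"
    using K0 by linarith
  then have "(1/2) ^ K * (5 * sqrt (real n)) \<le> 1 / (5 * sqrt (real n)) * (5 * sqrt (real n))"
    by (intro mult_right_mono) auto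
  then have Kn: "5 * sqrt (real n) * (1/2) ^ K \<le> 1"
    using n by (simp add: mult.commute)
  have \<tau>sum: "(\<Sum>k=2..K. \<tau> k) \<le> sqrt R * (56 * J0 + 42 + 14 * \<omega>)"
  proof -
    have "(\<Sum>k=2..K. \<tau> k) = 28 * sqrt R * ((\<Sum>k=2..K. (1/2)^k * h k)
        + (\<Sum>k=2..K. (1/2)^k * real k) + \<omega> * (\<Sum>k=2..K. (1/2)^k))"
      unfolding \<tau>_def sum_distrib_left sum.distrib[symmetric]
      by (intro sum.cong refl) (simp add: algebra_simps)
    also have "\<dots> \<le> 28 * sqrt R * (2 * J0 + 3/2 + \<omega> * (1/2))"
      using R \<omega> by (intro mult_left_mono add_mono hsum sum_half_powers sum_linear_half_powers) auto
    finally show ?thesis by (simp add: algebra_simps)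
  qed
  have chain: "real (card {s\<in>Pow {1..n}. \<exists>c\<in>C K. (\<Sum>k=2..K. \<tau> k) < \<bar>\<Sum>j=1..n. sgs s j * a c j\<bar>})
    \<le> 2 ^ card {1..n} * (\<Sum>k=2..K. 2 * real (card (C k)) * exp (- (\<tau> k)\<^sup>2 / (2 * v k)))"
  proof (rule rademacher_chaining[where v = v])
    fix c assume c: "c \<in> C 2"
    let ?b = "\<lambda>j. F (fst c) (snd c) (w j)"
    have "(\<Sum>j=1..n. (a c j)\<^sup>2) \<le> 2 * (\<Sum>j=1..2*n. (?b j)\<^sup>2)"
      unfolding a_def by (rule sum_paired_diff_square)
    also have "\<dots> \<le> 2 * (\<Sum>j=1..2*n. 2 * env2 (w j))"
      using inC[OF c] by (intro mult_left_mono sum_mono F_square_le) auto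
    also have "\<dots> = 4 * Sw"
      by (simp add: Sw_def sum_distrib_left)
    \<comment> \<open>Level 2 fixes the constant in \<open>v\<close>: the members themselves have
      squared length up to \<open>24 * R\<close>, and \<open>24 * 16 = 384\<close>. The links would
      only ask for \<open>24 * 4 = 96\<close>.\<close>
    also have "\<dots> \<le> v 2"
      using Sw by (simp add: v_def power2_eq_square)
    finally show "(\<Sum>j=1..n. (a c j)\<^sup>2) \<le> v 2" .
  next
    fix k c assume k: "2 \<le> k" and c: "c \<in> C (Suc k)"
    have "24 * ((1/2)^k)\<^sup>2 * R \<le> v (Suc k)"
      using R by (simp add: v_def power2_eq_square)
    then show "\<exists>c'\<in>C k. (\<Sum>j=1..n. (a c j - a c' j)\<^sup>2) \<le> v (Suc k)"
      using close[OF k inC[OF c]] order_trans by blast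
  qed (use K C v \<tau>0 in auto)
  have "(\<Sum>k=2..K. 2 * real (card (C k)) * exp (- (\<tau> k)\<^sup>2 / (2 * v k))) \<le> (\<Sum>k=2..K. (1/2)^k * exp (- \<omega>\<^sup>2))"
  proof (rule sum_mono)
    fix k assume "k \<in> {2..K}"
    then have k: "k \<ge> 2" by simp
    have "(h k)\<^sup>2 + (real k)\<^sup>2 + \<omega>\<^sup>2 \<le> (h k + real k + \<omega>)\<^sup>2"
      using h0[of k] \<omega> by (simp add: power2_eq_square algebra_simps)
    \<comment> \<open>Here \<open>784 = 28\<^sup>2\<close> and \<open>768 = 2 * 384\<close>; 28 is
      the least integer whose square reaches 768.\<close>
    also have "\<dots> \<le> 784 / 768 * (h k + real k + \<omega>)\<^sup>2"
      by simp
    also have "\<dots> = (\<tau> k)\<^sup>2 / (2 * v k)"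
      using R by (simp add: \<tau>_def v_def power_mult_distrib)
    finally have "exp (- (\<tau> k)\<^sup>2 / (2 * v k)) \<le> exp (- ((h k)\<^sup>2 + (real k)\<^sup>2 + \<omega>\<^sup>2))"
      by simp
    then have "2 * real (card (C k)) * exp (- (\<tau> k)\<^sup>2 / (2 * v k))
        \<le> (exp ((h k)\<^sup>2) * 2 ^ k) * exp (- ((h k)\<^sup>2 + (real k)\<^sup>2 + \<omega>\<^sup>2))"
      by (rule mult_mono[OF Ccard[OF k]]) simp_all
    also have "\<dots> = (exp ((h k)\<^sup>2) * exp (- (h k)\<^sup>2)) * (2 ^ k / exp ((real k)\<^sup>2)) * exp (- \<omega>\<^sup>2)"
      by (simp add: exp_add exp_minus exp_diff divide_inverse)
    also have "\<dots> = 2 ^ k / exp ((real k)\<^sup>2) * exp (- \<omega>\<^sup>2)"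
      by (simp flip: exp_add)
    \<comment> \<open>The entropy factor has cancelled; \<open>exp (k\<^sup>2)\<close>, being at
      least \<open>4 ^ k\<close>, beats the \<open>2 ^ k\<close> grid points and leaves a summable
      \<open>(1/2) ^ k\<close>.\<close>
    also have "\<dots> \<le> 2 ^ k / 4 ^ k * exp (- \<omega>\<^sup>2)"
      using four_power_le_exp_square[OF k] by (intro mult_right_mono divide_left_mono) auto
    also have "(2::real) ^ k / 4 ^ k = (1/2) ^ k"
      by (simp flip: power_divide)
    finally show "2 * real (card (C k)) * exp (- (\<tau> k)\<^sup>2 / (2 * v k)) \<le> (1/2)^k * exp (- \<omega>\<^sup>2)" .
  qed
  also have "\<dots> \<le> 1/2 * exp (- \<omega>\<^sup>2)"
    unfolding sum_distrib_right[symmetric] by (intro mult_right_mono sum_half_powers) auto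
  finally have tail: "(\<Sum>k=2..K. 2 * real (card (C k)) * exp (- (\<tau> k)\<^sup>2 / (2 * v k))) \<le> 1/2 * exp (- \<omega>\<^sup>2)" .
  have "{s\<in>Pow {1..n}. \<exists>h\<in>H. \<exists>x. \<bar>x\<bar> \<le> U \<and> \<kappa> < \<bar>\<Sum>j=1..n. sgs s j * (F h x (w j) - F h x (w (j + n)))\<bar>}
      \<subseteq> {s\<in>Pow {1..n}. \<exists>c\<in>C K. (\<Sum>k=2..K. \<tau> k) < \<bar>\<Sum>j=1..n. sgs s j * a c j\<bar>}"
  proof
    fix s assume "s \<in> {s\<in>Pow {1..n}. \<exists>h\<in>H. \<exists>x. \<bar>x\<bar> \<le> U \<and> \<kappa> < \<bar>\<Sum>j=1..n. sgs s j * (F h x (w j) - F h x (w (j + n)))\<bar>}"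
    then obtain g x where s: "s \<in> Pow {1..n}" and g: "g \<in> H" "\<bar>x\<bar> \<le> U"
      and big: "\<kappa> < \<bar>\<Sum>j=1..n. sgs s j * a (g, x) j\<bar>"
      by (auto simp: a_def)
    obtain c where c: "c \<in> C K" "(\<Sum>j=1..n. (a (g, x) j - a c j)\<^sup>2) \<le> 24 * ((1/2)^K)\<^sup>2 * R"
      using close[OF K, of "(g, x)"] g by auto
    let ?d = "\<Sum>j=1..n. sgs s j * (a (g, x) j - a c j)"
    have "?d\<^sup>2 \<le> (\<Sum>j=1..n. (sgs s j)\<^sup>2) * (\<Sum>j=1..n. (a (g, x) j - a c j)\<^sup>2)"
      by (rule Cauchy_Schwarz_ineq_sum)
    also have "(\<Sum>j=1..n. (sgs s j)\<^sup>2) = real n"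
      by (simp add: sgs_def if_distrib[of "\<lambda>x. x\<^sup>2"] cong: if_cong)
    also have "real n * (\<Sum>j=1..n. (a (g, x) j - a c j)\<^sup>2) \<le> real n * (25 * ((1/2)^K)\<^sup>2 * R)"
    proof (rule mult_left_mono)
      \<comment> \<open>24 is rounded up to 25 so that the bound becomes a perfect square.\<close>
      have "24 * ((1/2)^K)\<^sup>2 * R \<le> 25 * ((1/2)^K)\<^sup>2 * R"
        using R by (intro mult_right_mono) auto
      then show "(\<Sum>j=1..n. (a (g, x) j - a c j)\<^sup>2) \<le> 25 * ((1/2)^K)\<^sup>2 * R"
        using c(2) by linarith
    qed simp
    also have "\<dots> = (5 * sqrt (real n) * (1/2)^K * sqrt R)\<^sup>2"
      using R by (simp add: power_mult_distrib)
    finally have "\<bar>?d\<bar> \<le> \<bar>5 * sqrt (real n) * (1/2)^K * sqrt R\<bar>"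
      unfolding abs_le_square_iff .
    also have "\<dots> = 5 * sqrt (real n) * (1/2)^K * sqrt R"
      using R by (intro abs_of_nonneg mult_nonneg_nonneg) auto
    also have "\<dots> \<le> 1 * sqrt R"
      using Kn R by (intro mult_right_mono) auto
    finally have d: "\<bar>?d\<bar> \<le> sqrt R" by simp
    have "(\<Sum>j=1..n. sgs s j * a (g, x) j) = (\<Sum>j=1..n. sgs s j * a c j) + ?d"
      by (simp add: algebra_simps flip: sum.distrib)
    moreover have "sqrt R * (56 * J0 + 42 + 14 * \<omega>) + sqrt R \<le> \<kappa>"
      using \<kappa> unfolding J0_def[symmetric] sqrtR(1)[symmetric] by (simp add: algebra_simps)
    ultimately have "(\<Sum>k=2..K. \<tau> k) < \<bar>\<Sum>j=1..n. sgs s j * a c j\<bar>"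
      using big d \<tau>sum by linarith
    then show "s \<in> {s\<in>Pow {1..n}. \<exists>c\<in>C K. (\<Sum>k=2..K. \<tau> k) < \<bar>\<Sum>j=1..n. sgs s j * a c j\<bar>}"
      using s c(1) by blast
  qed
  then have "real (card {s\<in>Pow {1..n}. \<exists>h\<in>H. \<exists>x. \<bar>x\<bar> \<le> U \<and> \<kappa> < \<bar>\<Sum>j=1..n. sgs s j * (F h x (w j) - F h x (w (j + n)))\<bar>})
      \<le> real (card {s\<in>Pow {1..n}. \<exists>c\<in>C K. (\<Sum>k=2..K. \<tau> k) < \<bar>\<Sum>j=1..n. sgs s j * a c j\<bar>})"
    by (intro of_nat_mono card_mono) auto
  also have "\<dots> \<le> 2 ^ n * (\<Sum>k=2..K. 2 * real (card (C k)) * exp (- (\<tau> k)\<^sup>2 / (2 * v k)))"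
    using chain by simp
  also have "\<dots> \<le> 2 ^ n * (1/2 * exp (- \<omega>\<^sup>2))"
    using tail by (intro mult_left_mono) auto
  finally show ?thesis .
qed

end

section \<open>Independent samples and symmetrization\<close>

lemma (in prob_space) second_moment_indep_sum:
  fixes Y :: "'i \<Rightarrow> 'a \<Rightarrow> real"
  assumes J: "finite J" and ind: "indep_vars (\<lambda>_. borel) Y J"
    and sq: "\<And>j. j \<in> J \<Longrightarrow> integrable M (\<lambda>\<omega>. (Y j \<omega>)\<^sup>2)"
    and zero: "\<And>j. j \<in> J \<Longrightarrow> expectation (Y j) = 0"
  shows "integrable M (\<lambda>\<omega>. (\<Sum>j\<in>J. Y j \<omega>)\<^sup>2)"
    and "expectation (\<lambda>\<omega>. (\<Sum>j\<in>J. Y j \<omega>)\<^sup>2) = (\<Sum>j\<in>J. expectation (\<lambda>\<omega>. (Y j \<omega>)\<^sup>2))"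
proof -
  have rv: "Y j \<in> borel_measurable M" if "j \<in> J" for j
    using ind that by (auto simp: indep_vars_def)
  have int: "integrable M (Y j)" if "j \<in> J" for j
    by (rule square_integrable_imp_integrable[OF rv[OF that] sq[OF that]])
  have cross: "integrable M (\<lambda>\<omega>. Y i \<omega> * Y j \<omega>)
      \<and> expectation (\<lambda>\<omega>. Y i \<omega> * Y j \<omega>) = (if i = j then expectation (\<lambda>\<omega>. (Y i \<omega>)\<^sup>2) else 0)"
    if ij: "i \<in> J" "j \<in> J" for i j
  proof (cases "i = j")
    case True
    then show ?thesis using sq[OF ij(1)] by (simp add: power2_eq_square)
  next
    case False
    have *: "finite {i, j}" "indep_vars (\<lambda>_. borel) Y {i, j}" "\<And>k. k \<in> {i, j} \<Longrightarrow> integrable M (Y k)"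
      using ij int indep_vars_subset[OF ind, of "{i, j}"] by auto
    show ?thesis
      using indep_vars_lebesgue_integral[OF *] indep_vars_integrable[OF *] False zero ij by simp
  qed
  have eq: "(\<Sum>j\<in>J. Y j \<omega>)\<^sup>2 = (\<Sum>i\<in>J. \<Sum>j\<in>J. Y i \<omega> * Y j \<omega>)" for \<omega>
    by (simp add: power2_eq_square sum_product)
  show "integrable M (\<lambda>\<omega>. (\<Sum>j\<in>J. Y j \<omega>)\<^sup>2)"
    unfolding eq using cross by (intro Bochner_Integration.integrable_sum) auto
  have "expectation (\<lambda>\<omega>. (\<Sum>j\<in>J. Y j \<omega>)\<^sup>2)
      = (\<Sum>i\<in>J. \<Sum>j\<in>J. expectation (\<lambda>\<omega>. Y i \<omega> * Y j \<omega>))"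
    unfolding eq using cross
    by (subst Bochner_Integration.integral_sum, fastforce intro: Bochner_Integration.integrable_sum,
        intro sum.cong refl Bochner_Integration.integral_sum) auto
  also have "\<dots> = (\<Sum>i\<in>J. \<Sum>j\<in>J. if i = j then expectation (\<lambda>\<omega>. (Y i \<omega>)\<^sup>2) else 0)"
    using cross by (intro sum.cong refl) auto
  also have "\<dots> = (\<Sum>j\<in>J. expectation (\<lambda>\<omega>. (Y j \<omega>)\<^sup>2))"
    using J by simp
  finally show "expectation (\<lambda>\<omega>. (\<Sum>j\<in>J. Y j \<omega>)\<^sup>2) = (\<Sum>j\<in>J. expectation (\<lambda>\<omega>. (Y j \<omega>)\<^sup>2))" .
qed

locale iid_sample = prob_space M for M :: "'a measure" +
  fixes Z :: "nat \<Rightarrow> 'a \<Rightarrow> 'z::t1_space" and PZ :: "'z measure"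
  assumes iid: "iid M Z PZ"
begin

lemma indep: "indep_vars (\<lambda>_. borel) Z {1..}"
  using iid by (simp add: iid_def)

lemma Z_measurable: "j \<ge> 1 \<Longrightarrow> Z j \<in> measurable M borel"
  using indep by (simp add: indep_vars_def)

lemma distr_Z: "j \<ge> 1 \<Longrightarrow> distr M borel (Z j) = PZ"
  using iid by (simp add: iid_def)

lemma sets_PZ [measurable_cong]: "sets PZ = sets borel"
  using distr_Z[of 1] by (metis le_refl sets_distr)

lemma space_PZ [simp]: "space PZ = UNIV"
  using sets_eq_imp_space_eq[OF sets_PZ] by simp

lemma measurable_PZ_eq: "measurable PZ N = measurable borel N"
  by (rule measurable_cong_sets) (simp_all add: sets_PZ)

sublocale PZ: prob_space PZ
  using distr_Z[of 1] prob_space_distr[OF Z_measurable, of 1] by simp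

lemma measure_PZ_UNIV [simp]: "measure PZ UNIV = 1"
  using PZ.prob_space by simp

sublocale PP: product_prob_space "\<lambda>_::nat. PZ" J for J
  by standard

lemma integral_Z:
  fixes f :: "'z \<Rightarrow> real"
  assumes "j \<ge> 1" "f \<in> borel_measurable PZ"
  shows "expectation (\<lambda>\<omega>. f (Z j \<omega>)) = (\<integral>z. f z \<partial>PZ)"
    and "integrable M (\<lambda>\<omega>. f (Z j \<omega>)) \<longleftrightarrow> integrable PZ f"
  using assms distr_Z[OF assms(1)] integral_distr[OF Z_measurable, of j f]
    integrable_distr_eq[OF Z_measurable, of j f]
  by (simp_all add: measurable_PZ_eq)

lemma measurable_Z_comp:
  assumes "1 \<le> j" "g \<in> measurable PZ N"
  shows "(\<lambda>\<omega>. g (Z j \<omega>)) \<in> measurable M N"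
  by (rule measurable_compose[OF Z_measurable[OF assms(1)] assms(2)[unfolded measurable_PZ_eq]])

lemma sets_PiM_PZ: "sets (Pi\<^sub>M J (\<lambda>_. PZ)) = sets (Pi\<^sub>M J (\<lambda>_. borel))"
  by (intro sets_PiM_cong) (simp_all add: sets_PZ)

lemma sample_measurable: "J \<subseteq> {1..} \<Longrightarrow> (\<lambda>\<omega>. \<lambda>j\<in>J. Z j \<omega>) \<in> measurable M (Pi\<^sub>M J (\<lambda>_. PZ))"
  by (intro measurable_restrict) (auto simp: measurable_cong_sets[OF refl sets_PZ] intro!: Z_measurable)

lemma distr_sample:
  assumes J: "J \<subseteq> {1..}" "J \<noteq> {}"
  shows "distr M (Pi\<^sub>M J (\<lambda>_. PZ)) (\<lambda>\<omega>. \<lambda>j\<in>J. Z j \<omega>) = Pi\<^sub>M J (\<lambda>_. PZ)"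
proof -
  have "distr M (Pi\<^sub>M J (\<lambda>_. PZ)) (\<lambda>\<omega>. \<lambda>j\<in>J. Z j \<omega>) = distr M (Pi\<^sub>M J (\<lambda>_. borel)) (\<lambda>\<omega>. \<lambda>j\<in>J. Z j \<omega>)"
    by (intro distr_cong) (simp_all add: sets_PiM_PZ)
  also have "\<dots> = Pi\<^sub>M J (\<lambda>j. distr M borel (Z j))"
    using indep_vars_subset[OF indep J(1)] J Z_measurable
    by (subst (asm) indep_vars_iff_distr_eq_PiM') auto
  also have "\<dots> = Pi\<^sub>M J (\<lambda>_. PZ)"
    using J by (intro PiM_cong) (auto simp: distr_Z)
  finally show ?thesis .
qed

lemma prob_sample:
  assumes J: "J \<subseteq> {1..}" "J \<noteq> {}" and S: "S \<in> sets (Pi\<^sub>M J (\<lambda>_. PZ))"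
  shows "emeasure (Pi\<^sub>M J (\<lambda>_. PZ)) S = emeasure M {\<omega>\<in>space M. (\<lambda>j\<in>J. Z j \<omega>) \<in> S}"
  by (subst distr_sample[OF J, symmetric], subst emeasure_distr[OF sample_measurable[OF J(1)] S])
     (auto intro!: arg_cong[where f="emeasure M"])

lemma sample_event:
  assumes "J \<subseteq> {1..}" "S \<in> sets (Pi\<^sub>M J (\<lambda>_. PZ))"
  shows "{\<omega>\<in>space M. (\<lambda>j\<in>J. Z j \<omega>) \<in> S} \<in> events"
proof -
  have "(\<lambda>\<omega>. \<lambda>j\<in>J. Z j \<omega>) -` S \<inter> space M \<in> events"
    by (rule measurable_sets[OF sample_measurable[OF assms(1)] assms(2)])
  also have "(\<lambda>\<omega>. \<lambda>j\<in>J. Z j \<omega>) -` S \<inter> space M = {\<omega>\<in>space M. (\<lambda>j\<in>J. Z j \<omega>) \<in> S}"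
    by auto
  finally show ?thesis .
qed

section \<open>Moment bounds for sample means and symmetrization\<close>

lemma mean_Chebyshev:
  fixes g :: "'z \<Rightarrow> real"
  assumes J: "finite J" "J \<subseteq> {1..}" "J \<noteq> {}" and g[measurable]: "g \<in> borel_measurable PZ"
    and sq: "integrable PZ (\<lambda>z. (g z)\<^sup>2)" and \<epsilon>: "\<epsilon> > 0"
  shows "prob {\<omega>\<in>space M. \<epsilon> \<le> \<bar>(\<Sum>j\<in>J. g (Z j \<omega>)) / real (card J) - (\<integral>z. g z \<partial>PZ)\<bar>}
    \<le> (\<integral>z. (g z)\<^sup>2 \<partial>PZ) / (real (card J) * \<epsilon>\<^sup>2)"
proof -
  define m where "m = (\<integral>z. g z \<partial>PZ)"
  define N where "N = real (card J)"
  have N: "N > 0" using J by (simp add: N_def card_gt_0_iff)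
  define Y where "Y j \<omega> = g (Z j \<omega>) - m" for j \<omega>
  have intg: "integrable PZ g"
    using g sq by (rule PZ.square_integrable_imp_integrable)
  have sqm: "integrable PZ (\<lambda>z. (g z - m)\<^sup>2)"
    unfolding power2_diff using intg sq by simp
  have var: "(\<integral>z. (g z - m)\<^sup>2 \<partial>PZ) \<le> (\<integral>z. (g z)\<^sup>2 \<partial>PZ)"
  proof -
    have "(\<integral>z. (g z - m)\<^sup>2 \<partial>PZ) = (\<integral>z. (g z)\<^sup>2 \<partial>PZ) + m\<^sup>2 - 2 * m * m"
      unfolding power2_diff using intg sq by (simp add: PZ.prob_space m_def)
    then show ?thesis by (simp add: power2_eq_square)
  qed
  have ind: "indep_vars (\<lambda>_. borel) Y J"
    unfolding Y_def
    by (rule indep_vars_compose2[OF indep_vars_subset[OF indep J(2)]])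
       (use g in \<open>simp add: measurable_PZ_eq\<close>)
  have j1: "j \<ge> 1" if "j \<in> J" for j using that J by auto
  have sqY: "integrable M (\<lambda>\<omega>. (Y j \<omega>)\<^sup>2)" "expectation (\<lambda>\<omega>. (Y j \<omega>)\<^sup>2) = (\<integral>z. (g z - m)\<^sup>2 \<partial>PZ)" if "j \<in> J" for j
    using integral_Z[OF j1[OF that], of "\<lambda>z. (g z - m)\<^sup>2"] sqm by (simp_all add: Y_def)
  have zero: "expectation (Y j) = 0" if "j \<in> J" for j
    using integral_Z(1)[OF j1[OF that], of "\<lambda>z. g z - m"] intg
    by (simp add: Y_def[abs_def] PZ.prob_space m_def)
  note S = second_moment_indep_sum[OF J(1) ind sqY(1) zero]
  have [measurable]: "Y j \<in> borel_measurable M" if "j \<in> J" for j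
    using ind that by (simp add: indep_vars_def)
  have "{\<omega>\<in>space M. \<epsilon> \<le> \<bar>(\<Sum>j\<in>J. g (Z j \<omega>)) / N - m\<bar>} = {\<omega>\<in>space M. (N * \<epsilon>)\<^sup>2 \<le> (\<Sum>j\<in>J. Y j \<omega>)\<^sup>2}"
  proof (intro Collect_cong conj_cong refl)
    fix \<omega>
    have "(\<Sum>j\<in>J. Y j \<omega>) = N * ((\<Sum>j\<in>J. g (Z j \<omega>)) / N - m)"
      using N by (simp add: Y_def sum_subtractf N_def algebra_simps)
    then have "(N * \<epsilon>)\<^sup>2 \<le> (\<Sum>j\<in>J. Y j \<omega>)\<^sup>2 \<longleftrightarrow> \<bar>N * \<epsilon>\<bar> \<le> \<bar>N * ((\<Sum>j\<in>J. g (Z j \<omega>)) / N - m)\<bar>"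
      by (simp only: abs_le_square_iff)
    also have "\<dots> \<longleftrightarrow> \<epsilon> \<le> \<bar>(\<Sum>j\<in>J. g (Z j \<omega>)) / N - m\<bar>"
      using N \<epsilon> by (simp add: abs_mult)
    finally show "\<epsilon> \<le> \<bar>(\<Sum>j\<in>J. g (Z j \<omega>)) / N - m\<bar> \<longleftrightarrow> (N * \<epsilon>)\<^sup>2 \<le> (\<Sum>j\<in>J. Y j \<omega>)\<^sup>2" by blast
  qed
  then have "prob {\<omega>\<in>space M. \<epsilon> \<le> \<bar>(\<Sum>j\<in>J. g (Z j \<omega>)) / N - m\<bar>} \<le> expectation (\<lambda>\<omega>. (\<Sum>j\<in>J. Y j \<omega>)\<^sup>2) / (N * \<epsilon>)\<^sup>2"
    using N \<epsilon> by (simp only:) (rule integral_Markov_inequality_measure[OF S(1) sets.empty_sets], simp_all)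
  also have "expectation (\<lambda>\<omega>. (\<Sum>j\<in>J. Y j \<omega>)\<^sup>2) = N * (\<integral>z. (g z - m)\<^sup>2 \<partial>PZ)"
    by (subst S(2)) (simp_all add: sqY N_def)
  also have "N * (\<integral>z. (g z - m)\<^sup>2 \<partial>PZ) / (N * \<epsilon>)\<^sup>2 = (\<integral>z. (g z - m)\<^sup>2 \<partial>PZ) / (N * \<epsilon>\<^sup>2)"
    using N by (simp add: power2_eq_square)
  also have "\<dots> \<le> (\<integral>z. (g z)\<^sup>2 \<partial>PZ) / (N * \<epsilon>\<^sup>2)"
    using N \<epsilon> by (intro divide_right_mono var) auto
  finally show ?thesis by (simp add: N_def m_def)
qed

lemma mean_Markov:
  fixes e :: "'z \<Rightarrow> real"
  assumes J: "finite J" "J \<subseteq> {1..}" and e: "integrable PZ e" "\<And>z. 0 \<le> e z" and c: "c > 0"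
  shows "prob {\<omega>\<in>space M. c \<le> (\<Sum>j\<in>J. e (Z j \<omega>))} \<le> real (card J) * (\<integral>z. e z \<partial>PZ) / c"
proof -
  have int: "integrable M (\<lambda>\<omega>. e (Z j \<omega>))" "expectation (\<lambda>\<omega>. e (Z j \<omega>)) = (\<integral>z. e z \<partial>PZ)" if "j \<in> J" for j
    using integral_Z[of j e] e that J by auto
  have "prob {\<omega>\<in>space M. c \<le> (\<Sum>j\<in>J. e (Z j \<omega>))} \<le> expectation (\<lambda>\<omega>. \<Sum>j\<in>J. e (Z j \<omega>)) / c"
    using int e c by (intro integral_Markov_inequality_measure[OF _ sets.empty_sets]) (auto intro!: sum_nonneg)
  also have "expectation (\<lambda>\<omega>. \<Sum>j\<in>J. e (Z j \<omega>)) = real (card J) * (\<integral>z. e z \<partial>PZ)"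
    using int by (subst Bochner_Integration.integral_sum) auto
  finally show ?thesis .
qed

lemma sample_sum:
  assumes "I \<subseteq> J"
  shows "(\<Sum>j\<in>I. f ((\<lambda>j\<in>J. Z j \<omega>) j)) = (\<Sum>j\<in>I. f (Z j \<omega>))"
  using assms by (intro sum.cong) auto

text \<open>The bound on the sum of \<open>e\<close> is part of the event because it survives all
  exchanges of coordinates and is the input required for counting the sign patterns.\<close>

definition paired_event ::
  "nat \<Rightarrow> 'i set \<Rightarrow> ('i \<Rightarrow> 'z \<Rightarrow> real) \<Rightarrow> ('z \<Rightarrow> real) \<Rightarrow> real \<Rightarrow> real \<Rightarrow> (nat \<Rightarrow> 'z) set"
  where "paired_event n I f e \<kappa> c = {w\<in>space (Pi\<^sub>M {1..2*n} (\<lambda>_. PZ)).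
    (\<exists>i\<in>I. \<kappa> < \<bar>\<Sum>j=1..n. f i (w j) - f i (w (j + n))\<bar>) \<and> (\<Sum>j=1..2*n. e (w j)) \<le> c}"

lemma measurable_coordinate:
  fixes g :: "'z \<Rightarrow> real"
  assumes "g \<in> borel_measurable PZ" "j \<in> J"
  shows "(\<lambda>z. g (z j)) \<in> borel_measurable (Pi\<^sub>M J (\<lambda>_. PZ))"
  by (rule measurable_compose[OF measurable_component_singleton[OF assms(2)] assms(1)])

lemma paired_event_sets:
  fixes f :: "'i \<Rightarrow> 'z \<Rightarrow> real"
  assumes I: "countable I" and f: "\<And>i. i \<in> I \<Longrightarrow> f i \<in> borel_measurable PZ"
    and e: "e \<in> borel_measurable PZ"
  shows "paired_event n I f e \<kappa> c \<in> sets (Pi\<^sub>M {1..2*n} (\<lambda>_. PZ))" (is "_ \<in> sets ?AB")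
proof -
  have "{w\<in>space ?AB. \<kappa> < \<bar>\<Sum>j=1..n. f i (w j) - f i (w (j + n))\<bar>} \<in> sets ?AB" if "i \<in> I" for i
  proof -
    have "(\<lambda>w. \<bar>\<Sum>j=1..n. f i (w j) - f i (w (j + n))\<bar>) \<in> borel_measurable ?AB"
      using f[OF that] by (intro borel_measurable_abs borel_measurable_diff
          borel_measurable_sum measurable_coordinate) auto
    then show ?thesis by measurable
  qed
  then have "{w\<in>space ?AB. \<exists>i\<in>I. \<kappa> < \<bar>\<Sum>j=1..n. f i (w j) - f i (w (j + n))\<bar>} \<in> sets ?AB"
    using I by (rule sets.sets_Collect_countable_Ex')
  moreover have "(\<lambda>w. \<Sum>j=1..2*n. e (w j)) \<in> borel_measurable ?AB"
    by (intro borel_measurable_sum measurable_coordinate e) auto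
  then have "{w\<in>space ?AB. (\<Sum>j=1..2*n. e (w j)) \<le> c} \<in> sets ?AB"
    by measurable
  ultimately show ?thesis
    unfolding paired_event_def by (intro sets.sets_Collect_conj)
qed

text \<open>The ghost sample \<open>Z (n + 1), \<dots>, Z (2 * n)\<close> is close to the mean with probability at
  least one half, whatever the member \<open>f i\<close> violating the deviation bound.\<close>

lemma symmetrization_ghost:
  fixes f :: "'i \<Rightarrow> 'z \<Rightarrow> real" and e :: "'z \<Rightarrow> real"
  assumes n: "n \<ge> 1" and I: "countable I"
    and f[measurable]: "\<And>i. i \<in> I \<Longrightarrow> f i \<in> borel_measurable PZ"
    and e: "integrable PZ e" "\<And>z. 0 \<le> e z" and s2: "(\<integral>z. e z \<partial>PZ) = s2" "s2 > 0"
    and fe: "\<And>i z. i \<in> I \<Longrightarrow> (f i z)\<^sup>2 \<le> 2 * e z"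
    and \<epsilon>2: "\<epsilon>2 > 0" and large: "8 * s2 \<le> real n * \<epsilon>2\<^sup>2"
  shows "prob {\<omega>\<in>space M. (\<exists>i\<in>I. \<epsilon>1 < \<bar>(\<Sum>j=1..n. f i (Z j \<omega>)) / real n - (\<integral>z. f i z \<partial>PZ)\<bar>)
        \<and> (\<Sum>j=1..n. e (Z j \<omega>)) \<le> 2 * real n * s2}
    \<le> 2 * measure (Pi\<^sub>M {1..2*n} (\<lambda>_. PZ))
        (paired_event n I f e (real n * (\<epsilon>1 - \<epsilon>2)) (6 * real n * s2))"
    (is "prob ?T' \<le> 2 * measure ?AB _")
proof -
  let ?A = "Pi\<^sub>M {1..n} (\<lambda>_. PZ)" and ?B = "Pi\<^sub>M {1+n..n+n} (\<lambda>_. PZ)"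
  have [measurable]: "e \<in> borel_measurable PZ" using e by simp
  define mu where "mu i = (\<integral>z. f i z \<partial>PZ)" for i
  define T where "T = {z\<in>space ?A. (\<exists>i\<in>I. \<epsilon>1 < \<bar>(\<Sum>j=1..n. f i (z j)) / real n - mu i\<bar>)
        \<and> (\<Sum>j=1..n. e (z j)) \<le> 2 * real n * s2}"
  have T: "T \<in> sets ?A"
  proof -
    have *: "{z\<in>space ?A. \<epsilon>1 < \<bar>(\<Sum>j=1..n. f i (z j)) / real n - mu i\<bar>} \<in> sets ?A" if "i \<in> I" for i
    proof -
      have "(\<lambda>z. \<bar>(\<Sum>j=1..n. f i (z j)) / real n - mu i\<bar>) \<in> borel_measurable ?A"
        using f[OF that] by (intro borel_measurable_abs borel_measurable_diff borel_measurable_divide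
            borel_measurable_sum measurable_coordinate borel_measurable_const) auto
      then show ?thesis by measurable
    qed
    have "(\<lambda>z. \<Sum>j=1..n. e (z j)) \<in> borel_measurable ?A"
      by (intro borel_measurable_sum measurable_coordinate) auto
    then have "{z\<in>space ?A. (\<Sum>j=1..n. e (z j)) \<le> 2 * real n * s2} \<in> sets ?A"
      by measurable
    moreover have "{z\<in>space ?A. \<exists>i\<in>I. \<epsilon>1 < \<bar>(\<Sum>j=1..n. f i (z j)) / real n - mu i\<bar>} \<in> sets ?A"
      using * I by (rule sets.sets_Collect_countable_Ex')
    ultimately show ?thesis
      unfolding T_def by (intro sets.sets_Collect_conj)
  qed
  define E where "E = paired_event n I f e (real n * (\<epsilon>1 - \<epsilon>2)) (6 * real n * s2)"
  have E: "E \<in> sets ?AB"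
    unfolding E_def using I f by (rule paired_event_sets) measurable
  have un: "{1..n} \<union> {1+n..n+n} = {1..2*n}" by auto
  \<comment> \<open>The first half \<open>z\<close> is frozen. A violating index \<open>i\<close>
    can then be picked for this \<open>z\<close> alone, so no measurable selection arises, and only
    the slice of \<open>E\<close> over \<open>z\<close> has to be estimated.\<close>
  have ghost: "ennreal (1/2) \<le> emeasure ?B ((\<lambda>y. merge {1..n} {1+n..n+n} (z, y)) -` E \<inter> space ?B)" if z: "z \<in> T" for z
  proof -
    obtain i where i: "i \<in> I" "\<epsilon>1 < \<bar>(\<Sum>j=1..n. f i (z j)) / real n - mu i\<bar>"
      and ez: "(\<Sum>j=1..n. e (z j)) \<le> 2 * real n * s2" and zs: "z \<in> space ?A"
      using z by (auto simp: T_def)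
    let ?J = "{1+n..n+n}"
    have J: "finite ?J" "?J \<subseteq> {1..}" "?J \<noteq> {}" "card ?J = n" using n by auto
    have fi[measurable]: "f i \<in> borel_measurable PZ" by (rule f[OF i(1)])
    have sq: "integrable PZ (\<lambda>z. (f i z)\<^sup>2)"
      by (rule Bochner_Integration.integrable_bound[of PZ "\<lambda>z. 2 * e z"])
         (use e fe[OF i(1)] in \<open>auto intro!: AE_I2 simp: abs_of_nonneg\<close>)
    have sqle: "(\<integral>z. (f i z)\<^sup>2 \<partial>PZ) \<le> 2 * s2"
      using Bochner_Integration.integral_mono[OF sq _ fe[OF i(1)]] e s2 by simp
    have "(\<lambda>y. merge {1..n} ?J (z, y)) \<in> measurable ?B (Pi\<^sub>M ({1..n} \<union> ?J) (\<lambda>_. PZ))"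
      using zs by (intro measurable_compose[OF measurable_Pair1' measurable_merge])
    then have slice: "(\<lambda>y. merge {1..n} ?J (z, y)) -` E \<inter> space ?B \<in> sets ?B"
      by (rule measurable_sets) (simp only: un E)
    have slice_events: "{\<omega>\<in>space M. (\<lambda>j\<in>?J. Z j \<omega>) \<in> (\<lambda>y. merge {1..n} ?J (z, y)) -` E \<inter> space ?B} \<in> events"
      by (rule sample_event[OF J(2) slice])
    \<comment> \<open>Two ways to fail, each of probability at most 1/4: Chebyshev gives
      \<open>2 * s2 / (8 * s2)\<close> for \<open>G1\<close>, Markov the ratio 1 to 4 for
      \<open>G2\<close>. The budgets \<open>2 * real n * s2\<close> of \<open>T\<close> and
      \<open>4 * real n * s2\<close> outside \<open>G2\<close> add up to the 6 in
      \<open>E\<close>.\<close>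
    define G1 where "G1 = {\<omega>\<in>space M. \<epsilon>2 \<le> \<bar>(\<Sum>j\<in>?J. f i (Z j \<omega>)) / real n - mu i\<bar>}"
    define G2 where "G2 = {\<omega>\<in>space M. 4 * real n * s2 \<le> (\<Sum>j\<in>?J. e (Z j \<omega>))}"
    have fiZ: "(\<lambda>\<omega>. f i (Z j \<omega>)) \<in> borel_measurable M" "(\<lambda>\<omega>. e (Z j \<omega>)) \<in> borel_measurable M" if "j \<in> ?J" for j
    proof -
      have "1 \<le> j" using that by simp
      then show "(\<lambda>\<omega>. f i (Z j \<omega>)) \<in> borel_measurable M" "(\<lambda>\<omega>. e (Z j \<omega>)) \<in> borel_measurable M"
        by (rule measurable_Z_comp[OF _ fi], rule measurable_Z_comp[OF _ borel_measurable_integrable[OF e(1)]])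
    qed
    have "(\<lambda>\<omega>. \<bar>(\<Sum>j\<in>?J. f i (Z j \<omega>)) / real n - mu i\<bar>) \<in> borel_measurable M"
      by (intro borel_measurable_abs borel_measurable_diff borel_measurable_divide
            borel_measurable_sum fiZ borel_measurable_const)
    then have G1: "G1 \<in> events" unfolding G1_def by measurable
    have "(\<lambda>\<omega>. \<Sum>j\<in>?J. e (Z j \<omega>)) \<in> borel_measurable M"
      by (intro borel_measurable_sum fiZ)
    then have G2: "G2 \<in> events" unfolding G2_def by measurable
    have "prob G1 \<le> (\<integral>z. (f i z)\<^sup>2 \<partial>PZ) / (real n * \<epsilon>2\<^sup>2)"
      using mean_Chebyshev[OF J(1-3) fi sq \<epsilon>2] J(4) by (simp add: mu_def G1_def)
    also have "\<dots> \<le> (2 * s2) / (8 * s2)"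
      using sqle large s2 by (intro frac_le) auto
    finally have p1: "prob G1 \<le> 1/4" using s2 by simp
    have "prob G2 \<le> real n * s2 / (4 * real n * s2)"
      using mean_Markov[OF J(1,2) e, of "4 * real n * s2"] n s2 J(4) by (simp add: G2_def)
    then have p2: "prob G2 \<le> 1/4" using n s2 by simp
    have "prob (G1 \<union> G2) \<le> 1/2"
      using measure_Un_le[OF G1 G2] p1 p2 by linarith
    then have "1/2 \<le> prob (space M - (G1 \<union> G2))"
      by (simp add: prob_compl[OF sets.Un[OF G1 G2]])
    also have "\<dots> \<le> prob {\<omega>\<in>space M. (\<lambda>j\<in>?J. Z j \<omega>) \<in> (\<lambda>y. merge {1..n} ?J (z, y)) -` E \<inter> space ?B}"
    proof (rule finite_measure_mono)
      show "space M - (G1 \<union> G2) \<subseteq> {\<omega>\<in>space M. (\<lambda>j\<in>?J. Z j \<omega>) \<in> (\<lambda>y. merge {1..n} ?J (z, y)) -` E \<inter> space ?B}"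
      proof
        fix \<omega> assume "\<omega> \<in> space M - (G1 \<union> G2)"
        then have \<omega>: "\<omega> \<in> space M" and g1: "\<bar>(\<Sum>j\<in>?J. f i (Z j \<omega>)) / real n - mu i\<bar> < \<epsilon>2"
          and g2: "(\<Sum>j\<in>?J. e (Z j \<omega>)) < 4 * real n * s2" by (auto simp: G1_def G2_def)
        let ?y = "\<lambda>j\<in>?J. Z j \<omega>"
        define w where "w = merge {1..n} ?J (z, ?y)"
        have y: "?y \<in> space ?B" by (auto simp: space_PiM)
        have w1: "w j = z j" if "j \<in> {1..n}" for j using that by (simp add: w_def merge_def)
        have w2: "w j = Z j \<omega>" if "j \<in> ?J" for j using that by (simp add: w_def merge_def)
        have w: "w \<in> space ?AB"
          using zs by (auto simp: w_def space_PiM merge_def PiE_iff extensional_def)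
        have shift: "(\<Sum>j=1..n. g (w (j + n))) = (\<Sum>j\<in>?J. g (Z j \<omega>))" for g :: "'z \<Rightarrow> real"
        proof -
          have "(\<Sum>j=1..n. g (w (j + n))) = (\<Sum>j\<in>?J. g (w j))"
            by (rule sum.shift_bounds_cl_nat_ivl[symmetric])
          also have "\<dots> = (\<Sum>j\<in>?J. g (Z j \<omega>))"
            by (intro sum.cong refl arg_cong[where f=g] w2)
          finally show ?thesis .
        qed
        have "(\<Sum>j=1..n. f i (w j) - f i (w (j + n))) = (\<Sum>j=1..n. f i (z j)) - (\<Sum>j\<in>?J. f i (Z j \<omega>))"
          unfolding sum_subtractf shift
          by (intro arg_cong2[where f="(-)"] sum.cong refl arg_cong[where f="f i"] w1)
        also have "\<dots> = real n * (((\<Sum>j=1..n. f i (z j)) / real n - mu i) - ((\<Sum>j\<in>?J. f i (Z j \<omega>)) / real n - mu i))"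
          using n by (simp add: field_simps)
        finally have "\<bar>\<Sum>j=1..n. f i (w j) - f i (w (j + n))\<bar>
            = real n * \<bar>((\<Sum>j=1..n. f i (z j)) / real n - mu i) - ((\<Sum>j\<in>?J. f i (Z j \<omega>)) / real n - mu i)\<bar>"
          by (simp add: abs_mult)
        moreover have "real n * (\<epsilon>1 - \<epsilon>2) < real n * \<bar>((\<Sum>j=1..n. f i (z j)) / real n - mu i) - ((\<Sum>j\<in>?J. f i (Z j \<omega>)) / real n - mu i)\<bar>"
          using i(2) g1 n by (intro mult_strict_left_mono) linarith+
        ultimately have "real n * (\<epsilon>1 - \<epsilon>2) < \<bar>\<Sum>j=1..n. f i (w j) - f i (w (j + n))\<bar>"
          by simp
        moreover have "(\<Sum>j=1..2*n. e (w j)) \<le> 6 * real n * s2"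
        proof -
          have "(\<Sum>j=1..2*n. e (w j)) = (\<Sum>j=1..n. e (w j)) + (\<Sum>j\<in>?J. e (w j))"
            unfolding un[symmetric] by (rule sum.union_disjoint) auto
          also have "\<dots> = (\<Sum>j=1..n. e (z j)) + (\<Sum>j\<in>?J. e (Z j \<omega>))"
            by (intro arg_cong2[where f="(+)"] sum.cong refl arg_cong[where f=e] w1 w2)
          finally show ?thesis using ez g2 by linarith
        qed
        ultimately have "w \<in> E" unfolding E_def paired_event_def using w i(1) by blast
        then show "\<omega> \<in> {\<omega>\<in>space M. (\<lambda>j\<in>?J. Z j \<omega>) \<in> (\<lambda>y. merge {1..n} ?J (z, y)) -` E \<inter> space ?B}"
          using \<omega> y by (simp add: w_def)
      qed
      show "{\<omega>\<in>space M. (\<lambda>j\<in>?J. Z j \<omega>) \<in> (\<lambda>y. merge {1..n} ?J (z, y)) -` E \<inter> space ?B} \<in> events"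
        using slice_events .
    qed
    finally have "1/2 \<le> prob {\<omega>\<in>space M. (\<lambda>j\<in>?J. Z j \<omega>) \<in> (\<lambda>y. merge {1..n} ?J (z, y)) -` E \<inter> space ?B}" .
    then have "ennreal (1/2) \<le> emeasure M {\<omega>\<in>space M. (\<lambda>j\<in>?J. Z j \<omega>) \<in> (\<lambda>y. merge {1..n} ?J (z, y)) -` E \<inter> space ?B}"
      unfolding emeasure_eq_measure by (rule ennreal_leI)
    then show ?thesis
      unfolding prob_sample[OF J(2,3) slice] .
  qed
  have J1: "{1..n} \<subseteq> {1..}" "{1..n} \<noteq> {}" using n by auto
  have "ennreal (prob ?T') = emeasure M {\<omega>\<in>space M. (\<lambda>j\<in>{1..n}. Z j \<omega>) \<in> T}"
  proof -
    have "?T' = {\<omega>\<in>space M. (\<lambda>j\<in>{1..n}. Z j \<omega>) \<in> T}"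
      unfolding T_def mu_def by (auto simp: space_PiM sample_sum)
    then show ?thesis by (simp add: emeasure_eq_measure)
  qed
  also have "\<dots> = emeasure ?A T"
    by (rule prob_sample[OF J1 T, symmetric])
  finally have T': "ennreal (prob ?T') = emeasure ?A T" .
  have "ennreal (1/2) * emeasure ?A T = (\<integral>\<^sup>+z. ennreal (1/2) * indicator T z \<partial>?A)"
    using T by (simp add: nn_integral_cmult_indicator)
  also have "\<dots> \<le> (\<integral>\<^sup>+z. emeasure ?B ((\<lambda>y. merge {1..n} {1+n..n+n} (z, y)) -` E \<inter> space ?B) \<partial>?A)"
  proof (rule nn_integral_mono)
    fix z assume "z \<in> space ?A"
    show "ennreal (1/2) * indicator T z \<le> emeasure ?B ((\<lambda>y. merge {1..n} {1+n..n+n} (z, y)) -` E \<inter> space ?B)"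
    proof (cases "z \<in> T")
      case True
      then show ?thesis using ghost[OF True] by (simp only: indicator_eq_1_iff[THEN iffD2] mult_1_right)
    next
      case False
      then have "indicator T z = (0::ennreal)" by (rule indicator_simps(2))
      then show ?thesis by (simp only: mult_zero_right zero_le)
    qed
  qed
  \<comment> \<open>Fubini glues the slices: the law of the double sample is the product of the laws
    of its halves.\<close>
  also have "\<dots> = emeasure (Pi\<^sub>M ({1..n} \<union> {1+n..n+n}) (\<lambda>_. PZ)) E"
    by (rule PP.emeasure_fold_integral[symmetric]) (simp_all only: un E, auto)
  also have "\<dots> = emeasure ?AB E" by (simp only: un)
  also have "\<dots> = ennreal (measure ?AB E)"
    by (rule PP.emeasure_eq_measure)
  finally have "ennreal (1/2 * prob ?T') \<le> ennreal (measure ?AB E)"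
    unfolding T'[symmetric] by (subst ennreal_mult') auto
  then have "1/2 * prob ?T' \<le> measure ?AB E"
    by (subst (asm) ennreal_le_iff) auto
  then show ?thesis unfolding E_def by linarith
qed

text \<open>Exchanging \<open>w j\<close> and \<open>w (j + n)\<close> for all \<open>j\<close> in a set \<open>s\<close> leaves the law of the double
  sample invariant; averaging over all \<open>s\<close> reduces the bound to counting sign patterns.\<close>

lemma symmetrization_swap:
  fixes f :: "'i \<Rightarrow> 'z \<Rightarrow> real" and e :: "'z \<Rightarrow> real"
  assumes I: "countable I"
    and f: "\<And>i. i \<in> I \<Longrightarrow> f i \<in> borel_measurable PZ" and e: "e \<in> borel_measurable PZ"
    and b: "b \<ge> 0"
    and count: "\<And>w. (\<Sum>j=1..2*n. e (w j)) \<le> c \<Longrightarrow>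
      real (card {s\<in>Pow {1..n}. \<exists>i\<in>I. \<kappa> < \<bar>\<Sum>j=1..n. sgs s j * (f i (w j) - f i (w (j + n)))\<bar>}) \<le> 2 ^ n * b"
  shows "measure (Pi\<^sub>M {1..2*n} (\<lambda>_. PZ)) (paired_event n I f e \<kappa> c) \<le> b"
proof -
  let ?AB = "Pi\<^sub>M {1..2*n} (\<lambda>_. PZ)"
  define E where "E = paired_event n I f e \<kappa> c"
  have E: "E \<in> sets ?AB"
    unfolding E_def using I f e by (rule paired_event_sets)
  \<comment> \<open>An involution exchanging \<open>j\<close> and \<open>j + n\<close> for
    \<open>j\<close> in \<open>s\<close>; the test \<open>n < k\<close> guards the truncated
    subtraction \<open>k - n\<close>.\<close>
  define \<pi> where "\<pi> s k = (if k \<in> s then k + n else if n < k \<and> k - n \<in> s then k - n else k)" for s k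
  define R where "R s w = (\<lambda>k\<in>{1..2*n}. w (\<pi> s k))" for s and w :: "nat \<Rightarrow> 'z"
  define Es where "Es s = R s -` E \<inter> space ?AB" for s
  have \<pi>: "\<pi> s k \<in> {1..2*n}" "\<pi> s (\<pi> s k) = k" if "s \<in> Pow {1..n}" "k \<in> {1..2*n}" for s k
    using that by (auto simp: \<pi>_def)
  have bij: "bij_betw (\<pi> s) {1..2*n} {1..2*n}" if "s \<in> Pow {1..n}" for s
    by (rule bij_betw_byWitness[where f' = "\<pi> s"]) (use \<pi>[OF that] in auto)
  have R: "distr ?AB ?AB (R s) = ?AB" "R s \<in> measurable ?AB ?AB" if s: "s \<in> Pow {1..n}" for s
  proof -
    show "distr ?AB ?AB (R s) = ?AB"
      unfolding R_def using \<pi>(1)[OF s] bij[OF s]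
      by (intro distr_PiM_reindex[where M = "\<lambda>_. PZ"]) (auto simp: bij_betw_def PZ.prob_space_axioms)
    show "R s \<in> measurable ?AB ?AB"
      unfolding R_def using \<pi>(1)[OF s] by (intro measurable_restrict measurable_component_singleton)
  qed
  have Es: "Es s \<in> sets ?AB" "measure ?AB (Es s) = measure ?AB E" if s: "s \<in> Pow {1..n}" for s
  proof -
    show "Es s \<in> sets ?AB"
      unfolding Es_def by (rule measurable_sets[OF R(2)[OF s] E])
    have "measure ?AB E = measure (distr ?AB ?AB (R s)) E"
      by (simp only: R(1)[OF s])
    also have "\<dots> = measure ?AB (Es s)"
      unfolding Es_def by (rule measure_distr[OF R(2)[OF s] E])
    finally show "measure ?AB (Es s) = measure ?AB E" ..
  qed
  have count': "(\<Sum>s\<in>Pow {1..n}. indicator (Es s) w) \<le> 2 ^ n * b" if w: "w \<in> space ?AB" for w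
  proof (cases "(\<Sum>j=1..2*n. e (w j)) \<le> c")
    case True
    have "s \<in> {s\<in>Pow {1..n}. \<exists>i\<in>I. \<kappa> < \<bar>\<Sum>j=1..n. sgs s j * (f i (w j) - f i (w (j + n)))\<bar>}"
      if s: "s \<in> Pow {1..n}" and ws: "w \<in> Es s" for s
    proof -
      have "R s w \<in> E" using ws by (simp add: Es_def)
      then obtain i where i: "i \<in> I" "\<kappa> < \<bar>\<Sum>j=1..n. f i (R s w j) - f i (R s w (j + n))\<bar>"
        by (auto simp: E_def paired_event_def)
      \<comment> \<open>Exchanged pairs change sign and carry \<open>sgs s j = 1\<close>, the others
        keep theirs and carry \<open>- 1\<close>. So the exchanged sum is the signed sum up to one
        global sign, which the absolute value removes.\<close>
      have "(\<Sum>j=1..n. f i (R s w j) - f i (R s w (j + n))) = (\<Sum>j=1..n. - (sgs s j * (f i (w j) - f i (w (j + n)))))"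
        using s by (intro sum.cong refl) (auto simp: R_def \<pi>_def sgs_def)
      then have "\<bar>\<Sum>j=1..n. f i (R s w j) - f i (R s w (j + n))\<bar> = \<bar>\<Sum>j=1..n. sgs s j * (f i (w j) - f i (w (j + n)))\<bar>"
        by (simp only: sum_negf abs_minus_cancel)
      with i s show ?thesis by auto
    qed
    then have "(\<Sum>s\<in>Pow {1..n}. indicator (Es s) w)
        \<le> (\<Sum>s\<in>Pow {1..n}. indicator {s\<in>Pow {1..n}. \<exists>i\<in>I. \<kappa> < \<bar>\<Sum>j=1..n. sgs s j * (f i (w j) - f i (w (j + n)))\<bar>} s :: real)"
      by (intro sum_mono) (auto simp: indicator_def)
    also have "\<dots> = real (card {s\<in>Pow {1..n}. \<exists>i\<in>I. \<kappa> < \<bar>\<Sum>j=1..n. sgs s j * (f i (w j) - f i (w (j + n)))\<bar>})"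
      by (simp add: indicator_def of_bool_def sum.If_cases Int_def)
    also have "\<dots> \<le> 2 ^ n * b"
      by (rule count[OF True])
    finally show ?thesis .
  next
    case False
    have "w \<notin> Es s" if s: "s \<in> Pow {1..n}" for s
    proof
      assume "w \<in> Es s"
      then have "R s w \<in> E" by (simp add: Es_def)
      then have "(\<Sum>j=1..2*n. e (R s w j)) \<le> c" by (simp add: E_def paired_event_def)
      also have "(\<Sum>j=1..2*n. e (R s w j)) = (\<Sum>j=1..2*n. e (w (\<pi> s j)))"
        by (intro sum.cong refl) (simp add: R_def)
      also have "\<dots> = (\<Sum>j=1..2*n. e (w j))"
        by (rule sum.reindex_bij_betw[OF bij[OF s]])
      finally show False using False by simp
    qed
    then have "(\<Sum>s\<in>Pow {1..n}. indicator (Es s) w) = (0::real)"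
      by (intro sum.neutral) (auto simp: indicator_def)
    then show ?thesis using b by simp
  qed
  have int: "integrable ?AB (indicator (Es s) :: _ \<Rightarrow> real)" if "s \<in> Pow {1..n}" for s
    using Es(1)[OF that] by (simp add: PP.emeasure_eq_measure)
  have "2 ^ n * measure ?AB E = (\<Sum>s\<in>Pow {1..n}. measure ?AB (Es s))"
    using Es(2) by (simp add: card_Pow)
  also have "\<dots> = (\<Sum>s\<in>Pow {1..n}. \<integral>w. indicator (Es s) w \<partial>?AB)"
    using Es(1) by (intro sum.cong refl) simp
  also have "\<dots> = (\<integral>w. (\<Sum>s\<in>Pow {1..n}. indicator (Es s) w) \<partial>?AB)"
    by (rule Bochner_Integration.integral_sum[symmetric]) (rule int)
  also have "\<dots> \<le> (\<integral>w. 2 ^ n * b \<partial>?AB)"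
    by (intro Bochner_Integration.integral_mono Bochner_Integration.integrable_sum int count') auto
  also have "\<dots> = 2 ^ n * b"
    by (simp only: lebesgue_integral_const prob_space.prob_space[OF prob_space_PiM[OF PZ.prob_space_axioms]]
        real_scaleR_def mult_1_left)
  finally show ?thesis
    unfolding E_def[symmetric] by simp
qed

end

section \<open>Weak law of large numbers and tightness\<close>

text \<open>Only a first moment is available, also when \<open>g\<close> is the square of
  \<open>xi_map\<close>. So Chebyshev is applied to the truncation \<open>min (g z) (real K)\<close>
  and Markov to the remainder.\<close>

lemma (in iid_sample) weak_law_upper:
  fixes g :: "'z \<Rightarrow> real"
  assumes g: "integrable PZ g" and g0: "\<And>z. 0 \<le> g z" and d: "d > 0"
  shows "(\<lambda>n. prob {\<omega>\<in>space M. (\<integral>z. g z \<partial>PZ) + d < (\<Sum>j=1..n. g (Z j \<omega>)) / real n}) \<longlonglongrightarrow> 0"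
proof -
  have mg[measurable]: "g \<in> borel_measurable PZ" using g by simp
  have lim: "(\<lambda>K. \<integral>z. min (g z) (real K) \<partial>PZ) \<longlonglongrightarrow> (\<integral>z. g z \<partial>PZ)"
  proof (rule integral_dominated_convergence[where w = g])
    show "AE z in PZ. (\<lambda>K. min (g z) (real K)) \<longlonglongrightarrow> g z"
    proof (rule AE_I2)
      fix z
      have "\<forall>\<^sub>F K in sequentially. g z \<le> real K"
        using filterlim_real_sequentially by (simp add: filterlim_at_top)
      then have "\<forall>\<^sub>F K in sequentially. min (g z) (real K) = g z"
        by eventually_elim simp
      then show "(\<lambda>K. min (g z) (real K)) \<longlonglongrightarrow> g z"
        by (rule tendsto_eventually)
    qed
    show "AE z in PZ. norm (min (g z) (real K)) \<le> g z" for K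
      using g0 by (intro AE_I2) (simp add: min_def)
  qed (use g in auto)
  have bound: "\<forall>\<^sub>F n in sequentially. prob {\<omega>\<in>space M. (\<integral>z. g z \<partial>PZ) + d < (\<Sum>j=1..n. g (Z j \<omega>)) / real n} < e"
    if e: "e > 0" for e
  proof -
    \<comment> \<open>A remainder of mean below \<open>d * e / 4\<close> costs at most
      \<open>e / 2\<close> in Markov's inequality at threshold \<open>d / 2\<close>.\<close>
    have "\<forall>\<^sub>F K in sequentially. (\<integral>z. g z \<partial>PZ) - d * e / 4 < (\<integral>z. min (g z) (real K) \<partial>PZ)"
      using d e by (intro order_tendstoD(1)[OF lim]) simp
    then obtain K where K: "(\<integral>z. g z \<partial>PZ) - d * e / 4 < (\<integral>z. min (g z) (real K) \<partial>PZ)"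
      by (auto simp: eventually_sequentially)
    define h where "h z = min (g z) (real K)" for z
    define r where "r z = g z - h z" for z
    have mh[measurable]: "h \<in> borel_measurable PZ" unfolding h_def by measurable
    have h: "0 \<le> h z" "h z \<le> real K" "h z \<le> g z" for z using g0[of z] by (auto simp: h_def)
    have ih: "integrable PZ h"
      using h by (intro PZ.integrable_const_bound[where B = "real K"]) auto
    have ih2: "integrable PZ (\<lambda>z. (h z)\<^sup>2)"
      using h by (intro PZ.integrable_const_bound[where B = "(real K)\<^sup>2"]) (auto intro!: power_mono)
    have Eh2: "(\<integral>z. (h z)\<^sup>2 \<partial>PZ) \<le> (real K)\<^sup>2"
      using ih2 h by (intro PZ.integral_le_const) (auto intro!: power_mono)
    have ir: "integrable PZ r" and r0: "0 \<le> r z" for z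
      using g ih h by (auto simp: r_def[abs_def])
    have Er: "(\<integral>z. r z \<partial>PZ) < d * e / 4"
      unfolding r_def using K g ih by (simp add: h_def[symmetric])
    have le: "(\<integral>z. h z \<partial>PZ) \<le> (\<integral>z. g z \<partial>PZ)"
      using ih g h by (intro Bochner_Integration.integral_mono) auto
    have "(\<lambda>n. 4 * (real K)\<^sup>2 / d\<^sup>2 * (1 / real n)) \<longlonglongrightarrow> 4 * (real K)\<^sup>2 / d\<^sup>2 * 0"
      by (intro tendsto_mult tendsto_const lim_1_over_n)
    then have "\<forall>\<^sub>F n in sequentially. 4 * (real K)\<^sup>2 / d\<^sup>2 * (1 / real n) < e / 2"
      using e by (intro order_tendstoD(2)) auto
    then show ?thesis
      using eventually_ge_at_top[of 1]
    proof eventually_elim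
      case (elim n)
      then have n: "n \<ge> 1" and small: "4 * (real K)\<^sup>2 / d\<^sup>2 * (1 / real n) < e / 2" by auto
      have J: "finite {1..n}" "{1..n} \<subseteq> {1..}" "{1..n} \<noteq> {}" "card {1..n} = n" using n by auto
      define A where "A = {\<omega>\<in>space M. d / 2 \<le> \<bar>(\<Sum>j=1..n. h (Z j \<omega>)) / real n - (\<integral>z. h z \<partial>PZ)\<bar>}"
      define B where "B = {\<omega>\<in>space M. real n * (d / 2) \<le> (\<Sum>j=1..n. r (Z j \<omega>))}"
      have mr[measurable]: "r \<in> borel_measurable PZ" unfolding r_def by measurable
      have mZ: "(\<lambda>\<omega>. h (Z j \<omega>)) \<in> borel_measurable M" "(\<lambda>\<omega>. r (Z j \<omega>)) \<in> borel_measurable M"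
        if "j \<in> {1..n}" for j
      proof -
        have "1 \<le> j" using that by simp
        then show "(\<lambda>\<omega>. h (Z j \<omega>)) \<in> borel_measurable M" "(\<lambda>\<omega>. r (Z j \<omega>)) \<in> borel_measurable M"
          by (rule measurable_Z_comp[OF _ mh], rule measurable_Z_comp[OF _ mr])
      qed
      have "(\<lambda>\<omega>. \<bar>(\<Sum>j=1..n. h (Z j \<omega>)) / real n - (\<integral>z. h z \<partial>PZ)\<bar>) \<in> borel_measurable M"
        by (intro borel_measurable_abs borel_measurable_diff borel_measurable_divide
            borel_measurable_sum mZ borel_measurable_const)
      then have A: "A \<in> events" unfolding A_def by measurable
      have "(\<lambda>\<omega>. \<Sum>j=1..n. r (Z j \<omega>)) \<in> borel_measurable M"
        by (intro borel_measurable_sum mZ)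
      then have B: "B \<in> events" unfolding B_def by measurable
      have "prob A \<le> (\<integral>z. (h z)\<^sup>2 \<partial>PZ) / (real n * (d / 2)\<^sup>2)"
        using mean_Chebyshev[OF J(1-3) mh ih2, of "d / 2"] d J(4) by (simp add: A_def)
      also have "\<dots> \<le> (real K)\<^sup>2 / (real n * (d / 2)\<^sup>2)"
        using Eh2 by (intro divide_right_mono) auto
      also have "\<dots> = 4 * (real K)\<^sup>2 / d\<^sup>2 * (1 / real n)"
        by (simp add: power_divide mult.commute)
      finally have pA: "prob A < e / 2" using small by linarith
      have "prob B \<le> real n * (\<integral>z. r z \<partial>PZ) / (real n * (d / 2))"
        using mean_Markov[OF J(1,2) ir r0, of "real n * (d / 2)"] d n J(4) by (simp add: B_def)
      also have "\<dots> = (\<integral>z. r z \<partial>PZ) / (d / 2)"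
        using n by simp
      also have "\<dots> \<le> (d * e / 4) / (d / 2)"
        using Er d by (intro divide_right_mono) auto
      also have "\<dots> = e / 2"
        using d by simp
      finally have pB: "prob B \<le> e / 2" .
      have "prob {\<omega>\<in>space M. (\<integral>z. g z \<partial>PZ) + d < (\<Sum>j=1..n. g (Z j \<omega>)) / real n} \<le> prob (A \<union> B)"
      proof (rule finite_measure_mono)
        show "A \<union> B \<in> events" using A B by blast
        show "{\<omega>\<in>space M. (\<integral>z. g z \<partial>PZ) + d < (\<Sum>j=1..n. g (Z j \<omega>)) / real n} \<subseteq> A \<union> B"
        proof
          fix \<omega> assume "\<omega> \<in> {\<omega>\<in>space M. (\<integral>z. g z \<partial>PZ) + d < (\<Sum>j=1..n. g (Z j \<omega>)) / real n}"
          then have \<omega>: "\<omega> \<in> space M" and big: "(\<integral>z. g z \<partial>PZ) + d < (\<Sum>j=1..n. g (Z j \<omega>)) / real n" by auto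
          have "(\<Sum>j=1..n. g (Z j \<omega>)) / real n = (\<Sum>j=1..n. h (Z j \<omega>)) / real n + (\<Sum>j=1..n. r (Z j \<omega>)) / real n"
            by (simp add: r_def sum_subtractf add_divide_distrib[symmetric])
          then have "d / 2 \<le> \<bar>(\<Sum>j=1..n. h (Z j \<omega>)) / real n - (\<integral>z. h z \<partial>PZ)\<bar> \<or> d / 2 \<le> (\<Sum>j=1..n. r (Z j \<omega>)) / real n"
            using big le by linarith
          then show "\<omega> \<in> A \<union> B"
            using \<omega> n by (auto simp: A_def B_def field_simps)
        qed
      qed
      also have "\<dots> \<le> prob A + prob B" by (rule measure_Un_le[OF A B])
      also have "\<dots> < e" using pA pB by linarith
      finally show ?case .
    qed
  qed
  show ?thesis
  proof (rule order_tendstoI)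
    fix a :: real assume "a < 0"
    then show "\<forall>\<^sub>F n in sequentially. a < prob {\<omega>\<in>space M. (\<integral>z. g z \<partial>PZ) + d < (\<Sum>j=1..n. g (Z j \<omega>)) / real n}"
      by (intro always_eventually allI less_le_trans[OF _ measure_nonneg])
  qed (rule bound)
qed

text \<open>Lets the optimal value over the uncountable \<open>\<Theta>\<close> inherit
  measurability from a countable infimum.\<close>

lemma (in complete_measure) measurable_off_null:
  assumes g: "g \<in> measurable M L" and N: "N \<in> null_sets M"
    and eq: "\<And>x. x \<in> space M - N \<Longrightarrow> f x = g x" and f: "f \<in> space M \<rightarrow> space L"
  shows "f \<in> measurable M L"
proof (rule measurableI)
  fix A assume A: "A \<in> sets L"
  have "f -` A \<inter> space M = ((g -` A \<inter> space M) - N) \<union> (f -` A \<inter> space M \<inter> N)"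
    using eq by auto
  moreover have "f -` A \<inter> space M \<inter> N \<in> sets M"
    by (rule complete[OF _ N]) auto
  moreover have "(g -` A \<inter> space M) - N \<in> sets M"
    using measurable_sets[OF g A] null_setsD2[OF N] by auto
  ultimately show "f -` A \<inter> space M \<in> sets M" by (metis sets.Un)
qed (use f in auto)

lemma (in prob_space) tail_prob_small:
  fixes X :: "'a \<Rightarrow> real"
  assumes [measurable]: "X \<in> borel_measurable M" and e: "e > 0"
  shows "\<exists>c. prob {\<omega>\<in>space M. c \<le> \<bar>X \<omega>\<bar>} < e"
proof -
  define A where "A k = {\<omega>\<in>space M. real k \<le> \<bar>X \<omega>\<bar>}" for k :: nat
  have "range A \<subseteq> events" unfolding A_def by auto
  moreover have "decseq A"
    by (auto simp: decseq_def A_def)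
  ultimately have "(\<lambda>k. prob (A k)) \<longlonglongrightarrow> prob (\<Inter>k. A k)"
    by (rule finite_Lim_measure_decseq)
  moreover have "(\<Inter>k. A k) = {}"
  proof (rule equals0I)
    fix \<omega> assume "\<omega> \<in> (\<Inter>k. A k)"
    then have "real k \<le> \<bar>X \<omega>\<bar>" for k by (auto simp: A_def)
    then show False using reals_Archimedean2[of "\<bar>X \<omega>\<bar>"] not_less by blast
  qed
  ultimately have "(\<lambda>k. prob (A k)) \<longlonglongrightarrow> 0" by simp
  then have "\<forall>\<^sub>F k in sequentially. prob (A k) < e"
    using e by (rule order_tendstoD(2))
  then show ?thesis
    unfolding A_def eventually_sequentially by blast
qed

text \<open>Uniform tails are required only eventually: the finitely many remaining variables are
  each tight by themselves, and one maximum of constants serves all.\<close>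

lemma (in prob_space) tight_distr:
  fixes X :: "nat \<Rightarrow> 'a \<Rightarrow> real"
  assumes X: "\<And>n. X n \<in> borel_measurable M"
    and ev: "\<And>e. e > 0 \<Longrightarrow> \<exists>c. \<forall>\<^sub>F n in sequentially. prob {\<omega>\<in>space M. c \<le> \<bar>X n \<omega>\<bar>} < e"
  shows "tight (\<lambda>n. distr M borel (X n))"
  unfolding tight_def
proof (intro conjI allI impI)
  show "real_distribution (distr M borel (X n))" for n
    using X by (rule real_distribution_distr)
  fix e :: real assume e: "e > 0"
  obtain c0 n0 where c0: "\<And>n. n \<ge> n0 \<Longrightarrow> prob {\<omega>\<in>space M. c0 \<le> \<bar>X n \<omega>\<bar>} < e"
    using ev[OF e] by (auto simp: eventually_sequentially)
  have "\<forall>n. \<exists>c. prob {\<omega>\<in>space M. c \<le> \<bar>X n \<omega>\<bar>} < e"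
    using tail_prob_small[OF X e] by blast
  then obtain c where c: "\<And>n. prob {\<omega>\<in>space M. c n \<le> \<bar>X n \<omega>\<bar>} < e"
    unfolding choice_iff by blast
  define C where "C = Max (insert 1 (insert c0 (c ` {..<n0})))"
  have C: "1 \<le> C" "c0 \<le> C" "\<And>n. n < n0 \<Longrightarrow> c n \<le> C"
    unfolding C_def by (rule Max_ge; simp)+
  have mono: "prob {\<omega>\<in>space M. C \<le> \<bar>X n \<omega>\<bar>} \<le> prob {\<omega>\<in>space M. a \<le> \<bar>X n \<omega>\<bar>}" if "a \<le> C" for a n
    using X[of n] that by (intro finite_measure_mono) auto
  have small: "prob {\<omega>\<in>space M. C \<le> \<bar>X n \<omega>\<bar>} < e" for n
  proof (cases "n < n0")
    case True
    show ?thesis using mono[OF C(3)[OF True], of n] c[of n] by linarith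
  next
    case False
    then show ?thesis using mono[OF C(2), of n] c0[of n] by linarith
  qed
  show "\<exists>a b. a < b \<and> (\<forall>n. measure (distr M borel (X n)) {a<..b} > 1 - e)"
  proof (intro exI conjI allI)
    show "- C < C" using C(1) by simp
    fix n
    have mX[measurable]: "X n \<in> borel_measurable M" by (rule X)
    have "1 - e < 1 - prob {\<omega>\<in>space M. C \<le> \<bar>X n \<omega>\<bar>}"
      using small[of n] by simp
    also have "\<dots> = prob (space M - {\<omega>\<in>space M. C \<le> \<bar>X n \<omega>\<bar>})"
      by (rule prob_compl[symmetric]) measurable
    also have "\<dots> \<le> prob (X n -` {- C<..C} \<inter> space M)"
      by (intro finite_measure_mono) auto
    also have "\<dots> = measure (distr M borel (X n)) {- C<..C}"
      by (rule measure_distr[symmetric]) auto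
    finally show "1 - e < measure (distr M borel (X n)) {- C<..C}" .
  qed
qed

section \<open>Sample average approximation\<close>

locale saa_problem = divergence_prob \<Phi> M + iid_sample M Z PZ
  for \<Phi> :: "real \<Rightarrow> ennreal" and M :: "'a measure" and Z :: "nat \<Rightarrow> 'a \<Rightarrow> 'z::t1_space" and PZ +
  fixes \<Theta> :: "'t set" and G :: "'t \<Rightarrow> 'z \<Rightarrow> real" and \<xi> :: "'z \<Rightarrow> real" and x0 \<delta> :: real
  assumes nonempty: "\<Theta> \<noteq> {}" and complete_M: "complete_measure M" and atomless_M: "atomless M"
    and G_measurable: "\<And>\<theta>. \<theta> \<in> \<Theta> \<Longrightarrow> G \<theta> \<in> borel_measurable borel"
    and envelope: "positive_envelope (G ` \<Theta>) \<xi>"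
    and envelope_heart: "(\<lambda>\<omega>. \<xi> (Z 1 \<omega>)) \<in> orlicz_heart M \<Phi>"
    and separable: "\<exists>\<Theta>' (N :: nat \<Rightarrow> (nat \<Rightarrow> 'z) set). \<Theta>' \<subseteq> \<Theta> \<and> countable \<Theta>' \<and> \<Theta>' \<noteq> {} \<and>
        (\<forall>n\<ge>1. N n \<in> null_sets (Pi\<^sub>M {1..n} (\<lambda>_. PZ))) \<and>
        (\<forall>n\<ge>1. \<forall>\<theta>\<in>\<Theta>. \<forall>z \<in> space (Pi\<^sub>M {1..n} (\<lambda>_. PZ)) - N n.
           (INF \<eta>\<in>\<Theta>'. \<integral>\<omega>. \<bar>G \<eta> (Z 1 \<omega>) - G \<theta> (Z 1 \<omega>)\<bar> \<partial>M) = 0 \<and>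
           (INF \<eta>\<in>\<Theta>'. MAX j\<in>{1..n}. \<bar>G \<theta> (z j) - G \<eta> (z j)\<bar>) = 0)"
    and x0: "1 < x0" "x0 < 2" "\<Phi> x0 < \<infinity>" and \<delta>: "\<delta> > 0"
    and xi_map_measurable: "xi_map \<Phi> PZ x0 \<xi> \<delta> \<in> borel_measurable PZ"
    and xi_map_integrable: "integrable PZ (\<lambda>z. (xi_map \<Phi> PZ x0 \<xi> \<delta> z)\<^sup>2)"
    and entropy_fin: "entropy_integral (G ` \<Theta>) \<xi> (1/4) < \<infinity>"
begin

abbreviation XI :: "'z \<Rightarrow> real" where "XI \<equiv> xi_map \<Phi> PZ x0 \<xi> \<delta>"
abbreviation U :: real where "U \<equiv> x_upper \<Phi> PZ x0 \<xi> \<delta>"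
abbreviation \<sigma> :: real where "\<sigma> \<equiv> l2_norm PZ XI"

definition loss :: "('z \<Rightarrow> real) \<Rightarrow> real \<Rightarrow> 'z \<Rightarrow> real"
  where "loss h x z = fs (h z + x) - x"

text \<open>The right derivative is taken at the largest argument \<open>\<xi> z + U\<close> that
  can occur, so by monotonicity it bounds all relevant slopes of \<open>fs\<close>; the summand 1
  accounts for the linear term \<open>- x\<close> of the loss.\<close>

definition slope :: "'z \<Rightarrow> real"
  where "slope z = right_deriv fs (\<xi> z + U) + 1"

section \<open>Integrability and Lipschitz structure of the losses\<close>

lemma xi_measurable: "\<xi> \<in> borel_measurable borel" "\<xi> \<in> borel_measurable PZ"
  and xi_pos: "0 < \<xi> z"
  and G_le_xi: "\<theta> \<in> \<Theta> \<Longrightarrow> \<bar>G \<theta> z\<bar> \<le> \<xi> z"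
  using envelope by (auto simp: positive_envelope_def measurable_PZ_eq)

lemma G_measurable_PZ: "\<theta> \<in> \<Theta> \<Longrightarrow> G \<theta> \<in> borel_measurable PZ"
  using G_measurable by (simp add: measurable_PZ_eq)

lemma G_heart: "\<theta> \<in> \<Theta> \<Longrightarrow> (\<lambda>\<omega>. G \<theta> (Z 1 \<omega>)) \<in> orlicz_heart M \<Phi>"
  by (rule heart_dominated[OF envelope_heart])
     (auto intro!: measurable_Z_comp[OF _ G_measurable_PZ] order_trans[OF G_le_xi abs_ge_self])

lemma integral_Z1:
  fixes f :: "'z \<Rightarrow> real"
  assumes "f \<in> borel_measurable PZ"
  shows "(\<integral>\<omega>. f (Z 1 \<omega>) \<partial>M) = (\<integral>z. f z \<partial>PZ)"
    and "integrable M (\<lambda>\<omega>. f (Z 1 \<omega>)) \<Longrightarrow> integrable PZ f"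
  using integral_Z[of 1 f] assms by auto

lemma xi_integrable: "integrable PZ \<xi>"
  using heart_integrable[OF envelope_heart] by (rule integral_Z1(2)[OF xi_measurable(2)])

lemma fs_xi_integrable: "integrable PZ (\<lambda>z. fs (\<xi> z + x))"
  using heart_integrable_fs_add[OF envelope_heart, of x]
  by (rule integral_Z1(2)[rotated]) (use xi_measurable(2) in measurable)

lemma fs_xi_integrable0: "integrable PZ (\<lambda>z. fs (\<xi> z))"
  using fs_xi_integrable[of 0] by simp

lemma fs_G_integrable: "\<theta> \<in> \<Theta> \<Longrightarrow> integrable PZ (\<lambda>z. fs (G \<theta> z + x))"
  using heart_integrable_fs_add[OF G_heart, of \<theta> x]
  by (rule integral_Z1(2)[rotated]) (use G_measurable_PZ[of \<theta>] in measurable)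

lemma G_integrable: "\<theta> \<in> \<Theta> \<Longrightarrow> integrable PZ (G \<theta>)"
  by (rule integral_Z1(2)[OF G_measurable_PZ heart_integrable[OF G_heart]])

abbreviation E\<xi> :: real where "E\<xi> \<equiv> \<integral>z. \<xi> z \<partial>PZ"
abbreviation Efs :: real where "Efs \<equiv> \<integral>z. fs (\<xi> z) \<partial>PZ"

lemma E_nonneg: "0 \<le> E\<xi>" "0 \<le> Efs"
  by (intro Bochner_Integration.integral_nonneg fs_nonneg less_imp_le[OF xi_pos])+

lemma U_eq: "(x0 - 1) * U = \<psi> x0 + (1 + x0) * \<delta> + Efs + x0 * E\<xi> + (x0 - 1) * \<psi> 0"
proof -
  have "U = (\<psi> x0 + (1 + x0) * \<delta> + Efs + x0 * E\<xi>) / (x0 - 1) + \<psi> 0"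
    by (simp add: x_upper_def \<psi>_def)
  then have "(x0 - 1) * U = (x0 - 1) * ((\<psi> x0 + (1 + x0) * \<delta> + Efs + x0 * E\<xi>) / (x0 - 1)) + (x0 - 1) * \<psi> 0"
    by (simp only: distrib_left)
  then show ?thesis
    using x0 by simp
qed

text \<open>\<open>x0 < 2\<close> enters here: the factor \<open>x0 - 1\<close> in
  \<open>U_eq\<close> is at most 1, so dropping it only enlarges the right side. The bound serves
  shifts below \<open>- U\<close>.\<close>

lemma U_ge: "\<psi> 0 + \<delta> + Efs \<le> U"
proof -
  have "0 \<le> x0 * E\<xi>" "\<delta> \<le> (1 + x0) * \<delta>" "0 \<le> \<psi> x0"
    using x0 \<delta> E_nonneg psi_nonneg by auto
  then have ge: "\<delta> + Efs \<le> (x0 - 1) * (U - \<psi> 0)"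
    using U_eq by (simp add: right_diff_distrib)
  have "0 \<le> U - \<psi> 0"
  proof (rule ccontr)
    assume "\<not> 0 \<le> U - \<psi> 0"
    then have "(x0 - 1) * (U - \<psi> 0) \<le> 0"
      using x0 by (intro mult_nonneg_nonpos) auto
    then show False using ge \<delta> E_nonneg(2) by linarith
  qed
  then have "(x0 - 1) * (U - \<psi> 0) \<le> 1 * (U - \<psi> 0)"
    using x0 by (intro mult_right_mono) auto
  with ge show ?thesis by simp
qed

lemma U_pos: "0 < U"
  using U_ge \<delta> E_nonneg(2) psi_nonneg[of 0] by linarith

lemma slope_ge_1: "1 \<le> slope z"
  using right_deriv_nonneg by (simp add: slope_def)

text \<open>Formulated pointwise in \<open>z\<close> rather than for members of the class, so that
  the zero function at shift 0, whose loss vanishes by \<open>fs_0\<close>, can be used as reference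
  for the envelope bound.\<close>

lemma loss_lipschitz_gen:
  assumes "\<bar>h z\<bar> \<le> \<xi> z" "\<bar>h' z\<bar> \<le> \<xi> z" "\<bar>x\<bar> \<le> U" "\<bar>x'\<bar> \<le> U"
  shows "\<bar>loss h x z - loss h' x' z\<bar> \<le> slope z * (\<bar>h z - h' z\<bar> + \<bar>x - x'\<bar>)"
proof -
  have "\<bar>fs (h z + x) - fs (h' z + x')\<bar> \<le> right_deriv fs (\<xi> z + U) * \<bar>(h z + x) - (h' z + x')\<bar>"
    using assms by (intro fs_Lipschitz) auto
  also have "\<dots> \<le> right_deriv fs (\<xi> z + U) * (\<bar>h z - h' z\<bar> + \<bar>x - x'\<bar>)"
    by (intro mult_left_mono right_deriv_nonneg) linarith
  finally have "\<bar>fs (h z + x) - fs (h' z + x')\<bar> \<le> right_deriv fs (\<xi> z + U) * (\<bar>h z - h' z\<bar> + \<bar>x - x'\<bar>)" .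
  moreover have "\<bar>(p - x) - (q - x')\<bar> \<le> r + (d + \<bar>x - x'\<bar>)" if "\<bar>p - q\<bar> \<le> r" "0 \<le> d" for p q r d :: real
    using that by linarith
  ultimately show ?thesis
    unfolding loss_def slope_def distrib_right[of _ 1] mult_1_left by simp
qed

sublocale lipschitz_class "G ` \<Theta>" \<xi> slope loss U
proof
  fix z show "0 < slope z" using slope_ge_1[of z] by linarith
next
  fix h x z assume h: "h \<in> G ` \<Theta>" and x: "\<bar>x\<bar> \<le> U"
  have hz: "\<bar>h z\<bar> \<le> \<xi> z" using h G_le_xi by auto
  have "\<bar>loss h x z - loss (\<lambda>_. 0) 0 z\<bar> \<le> slope z * (\<bar>h z - 0\<bar> + \<bar>x - 0\<bar>)"
    using loss_lipschitz_gen[of h z "\<lambda>_. 0" x 0] hz xi_pos[of z] x U_pos by simp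
  also have "\<dots> \<le> slope z * (\<xi> z + U)"
    using hz x slope_ge_1[of z] by (intro mult_left_mono) auto
  finally show "\<bar>loss h x z\<bar> \<le> slope z * (\<xi> z + U)"
    by (simp add: loss_def fs_0)
qed (auto intro: G_measurable xi_measurable xi_pos U_pos loss_lipschitz_gen G_le_xi)

text \<open>This identity is the reason for the square root in \<open>xi_map\<close>.\<close>

lemma env2_eq: "env2 z = (XI z)\<^sup>2"
  by (simp add: env2_def xi_map_def slope_def power_mult_distrib)

lemma XI_ge: "U \<le> XI z" "slope z * U \<le> XI z"
proof -
  have "U = sqrt (U\<^sup>2)" using U_pos by simp
  also have "\<dots> \<le> sqrt ((\<xi> z)\<^sup>2 + U\<^sup>2)" by simp
  finally have *: "U \<le> sqrt ((\<xi> z)\<^sup>2 + U\<^sup>2)" .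
  then show "slope z * U \<le> XI z"
    unfolding xi_map_def slope_def[symmetric] using slope_ge_1[of z] by (intro mult_left_mono) auto
  moreover have "1 * U \<le> slope z * U"
    using slope_ge_1 U_pos by (intro mult_right_mono) auto
  ultimately show "U \<le> XI z" by simp
qed

lemma sigma_square: "\<sigma>\<^sup>2 = (\<integral>z. (XI z)\<^sup>2 \<partial>PZ)"
  unfolding l2_norm_def by (simp add: Bochner_Integration.integral_nonneg)

lemma sigma_pos: "\<sigma> > 0"
proof -
  have "U\<^sup>2 \<le> (\<integral>z. (XI z)\<^sup>2 \<partial>PZ)"
    using XI_ge(1) U_pos by (intro PZ.integral_ge_const[OF xi_map_integrable]) (auto intro!: power_mono)
  then have "0 < (\<integral>z. (XI z)\<^sup>2 \<partial>PZ)"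
    using U_pos by (intro less_le_trans[OF _ \<open>U\<^sup>2 \<le> _\<close>]) simp
  then show ?thesis by (simp add: l2_norm_def)
qed

lemma slope_integrable: "integrable PZ slope"
proof (rule Bochner_Integration.integrable_bound)
  have "integrable PZ XI"
    by (rule PZ.square_integrable_imp_integrable[OF xi_map_measurable xi_map_integrable])
  then show "integrable PZ (\<lambda>z. XI z / U)" by simp
  have "(\<lambda>y. right_deriv fs y) \<in> borel_measurable borel"
    by (rule borel_measurable_mono) (auto simp: mono_def right_deriv_mono)
  then show "slope \<in> borel_measurable PZ"
    unfolding slope_def[abs_def] using xi_measurable(2) by measurable
  show "AE z in PZ. norm (slope z) \<le> norm (XI z / U)"
  proof (rule AE_I2)
    fix z
    have "slope z \<le> XI z / U"
      using XI_ge(2)[of z] U_pos by (simp add: pos_le_divide_eq)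
    then show "norm (slope z) \<le> norm (XI z / U)"
      using slope_ge_1[of z] unfolding real_norm_def by linarith
  qed
qed

section \<open>Population and empirical objectives, localisation of their minimisers\<close>

definition obj_pop :: "'t \<Rightarrow> real \<Rightarrow> real"
  where "obj_pop \<theta> x = (\<integral>z. fs (G \<theta> z + x) \<partial>PZ) - x"

definition obj_emp :: "nat \<Rightarrow> 'a \<Rightarrow> 't \<Rightarrow> real \<Rightarrow> real"
  where "obj_emp n \<omega> \<theta> x = (\<Sum>j=1..n. fs (G \<theta> (Z j \<omega>) + x)) / real n - x"

definition val_pop :: "'t \<Rightarrow> real" where "val_pop \<theta> = (INF x. obj_pop \<theta> x)"

definition val_emp :: "nat \<Rightarrow> 'a \<Rightarrow> 't \<Rightarrow> real" where "val_emp n \<omega> \<theta> = (INF x. obj_emp n \<omega> \<theta> x)"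

lemma risk_pop: 
  assumes "\<theta> \<in> \<Theta>"
  shows "risk_functional M \<Phi> (cdf (distr M borel (\<lambda>\<omega>. G \<theta> (Z 1 \<omega>)))) = val_pop \<theta>"
proof -
  have "(\<integral>\<omega>. fs (G \<theta> (Z 1 \<omega>) + x) \<partial>M) = (\<integral>z. fs (G \<theta> z + x) \<partial>PZ)" for x
    by (rule integral_Z1(1)) (use G_measurable_PZ[OF assms] in measurable)
  then show ?thesis
    unfolding val_pop_def obj_pop_def using risk_functional_cdf[OF G_heart[OF assms]] by simp
qed

lemma risk_emp: "n \<ge> 1 \<Longrightarrow> risk_functional M \<Phi> (emp_cdf n (\<lambda>j. G \<theta> (Z j \<omega>))) = val_emp n \<omega> \<theta>"
  unfolding val_emp_def obj_emp_def by (rule risk_functional_emp_cdf[OF atomless_M])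

text \<open>The lower bounds are Young's inequality with the constants 1, 0 and \<open>x0\<close>.
  The first is uniform in \<open>x\<close> and makes the infimum finite, the second controls
  \<open>x\<close> to the left, the third, as \<open>x0 > 1\<close>, to the right.\<close>

lemma obj_pop_bounds:
  assumes \<theta>: "\<theta> \<in> \<Theta>"
  shows "obj_pop \<theta> 0 \<le> Efs" "- E\<xi> - \<psi> 1 \<le> obj_pop \<theta> x" "- \<psi> 0 - x \<le> obj_pop \<theta> x"
    "x0 * (x - E\<xi>) - \<psi> x0 - x \<le> obj_pop \<theta> x"
proof -
  note int = fs_G_integrable[OF \<theta>] G_integrable[OF \<theta>]
  have "(\<integral>z. fs (G \<theta> z + 0) \<partial>PZ) \<le> Efs"
    using fs_G_integrable[OF \<theta>, of 0] G_le_xi[OF \<theta>] fs_xi_integrable0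
    by (intro Bochner_Integration.integral_mono fs_mono) (auto simp: abs_le_iff)
  then show "obj_pop \<theta> 0 \<le> Efs" by (simp add: obj_pop_def)
  have EG: "- E\<xi> \<le> (\<integral>z. G \<theta> z \<partial>PZ)"
  proof -
    have "(\<integral>z. - \<xi> z \<partial>PZ) \<le> (\<integral>z. G \<theta> z \<partial>PZ)"
      using int G_le_xi[OF \<theta>] xi_integrable
      by (intro Bochner_Integration.integral_mono) (auto simp: abs_le_iff minus_le_iff)
    then show ?thesis by simp
  qed
  have lin: "c * ((\<integral>z. G \<theta> z \<partial>PZ) + x) - \<psi> c \<le> (\<integral>z. fs (G \<theta> z + x) \<partial>PZ)" if c: "c \<ge> 0" "\<Phi> c < \<infinity>" for c
  proof -
    have "(\<integral>z. c * (G \<theta> z + x) - \<psi> c \<partial>PZ) \<le> (\<integral>z. fs (G \<theta> z + x) \<partial>PZ)"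
      using int by (intro Bochner_Integration.integral_mono legendre_ge c) auto
    then show ?thesis using int by simp
  qed
  show "- E\<xi> - \<psi> 1 \<le> obj_pop \<theta> x"
    using lin[of 1] Phi_1 EG by (simp add: obj_pop_def)
  show "- \<psi> 0 - x \<le> obj_pop \<theta> x"
    using lin[of 0] Phi_0 by (simp add: obj_pop_def)
  have "x0 * (x - E\<xi>) \<le> x0 * ((\<integral>z. G \<theta> z \<partial>PZ) + x)"
    using EG x0 by (intro mult_left_mono) auto
  then show "x0 * (x - E\<xi>) - \<psi> x0 - x \<le> obj_pop \<theta> x"
    using lin[OF _ x0(3)] x0(1) unfolding obj_pop_def by linarith
qed

lemma obj_emp_bounds:
  fixes \<omega> :: 'a
  assumes \<theta>: "\<theta> \<in> \<Theta>" and n: "n \<ge> 1"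
  defines "m \<equiv> (\<Sum>j=1..n. \<xi> (Z j \<omega>)) / real n"
  shows "obj_emp n \<omega> \<theta> 0 \<le> (\<Sum>j=1..n. fs (\<xi> (Z j \<omega>))) / real n"
    "- m - \<psi> 1 \<le> obj_emp n \<omega> \<theta> x" "- \<psi> 0 - x \<le> obj_emp n \<omega> \<theta> x"
    "x0 * (x - m) - \<psi> x0 - x \<le> obj_emp n \<omega> \<theta> x"
proof -
  show "obj_emp n \<omega> \<theta> 0 \<le> (\<Sum>j=1..n. fs (\<xi> (Z j \<omega>))) / real n"
    unfolding obj_emp_def using G_le_xi[OF \<theta>]
    by (auto intro!: divide_right_mono sum_mono fs_mono simp: abs_le_iff)
  have EG: "- m \<le> (\<Sum>j=1..n. G \<theta> (Z j \<omega>)) / real n"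
    unfolding m_def minus_divide_left sum_negf[symmetric] using G_le_xi[OF \<theta>]
    by (intro divide_right_mono sum_mono) (auto simp: abs_le_iff minus_le_iff)
  have lin: "c * ((\<Sum>j=1..n. G \<theta> (Z j \<omega>)) / real n + x) - \<psi> c \<le> (\<Sum>j=1..n. fs (G \<theta> (Z j \<omega>) + x)) / real n"
    if c: "c \<ge> 0" "\<Phi> c < \<infinity>" for c
  proof -
    have "(\<Sum>j=1..n. c * (G \<theta> (Z j \<omega>) + x) - \<psi> c) / real n \<le> (\<Sum>j=1..n. fs (G \<theta> (Z j \<omega>) + x)) / real n"
      by (intro divide_right_mono sum_mono legendre_ge c) auto
    moreover have "(\<Sum>j=1..n. c * (G \<theta> (Z j \<omega>) + x) - \<psi> c) / real n = c * ((\<Sum>j=1..n. G \<theta> (Z j \<omega>)) / real n + x) - \<psi> c"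
    proof -
      have "(\<Sum>j=1..n. c * (G \<theta> (Z j \<omega>) + x) - \<psi> c) = c * (\<Sum>j=1..n. G \<theta> (Z j \<omega>)) + real n * (c * x - \<psi> c)"
        by (simp add: sum_subtractf sum.distrib sum_distrib_left algebra_simps)
      then have "(\<Sum>j=1..n. c * (G \<theta> (Z j \<omega>) + x) - \<psi> c) / real n
          = c * (\<Sum>j=1..n. G \<theta> (Z j \<omega>)) / real n + real n * (c * x - \<psi> c) / real n"
        by (simp only: add_divide_distrib)
      also have "real n * (c * x - \<psi> c) / real n = c * x - \<psi> c"
        using n by simp
      finally show ?thesis by (simp add: distrib_left)
    qed
    ultimately show ?thesis by simp
  qed
  show "- m - \<psi> 1 \<le> obj_emp n \<omega> \<theta> x"
    using lin[of 1] Phi_1 EG by (simp add: obj_emp_def)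
  show "- \<psi> 0 - x \<le> obj_emp n \<omega> \<theta> x"
    using lin[of 0] Phi_0 by (simp add: obj_emp_def)
  have "x0 * (x - m) \<le> x0 * ((\<Sum>j=1..n. G \<theta> (Z j \<omega>)) / real n + x)"
    using EG x0 by (intro mult_left_mono) auto
  then show "x0 * (x - m) - \<psi> x0 - x \<le> obj_emp n \<omega> \<theta> x"
    using lin[OF _ x0(3)] x0(1) unfolding obj_emp_def by linarith
qed

text \<open>The definition of \<open>x_upper\<close> is exactly what forces minimisers of both the empirical and
  the true objective into \<open>{- U..U}\<close>.\<close>

lemma outside_interval:
  assumes g0: "g 0 \<le> Efs + \<delta>" and m: "m \<le> E\<xi> + \<delta>"
    and lower: "- \<psi> 0 - x \<le> g x" "x0 * (x - m) - \<psi> x0 - x \<le> g x" and x: "\<bar>x\<bar> > U"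
  shows "g 0 \<le> g (x :: real)"
proof (cases "x > 0")
  case True
  \<comment> \<open>To the right the bound with \<open>x0\<close> increases with slope
    \<open>x0 - 1\<close>. Inserting \<open>U_eq\<close>, its value at \<open>U\<close> is at least
    \<open>Efs + \<delta>\<close>, hence at least \<open>g 0\<close>.\<close>
  then have "U \<le> x" using x by simp
  then have "(x0 - 1) * U \<le> (x0 - 1) * x"
    using x0 by (intro mult_left_mono) auto
  moreover have "x0 * m \<le> x0 * (E\<xi> + \<delta>)"
    using m x0 by (intro mult_left_mono) auto
  moreover have "0 \<le> (x0 - 1) * \<psi> 0"
    using x0 psi_nonneg by simp
  ultimately show ?thesis
    using U_eq lower(2) g0 by (simp add: algebra_simps)
next
  case False
  then show ?thesis
    using x U_ge lower(1) g0 by linarith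
qed

lemma val_pop_bdd: "\<theta> \<in> \<Theta> \<Longrightarrow> bdd_below (range (obj_pop \<theta>))"
  using obj_pop_bounds(2) by (intro bdd_belowI2) auto

lemma val_emp_bdd: "\<theta> \<in> \<Theta> \<Longrightarrow> n \<ge> 1 \<Longrightarrow> bdd_below (range (obj_emp n \<omega> \<theta>))"
  using obj_emp_bounds(2) by (intro bdd_belowI2) auto

lemma val_pop_ge: "\<theta> \<in> \<Theta> \<Longrightarrow> - E\<xi> - \<psi> 1 \<le> val_pop \<theta>"
  unfolding val_pop_def using obj_pop_bounds(2) by (intro cINF_greatest) auto

lemma val_emp_ge: "\<theta> \<in> \<Theta> \<Longrightarrow> n \<ge> 1 \<Longrightarrow> - ((\<Sum>j=1..n. \<xi> (Z j \<omega>)) / real n) - \<psi> 1 \<le> val_emp n \<omega> \<theta>"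
  unfolding val_emp_def using obj_emp_bounds(2) by (intro cINF_greatest) auto

lemma obj_diff:
  "\<theta> \<in> \<Theta> \<Longrightarrow> n \<ge> 1 \<Longrightarrow> obj_emp n \<omega> \<theta> x - obj_pop \<theta> x
    = (\<Sum>j=1..n. loss (G \<theta>) x (Z j \<omega>)) / real n - (\<integral>z. loss (G \<theta>) x z \<partial>PZ)"
  using fs_G_integrable[of \<theta> x]
  by (simp add: obj_emp_def obj_pop_def loss_def sum_subtractf diff_divide_distrib)

lemma obj_pop_lipschitz:
  assumes \<theta>: "\<theta> \<in> \<Theta>" and x: "\<bar>x\<bar> \<le> U" "\<bar>y\<bar> \<le> U"
  shows "\<bar>obj_pop \<theta> x - obj_pop \<theta> y\<bar> \<le> (\<integral>z. slope z \<partial>PZ) * \<bar>x - y\<bar>"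
proof -
  have "obj_pop \<theta> x - obj_pop \<theta> y = (\<integral>z. loss (G \<theta>) x z - loss (G \<theta>) y z \<partial>PZ)"
    using fs_G_integrable[OF \<theta>] by (simp add: obj_pop_def loss_def)
  also have "\<bar>\<dots>\<bar> \<le> (\<integral>z. \<bar>loss (G \<theta>) x z - loss (G \<theta>) y z\<bar> \<partial>PZ)"
    by (rule integral_abs_bound)
  also have "\<dots> \<le> (\<integral>z. slope z * \<bar>x - y\<bar> \<partial>PZ)"
  proof (rule Bochner_Integration.integral_mono)
    show "integrable PZ (\<lambda>z. \<bar>loss (G \<theta>) x z - loss (G \<theta>) y z\<bar>)"
      using fs_G_integrable[OF \<theta>] by (simp add: loss_def)
    show "integrable PZ (\<lambda>z. slope z * \<bar>x - y\<bar>)"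
      using slope_integrable by simp
    fix z
    show "\<bar>loss (G \<theta>) x z - loss (G \<theta>) y z\<bar> \<le> slope z * \<bar>x - y\<bar>"
      using loss_lipschitz_gen[of "G \<theta>" z "G \<theta>" x y] G_le_xi[OF \<theta>] x by simp
  qed
  finally show ?thesis using slope_integrable by simp
qed

lemma obj_emp_continuous: "continuous_on A (obj_emp n \<omega> \<theta>)"
  unfolding obj_emp_def divide_inverse
  by (intro continuous_intros continuous_on_compose2[OF fs_continuous[of UNIV]]) auto

section \<open>Reduction to countably many parameters and measurability\<close>

lemma val_emp_le:
  assumes \<theta>: "\<theta> \<in> \<Theta>" "\<eta> \<in> \<Theta>" and n: "n \<ge> 1"
    and close: "\<And>j. j \<in> {1..n} \<Longrightarrow> \<bar>G \<theta> (Z j \<omega>) - G \<eta> (Z j \<omega>)\<bar> \<le> e"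
  shows "val_emp n \<omega> \<eta> \<le> val_emp n \<omega> \<theta> + e"
proof -
  have "val_emp n \<omega> \<eta> - e \<le> obj_emp n \<omega> \<theta> x" for x
  proof -
    \<comment> \<open>Lowering the shift by \<open>e\<close> absorbs the discrepancy inside the
      monotone \<open>fs\<close>; the linear term returns the cost \<open>e\<close>.\<close>
    have "val_emp n \<omega> \<eta> \<le> obj_emp n \<omega> \<eta> (x - e)"
      unfolding val_emp_def by (intro cINF_lower val_emp_bdd \<theta> n) simp
    also have "\<dots> \<le> (\<Sum>j=1..n. fs (G \<theta> (Z j \<omega>) + x)) / real n - (x - e)"
      unfolding obj_emp_def using close
      by (intro diff_mono divide_right_mono sum_mono fs_mono) (auto simp: abs_le_iff algebra_simps)
    also have "\<dots> = obj_emp n \<omega> \<theta> x + e"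
      by (simp add: obj_emp_def)
    finally show ?thesis by simp
  qed
  then have "val_emp n \<omega> \<eta> - e \<le> val_emp n \<omega> \<theta>"
    unfolding val_emp_def[of n \<omega> \<theta>] by (intro cINF_greatest) auto
  then show ?thesis by simp
qed

text \<open>As \<open>fs\<close> need not be globally Lipschitz, closeness in
  \<open>L\<^sup>1\<close> does not bound the difference of values. A subsequence converging almost
  everywhere is taken instead, and at each fixed \<open>x\<close> dominated convergence applies with
  majorant \<open>fs (\<xi> z + \<bar>x\<bar>) + \<psi> 0\<close>.\<close>

lemma val_pop_dense:
  assumes sub: "\<Theta>' \<subseteq> \<Theta>" and \<theta>: "\<theta> \<in> \<Theta>" and ne: "\<Theta>' \<noteq> {}"
    and dense: "(INF \<eta>\<in>\<Theta>'. \<integral>\<omega>. \<bar>G \<eta> (Z 1 \<omega>) - G \<theta> (Z 1 \<omega>)\<bar> \<partial>M) = 0"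
  shows "(INF \<eta>\<in>\<Theta>'. val_pop \<eta>) \<le> val_pop \<theta>"
proof -
  have L1: "(\<integral>\<omega>. \<bar>G \<eta> (Z 1 \<omega>) - G \<theta> (Z 1 \<omega>)\<bar> \<partial>M) = (\<integral>z. norm (G \<eta> z - G \<theta> z) \<partial>PZ)" if "\<eta> \<in> \<Theta>'" for \<eta>
  proof -
    have "\<eta> \<in> \<Theta>" using that sub by blast
    have "(\<lambda>z. \<bar>G \<eta> z - G \<theta> z\<bar>) \<in> borel_measurable PZ"
      by (intro borel_measurable_abs borel_measurable_diff G_measurable_PZ \<open>\<eta> \<in> \<Theta>\<close> \<theta>)
    from integral_Z1(1)[OF this] show ?thesis by simp
  qed
  have "\<exists>\<eta>\<in>\<Theta>'. (\<integral>z. norm (G \<eta> z - G \<theta> z) \<partial>PZ) < inverse (real (Suc k))" for k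
  proof -
    have "bdd_below ((\<lambda>\<eta>. \<integral>\<omega>. \<bar>G \<eta> (Z 1 \<omega>) - G \<theta> (Z 1 \<omega>)\<bar> \<partial>M) ` \<Theta>')"
      by (intro bdd_belowI2[where m = 0]) simp
    moreover have "(INF \<eta>\<in>\<Theta>'. \<integral>\<omega>. \<bar>G \<eta> (Z 1 \<omega>) - G \<theta> (Z 1 \<omega>)\<bar> \<partial>M) < inverse (real (Suc k))"
      unfolding dense by simp
    ultimately show ?thesis
      using ne L1 by (subst (asm) cINF_less_iff) auto
  qed
  then have "\<exists>\<eta>. \<forall>k. \<eta> k \<in> \<Theta>' \<and> (\<integral>z. norm (G (\<eta> k) z - G \<theta> z) \<partial>PZ) < inverse (real (Suc k))"
    by (intro choice allI) blast
  then obtain \<eta> where \<eta>: "\<And>k. \<eta> k \<in> \<Theta>'" and small: "\<And>k. (\<integral>z. norm (G (\<eta> k) z - G \<theta> z) \<partial>PZ) < inverse (real (Suc k))"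
    by blast
  have \<eta>\<Theta>: "\<eta> k \<in> \<Theta>" for k using \<eta> sub by blast
  have "(\<lambda>k. \<integral>z. norm (G (\<eta> k) z - G \<theta> z) \<partial>PZ) \<longlonglongrightarrow> 0"
  proof (rule tendsto_sandwich[OF _ _ tendsto_const LIMSEQ_inverse_real_of_nat])
    show "\<forall>\<^sub>F k in sequentially. 0 \<le> (\<integral>z. norm (G (\<eta> k) z - G \<theta> z) \<partial>PZ)"
      by simp
    show "\<forall>\<^sub>F k in sequentially. (\<integral>z. norm (G (\<eta> k) z - G \<theta> z) \<partial>PZ) \<le> inverse (real (Suc k))"
      using small by (intro always_eventually allI less_imp_le)
  qed
  moreover have "integrable PZ (\<lambda>z. G (\<eta> k) z - G \<theta> z)" for k
    using G_integrable[OF \<eta>\<Theta>] G_integrable[OF \<theta>] by simp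
  ultimately obtain r where r: "strict_mono r" "AE z in PZ. (\<lambda>k. G (\<eta> (r k)) z - G \<theta> z) \<longlonglongrightarrow> 0"
    using tendsto_L1_AE_subseq[of PZ "\<lambda>k z. G (\<eta> k) z - G \<theta> z"] by blast
  have "(INF \<eta>\<in>\<Theta>'. val_pop \<eta>) \<le> obj_pop \<theta> x" for x
  proof -
    have "(\<lambda>k. \<integral>z. fs (G (\<eta> (r k)) z + x) \<partial>PZ) \<longlonglongrightarrow> (\<integral>z. fs (G \<theta> z + x) \<partial>PZ)"
    proof (rule integral_dominated_convergence[where w = "\<lambda>z. fs (\<xi> z + \<bar>x\<bar>) + \<psi> 0"])
      show "AE z in PZ. (\<lambda>k. fs (G (\<eta> (r k)) z + x)) \<longlonglongrightarrow> fs (G \<theta> z + x)"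
        using r(2)
      proof eventually_elim
        case (elim z)
        have "(\<lambda>k. (G (\<eta> (r k)) z - G \<theta> z) + (G \<theta> z + x)) \<longlonglongrightarrow> 0 + (G \<theta> z + x)"
          by (intro tendsto_add elim tendsto_const)
        then have "(\<lambda>k. G (\<eta> (r k)) z + x) \<longlonglongrightarrow> G \<theta> z + x" by simp
        moreover have "isCont fs (G \<theta> z + x)"
          using fs_continuous[of UNIV] by (simp add: continuous_on_eq_continuous_at)
        ultimately show ?case
          by (rule isCont_tendsto_compose[rotated])
      qed
      show "AE z in PZ. norm (fs (G (\<eta> (r k)) z + x)) \<le> fs (\<xi> z + \<bar>x\<bar>) + \<psi> 0" for k
      proof (rule AE_I2)
        fix z
        have "\<bar>G (\<eta> (r k)) z + x\<bar> \<le> \<xi> z + \<bar>x\<bar>"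
          using G_le_xi[OF \<eta>\<Theta>, of "r k" z] by linarith
        then have "fs \<bar>G (\<eta> (r k)) z + x\<bar> \<le> fs (\<xi> z + \<bar>x\<bar>)"
          by (rule fs_mono)
        then show "norm (fs (G (\<eta> (r k)) z + x)) \<le> fs (\<xi> z + \<bar>x\<bar>) + \<psi> 0"
          using abs_fs_le[of "G (\<eta> (r k)) z + x"] unfolding real_norm_def by linarith
      qed
      show "integrable PZ (\<lambda>z. fs (\<xi> z + \<bar>x\<bar>) + \<psi> 0)"
        using fs_xi_integrable by simp
    qed (use fs_G_integrable[OF \<theta>] fs_G_integrable[OF \<eta>\<Theta>] in auto)
    then have lim: "(\<lambda>k. obj_pop (\<eta> (r k)) x) \<longlonglongrightarrow> obj_pop \<theta> x"
      unfolding obj_pop_def by (intro tendsto_diff tendsto_const)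
    have "(INF \<eta>\<in>\<Theta>'. val_pop \<eta>) \<le> obj_pop (\<eta> (r k)) x" for k
    proof -
      have "(INF \<eta>\<in>\<Theta>'. val_pop \<eta>) \<le> val_pop (\<eta> (r k))"
        using \<eta> sub val_pop_ge by (intro cINF_lower bdd_belowI2) auto
      also have "\<dots> \<le> obj_pop (\<eta> (r k)) x"
        unfolding val_pop_def by (intro cINF_lower val_pop_bdd \<eta>\<Theta>) simp
      finally show ?thesis .
    qed
    then show ?thesis
      by (intro LIMSEQ_le_const[OF lim]) auto
  qed
  then show ?thesis
    unfolding val_pop_def[of \<theta>] by (intro cINF_greatest) auto
qed

lemma Inf_eq_dense:
  fixes v :: "'t \<Rightarrow> real"
  assumes sub: "\<Theta>' \<subseteq> \<Theta>" "\<Theta>' \<noteq> {}" and bdd: "\<And>\<theta>. \<theta> \<in> \<Theta> \<Longrightarrow> B \<le> v \<theta>"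
    and le: "\<And>\<theta>. \<theta> \<in> \<Theta> \<Longrightarrow> (INF \<eta>\<in>\<Theta>'. v \<eta>) \<le> v \<theta>"
  shows "(INF \<theta>\<in>\<Theta>. v \<theta>) = (INF \<theta>\<in>\<Theta>'. v \<theta>)"
proof (rule antisym)
  show "(INF \<theta>\<in>\<Theta>. v \<theta>) \<le> (INF \<theta>\<in>\<Theta>'. v \<theta>)"
    using sub bdd by (intro cINF_superset_mono bdd_belowI2) auto
  show "(INF \<theta>\<in>\<Theta>'. v \<theta>) \<le> (INF \<theta>\<in>\<Theta>. v \<theta>)"
    using nonempty le by (intro cINF_greatest) auto
qed

text \<open>One countable set serves the population value and all sample sizes: the
  \<open>L\<^sup>1\<close> clause of \<open>separable\<close> handles the former, uniform closeness
  at the sample points the latter. The null set depends on \<open>n\<close> but not on the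
  parameter.\<close>

lemma countable_reduction:
  obtains \<Theta>' where "\<Theta>' \<subseteq> \<Theta>" "countable \<Theta>'" "\<Theta>' \<noteq> {}"
    "(INF \<theta>\<in>\<Theta>. val_pop \<theta>) = (INF \<theta>\<in>\<Theta>'. val_pop \<theta>)"
    "\<And>n. n \<ge> 1 \<Longrightarrow> \<exists>N\<in>null_sets M. \<forall>\<omega>\<in>space M - N.
      (INF \<theta>\<in>\<Theta>. val_emp n \<omega> \<theta>) = (INF \<theta>\<in>\<Theta>'. val_emp n \<omega> \<theta>)"
proof -
  obtain \<Theta>' and N :: "nat \<Rightarrow> (nat \<Rightarrow> 'z) set" where \<Theta>': "\<Theta>' \<subseteq> \<Theta>" "countable \<Theta>'" "\<Theta>' \<noteq> {}"
    and N: "\<And>n. n \<ge> 1 \<Longrightarrow> N n \<in> null_sets (Pi\<^sub>M {1..n} (\<lambda>_. PZ))"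
    and pop: "\<And>n \<theta> z. n \<ge> 1 \<Longrightarrow> \<theta> \<in> \<Theta> \<Longrightarrow> z \<in> space (Pi\<^sub>M {1..n} (\<lambda>_. PZ)) - N n \<Longrightarrow>
           (INF \<eta>\<in>\<Theta>'. \<integral>\<omega>. \<bar>G \<eta> (Z 1 \<omega>) - G \<theta> (Z 1 \<omega>)\<bar> \<partial>M) = 0"
    and emp: "\<And>n \<theta> z. n \<ge> 1 \<Longrightarrow> \<theta> \<in> \<Theta> \<Longrightarrow> z \<in> space (Pi\<^sub>M {1..n} (\<lambda>_. PZ)) - N n \<Longrightarrow>
           (INF \<eta>\<in>\<Theta>'. MAX j\<in>{1..n}. \<bar>G \<theta> (z j) - G \<eta> (z j)\<bar>) = 0"
    using separable by blast
  show ?thesis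
  proof
    show "\<Theta>' \<subseteq> \<Theta>" "countable \<Theta>'" "\<Theta>' \<noteq> {}" by fact+
    \<comment> \<open>The \<open>L\<^sup>1\<close> clause does not mention \<open>z\<close> but is
      quantified over points off a null set, so one such point has to be exhibited.\<close>
    have "space (Pi\<^sub>M {1..1::nat} (\<lambda>_. PZ)) - N 1 \<noteq> {}"
    proof
      interpret P: prob_space "Pi\<^sub>M {1..1::nat} (\<lambda>_. PZ)"
        by (intro prob_space_PiM PZ.prob_space_axioms)
      assume "space (Pi\<^sub>M {1..1::nat} (\<lambda>_. PZ)) - N 1 = {}"
      then have "space (Pi\<^sub>M {1..1::nat} (\<lambda>_. PZ)) \<subseteq> N 1" by blast
      then have "emeasure (Pi\<^sub>M {1..1::nat} (\<lambda>_. PZ)) (space (Pi\<^sub>M {1..1::nat} (\<lambda>_. PZ))) \<le> emeasure (Pi\<^sub>M {1..1::nat} (\<lambda>_. PZ)) (N 1)"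
        using N[of 1] by (intro emeasure_mono) (auto intro: null_setsD2)
      also have "\<dots> = 0" using N[of 1] by auto
      finally show False
        using prob_space.emeasure_space_1[OF prob_space_PiM[OF PZ.prob_space_axioms], of "{1..1::nat}"] by simp
    qed
    then obtain z where z: "z \<in> space (Pi\<^sub>M {1..1::nat} (\<lambda>_. PZ)) - N 1" by blast
    show "(INF \<theta>\<in>\<Theta>. val_pop \<theta>) = (INF \<theta>\<in>\<Theta>'. val_pop \<theta>)"
      by (rule Inf_eq_dense[OF \<Theta>'(1,3) val_pop_ge val_pop_dense[OF \<Theta>'(1) _ \<Theta>'(3) pop[OF _ _ z]]]) auto
    fix n :: nat assume n: "n \<ge> 1"
    define N' where "N' = {\<omega>\<in>space M. (\<lambda>j\<in>{1..n}. Z j \<omega>) \<in> N n}"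
    have J: "{1..n} \<subseteq> {1..}" "{1..n} \<noteq> {}" using n by auto
    have Nn: "N n \<in> sets (Pi\<^sub>M {1..n} (\<lambda>_. PZ))" using N[OF n] by auto
    have "N' \<in> null_sets M"
      unfolding N'_def using sample_event[OF J(1) Nn] prob_sample[OF J Nn] N[OF n] by (auto intro!: null_setsI)
    moreover have "(INF \<theta>\<in>\<Theta>. val_emp n \<omega> \<theta>) = (INF \<theta>\<in>\<Theta>'. val_emp n \<omega> \<theta>)" if \<omega>: "\<omega> \<in> space M - N'" for \<omega>
    proof (rule Inf_eq_dense[OF \<Theta>'(1,3) val_emp_ge[OF _ n]])
      fix \<theta> assume \<theta>: "\<theta> \<in> \<Theta>"
      define z where "z = (\<lambda>j\<in>{1..n}. Z j \<omega>)"
      have z: "z \<in> space (Pi\<^sub>M {1..n} (\<lambda>_. PZ)) - N n"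
        using \<omega> by (auto simp: z_def N'_def space_PiM)
      show "(INF \<eta>\<in>\<Theta>'. val_emp n \<omega> \<eta>) \<le> val_emp n \<omega> \<theta>"
      proof (rule field_le_epsilon)
        fix e :: real assume e: "e > 0"
        have "bdd_below ((\<lambda>\<eta>. MAX j\<in>{1..n}. \<bar>G \<theta> (z j) - G \<eta> (z j)\<bar>) ` \<Theta>')"
        proof (rule bdd_belowI2)
          fix \<eta>
          have "0 \<le> \<bar>G \<theta> (z 1) - G \<eta> (z 1)\<bar>" by simp
          also have "\<dots> \<le> (MAX j\<in>{1..n}. \<bar>G \<theta> (z j) - G \<eta> (z j)\<bar>)"
            using n by (intro Max_ge) auto
          finally show "0 \<le> (MAX j\<in>{1..n}. \<bar>G \<theta> (z j) - G \<eta> (z j)\<bar>)" .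
        qed
        moreover have "(INF \<eta>\<in>\<Theta>'. MAX j\<in>{1..n}. \<bar>G \<theta> (z j) - G \<eta> (z j)\<bar>) < e"
          using emp[OF n \<theta> z] e by simp
        ultimately obtain \<eta> where \<eta>: "\<eta> \<in> \<Theta>'" "(MAX j\<in>{1..n}. \<bar>G \<theta> (z j) - G \<eta> (z j)\<bar>) < e"
          using \<Theta>'(3) by (subst (asm) cINF_less_iff) auto
        have \<eta>\<Theta>: "\<eta> \<in> \<Theta>" using \<eta>(1) \<Theta>'(1) by blast
        have "\<bar>G \<theta> (Z j \<omega>) - G \<eta> (Z j \<omega>)\<bar> \<le> e" if j: "j \<in> {1..n}" for j
        proof -
          have "\<bar>G \<theta> (z j) - G \<eta> (z j)\<bar> \<le> (MAX j\<in>{1..n}. \<bar>G \<theta> (z j) - G \<eta> (z j)\<bar>)"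
            using j by (intro Max_ge) auto
          then have "\<bar>G \<theta> (z j) - G \<eta> (z j)\<bar> \<le> e"
            using \<eta>(2) by linarith
          then show ?thesis using j by (simp add: z_def)
        qed
        then have "val_emp n \<omega> \<eta> \<le> val_emp n \<omega> \<theta> + e"
          by (rule val_emp_le[OF \<theta> \<eta>\<Theta> n])
        moreover have "(INF \<eta>\<in>\<Theta>'. val_emp n \<omega> \<eta>) \<le> val_emp n \<omega> \<eta>"
          using \<eta>(1) \<Theta>'(1) val_emp_ge[OF _ n] by (intro cINF_lower bdd_belowI2) auto
        ultimately show "(INF \<eta>\<in>\<Theta>'. val_emp n \<omega> \<eta>) \<le> val_emp n \<omega> \<theta> + e" by linarith
      qed
    qed
    ultimately show "\<exists>N\<in>null_sets M. \<forall>\<omega>\<in>space M - N.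
      (INF \<theta>\<in>\<Theta>. val_emp n \<omega> \<theta>) = (INF \<theta>\<in>\<Theta>'. val_emp n \<omega> \<theta>)" by blast
  qed
qed

lemma val_emp_measurable:
  assumes \<theta>: "\<theta> \<in> \<Theta>" and n: "n \<ge> 1"
  shows "(\<lambda>\<omega>. val_emp n \<omega> \<theta>) \<in> borel_measurable M"
proof -
  obtain T :: "real set" where T: "countable T" "UNIV \<subseteq> closure T"
    using Topology_Euclidean_Space.separable[of "UNIV :: real set"] by auto
  then have Tne: "T \<noteq> {}" by auto
  have "val_emp n \<omega> \<theta> = (INF x\<in>T. obj_emp n \<omega> \<theta> x)" for \<omega>
    unfolding val_emp_def
  proof (rule antisym)
    show "(INF x. obj_emp n \<omega> \<theta> x) \<le> (INF x\<in>T. obj_emp n \<omega> \<theta> x)"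
      using Tne val_emp_bdd[OF \<theta> n] by (intro cINF_superset_mono) auto
    have bdd: "bdd_below (obj_emp n \<omega> \<theta> ` T)"
      by (rule bdd_below_mono[OF val_emp_bdd[OF \<theta> n]]) auto
    have "(INF x\<in>T. obj_emp n \<omega> \<theta> x) \<le> obj_emp n \<omega> \<theta> x" for x
      by (rule continuous_ge_on_closure[OF obj_emp_continuous, of x T])
         (use T(2) bdd in \<open>auto intro: cINF_lower\<close>)
    then show "(INF x\<in>T. obj_emp n \<omega> \<theta> x) \<le> (INF x. obj_emp n \<omega> \<theta> x)"
      by (intro cINF_greatest) auto
  qed
  moreover have "(\<lambda>\<omega>. INF x\<in>T. obj_emp n \<omega> \<theta> x) \<in> borel_measurable M"
  proof (rule borel_measurable_cINF_real[OF T(1)])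
    fix x
    have m: "(\<lambda>z. fs (G \<theta> z + x)) \<in> borel_measurable PZ"
      using G_measurable_PZ[OF \<theta>] by measurable
    have "(\<lambda>\<omega>. fs (G \<theta> (Z j \<omega>) + x)) \<in> borel_measurable M" if "j \<in> {1..n}" for j
      by (rule measurable_Z_comp[OF _ m]) (use that in simp)
    then show "(\<lambda>\<omega>. obj_emp n \<omega> \<theta> x) \<in> borel_measurable M"
      unfolding obj_emp_def
      by (intro borel_measurable_diff borel_measurable_divide borel_measurable_sum borel_measurable_const)
  qed
  ultimately show ?thesis by simp
qed

lemma optimal_value_measurable:
  assumes n: "n \<ge> 1"
  shows "(\<lambda>\<omega>. INF \<theta>\<in>\<Theta>. val_emp n \<omega> \<theta>) \<in> borel_measurable M"
proof -
  obtain \<Theta>' where \<Theta>': "\<Theta>' \<subseteq> \<Theta>" "countable \<Theta>'"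
    and red: "\<And>n. n \<ge> 1 \<Longrightarrow> \<exists>N\<in>null_sets M. \<forall>\<omega>\<in>space M - N.
      (INF \<theta>\<in>\<Theta>. val_emp n \<omega> \<theta>) = (INF \<theta>\<in>\<Theta>'. val_emp n \<omega> \<theta>)"
    using countable_reduction by metis
  obtain N where N: "N \<in> null_sets M"
    "\<And>\<omega>. \<omega> \<in> space M - N \<Longrightarrow> (INF \<theta>\<in>\<Theta>. val_emp n \<omega> \<theta>) = (INF \<theta>\<in>\<Theta>'. val_emp n \<omega> \<theta>)"
    using red[OF n] by blast
  have "(\<lambda>\<omega>. INF \<theta>\<in>\<Theta>'. val_emp n \<omega> \<theta>) \<in> borel_measurable M"
    using \<Theta>' val_emp_measurable[OF _ n] by (intro borel_measurable_cINF_real) auto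
  then show ?thesis
    using N by (rule complete_measure.measurable_off_null[OF complete_M]) auto
qed

section \<open>The deviation bound for the optimal value\<close>

lemma Inf_le_restricted:
  fixes f g :: "real \<Rightarrow> real"
  assumes f: "bdd_below (range f)" and out: "\<And>x. \<bar>x\<bar> > U \<Longrightarrow> g 0 \<le> g x"
    and close: "\<And>x. \<bar>x\<bar> \<le> U \<Longrightarrow> f x \<le> g x + c"
  shows "(INF x. f x) \<le> (INF x. g x) + c"
proof -
  have "(INF x. f x) - c \<le> g x" for x
  proof (cases "\<bar>x\<bar> \<le> U")
    case True
    have "(INF x. f x) \<le> f x" using f by (intro cINF_lower) auto
    with close[OF True] show ?thesis by simp
  next
    case False
    have "(INF x. f x) \<le> f 0" using f by (intro cINF_lower) auto
    with close[of 0] out[of x] False U_pos show ?thesis by simp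
  qed
  then have "(INF x. f x) - c \<le> (INF x. g x)"
    by (intro cINF_greatest) auto
  then show ?thesis by simp
qed

lemma Inf_close:
  fixes f g :: "'t \<Rightarrow> real"
  assumes S: "S \<noteq> {}" and bdd: "bdd_below (f ` S)" "bdd_below (g ` S)"
    and close: "\<And>\<theta>. \<theta> \<in> S \<Longrightarrow> \<bar>f \<theta> - g \<theta>\<bar> \<le> c"
  shows "\<bar>(INF \<theta>\<in>S. f \<theta>) - (INF \<theta>\<in>S. g \<theta>)\<bar> \<le> c"
proof -
  have "(INF \<theta>\<in>S. f \<theta>) - c \<le> g \<theta>" if "\<theta> \<in> S" for \<theta>
    using cINF_lower[OF bdd(1) that] close[OF that] by linarith
  then have "(INF \<theta>\<in>S. f \<theta>) - c \<le> (INF \<theta>\<in>S. g \<theta>)"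
    using S by (intro cINF_greatest)
  moreover have "(INF \<theta>\<in>S. g \<theta>) - c \<le> f \<theta>" if "\<theta> \<in> S" for \<theta>
    using cINF_lower[OF bdd(2) that] close[OF that] by linarith
  then have "(INF \<theta>\<in>S. g \<theta>) - c \<le> (INF \<theta>\<in>S. f \<theta>)"
    using S by (intro cINF_greatest)
  ultimately show ?thesis by linarith
qed

abbreviation Aev :: "nat \<Rightarrow> 'a set" where "Aev \<equiv> A_event M \<Phi> Z PZ \<xi> \<delta>"
abbreviation Bev :: "nat \<Rightarrow> 'a set" where "Bev \<equiv> B_event M Z PZ (\<lambda>z. 2 * XI z)"

lemma sum_Z_measurable:
  fixes g :: "'z \<Rightarrow> real"
  assumes "g \<in> borel_measurable PZ"
  shows "(\<lambda>\<omega>. \<Sum>j=1..n. g (Z j \<omega>)) \<in> borel_measurable M"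
  by (intro borel_measurable_sum measurable_Z_comp[OF _ assms]) simp

lemma fs_xi_measurable: "(\<lambda>z. fs (\<xi> z)) \<in> borel_measurable PZ"
  using xi_measurable(2) by measurable

text \<open>The factor 2 in \<open>2 * XI\<close> multiplies both sides by 4 and cancels; what
  remains is the budget \<open>2 * \<sigma>\<^sup>2\<close> used for the first half of the double
  sample.\<close>

lemma Bev_eq: "Bev n = {\<omega>\<in>space M. (\<Sum>j=1..n. (XI (Z j \<omega>))\<^sup>2) / real n \<le> 2 * \<sigma>\<^sup>2}"
proof -
  have sq: "(\<Sum>j=1..n. (2 * XI (Z j \<omega>))\<^sup>2) / real n = 4 * ((\<Sum>j=1..n. (XI (Z j \<omega>))\<^sup>2) / real n)" for \<omega>
    by (simp add: power_mult_distrib sum_distrib_left)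
  have int: "(\<integral>z. (2 * XI z)\<^sup>2 \<partial>PZ) = 4 * \<sigma>\<^sup>2"
    unfolding sigma_square by (simp add: power_mult_distrib)
  have "(\<Sum>j=1..n. (2 * XI (Z j \<omega>))\<^sup>2) / real n \<le> 2 * (\<integral>z. (2 * XI z)\<^sup>2 \<partial>PZ)
      \<longleftrightarrow> (\<Sum>j=1..n. (XI (Z j \<omega>))\<^sup>2) / real n \<le> 2 * \<sigma>\<^sup>2" for \<omega>
    unfolding sq int by linarith
  then show ?thesis
    unfolding B_event_def by blast
qed

lemma Aev_event: "Aev n \<in> events" and Bev_event: "Bev n \<in> events"
proof -
  note [measurable] = sum_Z_measurable[OF xi_measurable(2), of n] sum_Z_measurable[OF fs_xi_measurable, of n]
  show "Aev n \<in> events" unfolding A_event_def by measurable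
  have "(\<lambda>z. (XI z)\<^sup>2) \<in> borel_measurable PZ"
    using xi_map_measurable by measurable
  note [measurable] = sum_Z_measurable[OF this, of n]
  show "Bev n \<in> events" unfolding Bev_eq by measurable
qed

text \<open>Continuity extends the estimate from the countable \<open>T\<close> to all of
  \<open>{- U..U}\<close>, and on \<open>Aev n\<close> no shift outside this interval does better
  than 0, for either objective.\<close>

lemma val_close:
  assumes \<theta>: "\<theta> \<in> \<Theta>" and n: "n \<ge> 1" and A: "\<omega> \<in> Aev n"
    and T: "{- U..U} \<subseteq> closure T" "T \<subseteq> {- U..U}"
    and close: "\<And>x. x \<in> T \<Longrightarrow> \<bar>(\<Sum>j=1..n. loss (G \<theta>) x (Z j \<omega>)) / real n - (\<integral>z. loss (G \<theta>) x z \<partial>PZ)\<bar> \<le> c"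
  shows "\<bar>val_emp n \<omega> \<theta> - val_pop \<theta>\<bar> \<le> c"
proof -
  have A': "(\<Sum>j=1..n. \<xi> (Z j \<omega>)) / real n \<le> E\<xi> + \<delta>" "(\<Sum>j=1..n. fs (\<xi> (Z j \<omega>))) / real n \<le> Efs + \<delta>"
    using A by (auto simp: A_event_def)
  have clo: "closure T = {- U..U}"
    using T closure_minimal[OF T(2)] by auto
  have "continuous_on {- U..U} (obj_pop \<theta>)"
  proof (rule lipschitz_on_continuous_on[OF lipschitz_onI])
    show "dist (obj_pop \<theta> x) (obj_pop \<theta> y) \<le> (\<integral>z. slope z \<partial>PZ) * dist x y"
      if "x \<in> {- U..U}" "y \<in> {- U..U}" for x y
      unfolding dist_real_def by (rule obj_pop_lipschitz[OF \<theta>]) (use that in auto)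
    show "0 \<le> (\<integral>z. slope z \<partial>PZ)"
      by (intro Bochner_Integration.integral_nonneg order_trans[OF zero_le_one slope_ge_1])
  qed
  then have cont: "continuous_on (closure T) (\<lambda>x. \<bar>obj_emp n \<omega> \<theta> x - obj_pop \<theta> x\<bar>)"
    unfolding clo by (intro continuous_intros obj_emp_continuous)
  have diff: "\<bar>obj_emp n \<omega> \<theta> x - obj_pop \<theta> x\<bar> \<le> c" if "\<bar>x\<bar> \<le> U" for x
    by (rule continuous_le_on_closure[OF cont]) (use that clo close in \<open>auto simp: obj_diff[OF \<theta> n]\<close>)
  have out_emp: "obj_emp n \<omega> \<theta> 0 \<le> obj_emp n \<omega> \<theta> x" if "\<bar>x\<bar> > U" for x
    using obj_emp_bounds(1)[OF \<theta> n, of \<omega>] A'(2)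
    by (intro outside_interval[where g = "obj_emp n \<omega> \<theta>", OF _ A'(1) obj_emp_bounds(3)[OF \<theta> n] obj_emp_bounds(4)[OF \<theta> n] that]) linarith
  have out_pop: "obj_pop \<theta> 0 \<le> obj_pop \<theta> x" if "\<bar>x\<bar> > U" for x
    using obj_pop_bounds(1)[OF \<theta>] \<delta>
    by (intro outside_interval[where g = "obj_pop \<theta>" and m = E\<xi>, OF _ _ obj_pop_bounds(3)[OF \<theta>] obj_pop_bounds(4)[OF \<theta>] that]) linarith+
  have "val_emp n \<omega> \<theta> \<le> val_pop \<theta> + c"
    unfolding val_emp_def val_pop_def
    by (rule Inf_le_restricted[where f = "obj_emp n \<omega> \<theta>" and g = "obj_pop \<theta>",
          OF val_emp_bdd[OF \<theta> n] out_pop]) (use diff in \<open>auto simp: abs_le_iff algebra_simps\<close>)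
  moreover have "val_pop \<theta> \<le> val_emp n \<omega> \<theta> + c"
    unfolding val_emp_def val_pop_def
    by (rule Inf_le_restricted[where f = "obj_pop \<theta>" and g = "obj_emp n \<omega> \<theta>",
          OF val_pop_bdd[OF \<theta>] out_emp]) (use diff in \<open>auto simp: abs_le_iff algebra_simps\<close>)
  ultimately show ?thesis by linarith
qed

definition error :: "nat \<Rightarrow> 'a \<Rightarrow> real"
  where "error n \<omega> = (INF \<theta>\<in>\<Theta>. val_emp n \<omega> \<theta>) - (INF \<theta>\<in>\<Theta>. val_pop \<theta>)"

lemma error_measurable: "n \<ge> 1 \<Longrightarrow> error n \<in> borel_measurable M"
  unfolding error_def[abs_def] using optimal_value_measurable by simp

text \<open>Symmetrization with \<open>\<epsilon>1 = 15/16 * \<epsilon>\<close> and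
  \<open>\<epsilon>2 = 3/16 * \<epsilon>\<close> leaves the threshold \<open>3/4 * u\<close> in
  units of \<open>sqrt (real n) * \<sigma>\<close>. For \<open>\<omega> = u / 64\<close> the class
  bound asks that \<open>56 * J + 43 + 14 * u / 64\<close> stay below it, which
  \<open>130 + 128 * J \<le> u\<close> ensures. Its factor 1/2 cancels the 2 of the ghost
  sample.\<close>

lemma uniform_deviation:
  assumes n: "n \<ge> 1" and \<epsilon>: "\<epsilon> > 0" and I: "countable I" "I \<subseteq> \<Theta> \<times> {- U..U}"
    and u: "u = sqrt (real n) * \<epsilon> / \<sigma>" and large: "130 + 128 * enn2real (entropy_integral (G ` \<Theta>) \<xi> (1/4)) \<le> u"
  shows "prob {\<omega>\<in>space M. (\<exists>i\<in>I. 15/16 * \<epsilon> < \<bar>(\<Sum>j=1..n. loss (G (fst i)) (snd i) (Z j \<omega>)) / real n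
        - (\<integral>z. loss (G (fst i)) (snd i) z \<partial>PZ)\<bar>) \<and> (\<Sum>j=1..n. (XI (Z j \<omega>))\<^sup>2) \<le> 2 * real n * \<sigma>\<^sup>2}
    \<le> exp (- (u / 64)\<^sup>2)"
proof -
  define J where "J = enn2real (entropy_integral (G ` \<Theta>) \<xi> (1/4))"
  have J: "0 \<le> J" by (simp add: J_def)
  have u130: "130 \<le> u" using large J unfolding J_def[symmetric] by linarith
  define f where "f i = loss (G (fst i)) (snd i)" for i :: "'t \<times> real"
  define e where "e z = (XI z)\<^sup>2" for z
  have I\<Theta>: "fst i \<in> \<Theta>" "\<bar>snd i\<bar> \<le> U" if "i \<in> I" for i
  proof -
    have "i \<in> \<Theta> \<times> {- U..U}" using that I(2) by blast
    then show "fst i \<in> \<Theta>" "\<bar>snd i\<bar> \<le> U" by (auto simp: mem_Times_iff)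
  qed
  have f: "f i \<in> borel_measurable PZ" if "i \<in> I" for i
    unfolding f_def loss_def using G_measurable_PZ[OF I\<Theta>(1)[OF that]] by measurable
  have e: "integrable PZ e" "\<And>z. 0 \<le> e z" "(\<integral>z. e z \<partial>PZ) = \<sigma>\<^sup>2" "0 < \<sigma>\<^sup>2"
    using xi_map_integrable sigma_pos by (auto simp: e_def[abs_def] sigma_square[symmetric])
  have fe: "(f i z)\<^sup>2 \<le> 2 * e z" if "i \<in> I" for i z
    using F_square_le[of "G (fst i)" "snd i" z] I\<Theta>[OF that] by (simp add: f_def e_def env2_eq)
  have n\<epsilon>: "real n * \<epsilon>\<^sup>2 = u\<^sup>2 * \<sigma>\<^sup>2"
    using sigma_pos by (simp add: u power_mult_distrib power_divide)
  have "(130::real)\<^sup>2 \<le> u\<^sup>2"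
    using u130 by (intro power_mono) auto
  then have "300 \<le> u\<^sup>2" by simp
  then have "300 * \<sigma>\<^sup>2 \<le> u\<^sup>2 * \<sigma>\<^sup>2"
    by (intro mult_right_mono) auto
  then have big: "8 * \<sigma>\<^sup>2 \<le> real n * (3/16 * \<epsilon>)\<^sup>2"
  proof -
    assume "300 * \<sigma>\<^sup>2 \<le> u\<^sup>2 * \<sigma>\<^sup>2"
    \<comment> \<open>\<open>8 * 256 = 2048\<close> and \<open>9 / 256\<close> is the square of
      \<open>3/16\<close>: the condition amounts to \<open>u\<^sup>2\<close> being at least
      \<open>2048 / 9\<close>, which is below 300.\<close>
    then have "2048 * \<sigma>\<^sup>2 \<le> 9 * (u\<^sup>2 * \<sigma>\<^sup>2)"
      using zero_le_power2[of \<sigma>] by linarith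
    then show ?thesis
      unfolding power_mult_distrib mult.left_commute[of "real n"] n\<epsilon> by (simp add: power_divide)
  qed
  define \<kappa> where "\<kappa> = real n * (15/16 * \<epsilon> - 3/16 * \<epsilon>)"
  have "\<kappa> = 3/4 * (sqrt (real n) * (sqrt (real n) * \<epsilon>))"
    by (simp add: \<kappa>_def)
  also have "sqrt (real n) * \<epsilon> = u * \<sigma>"
    using sigma_pos by (simp add: u)
  finally have \<kappa>: "\<kappa> = sqrt (real n) * \<sigma> * (3/4 * u)" by simp
  have \<kappa>_ge: "sqrt (real n) * \<sigma> * (56 * J + 43 + 14 * (u / 64)) \<le> \<kappa>"
    unfolding \<kappa> using sigma_pos large[folded J_def] J by (intro mult_left_mono) auto
  have count: "real (card {s\<in>Pow {1..n}. \<exists>i\<in>I. \<kappa> < \<bar>\<Sum>j=1..n. sgs s j * (f i (w j) - f i (w (j + n)))\<bar>})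
      \<le> 2 ^ n * (1/2 * exp (- (u / 64)\<^sup>2))" if w: "(\<Sum>j=1..2*n. e (w j)) \<le> 6 * real n * \<sigma>\<^sup>2" for w
  proof -
    have "card {s\<in>Pow {1..n}. \<exists>i\<in>I. \<kappa> < \<bar>\<Sum>j=1..n. sgs s j * (f i (w j) - f i (w (j + n)))\<bar>}
        \<le> card {s\<in>Pow {1..n}. \<exists>h\<in>G ` \<Theta>. \<exists>x. \<bar>x\<bar> \<le> U \<and>
            \<kappa> < \<bar>\<Sum>j=1..n. sgs s j * (loss h x (w j) - loss h x (w (j + n)))\<bar>}"
      using I\<Theta> unfolding f_def by (intro card_mono) fastforce+
    also have "real \<dots> \<le> 2 ^ n * (1/2 * exp (- (u / 64)\<^sup>2))"
    proof (rule rademacher_class_bound[OF n sigma_pos _ entropy_fin])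
      show "0 \<le> u / 64" using u130 by simp
      show "(\<Sum>j=1..2*n. env2 (w j)) \<le> 6 * real n * \<sigma>\<^sup>2"
        using w by (simp add: env2_eq e_def)
      show "sqrt (real n) * \<sigma> * (56 * enn2real (entropy_integral (G ` \<Theta>) \<xi> (1/4)) + 43 + 14 * (u / 64)) \<le> \<kappa>"
        using \<kappa>_ge by (simp add: J_def)
    qed
    finally show ?thesis by simp
  qed
  have \<epsilon>2: "0 < 3/16 * \<epsilon>" using \<epsilon> by simp
  have b0: "0 \<le> 1/2 * exp (- (u / 64)\<^sup>2)" by simp
  note ghost = symmetrization_ghost[OF n I(1) f e(1,2,3,4) fe \<epsilon>2 big, where ?\<epsilon>1.0 = "15/16 * \<epsilon>"]
  note swap = symmetrization_swap[OF I(1) f borel_measurable_integrable[OF e(1)] b0 count]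
  have "prob {\<omega>\<in>space M. (\<exists>i\<in>I. 15/16 * \<epsilon> < \<bar>(\<Sum>j=1..n. f i (Z j \<omega>)) / real n - (\<integral>z. f i z \<partial>PZ)\<bar>)
        \<and> (\<Sum>j=1..n. e (Z j \<omega>)) \<le> 2 * real n * \<sigma>\<^sup>2} \<le> 2 * (1/2 * exp (- (u / 64)\<^sup>2))"
    using ghost swap unfolding \<kappa>_def by (meson mult_left_mono order_trans zero_le_numeral)
  then show ?thesis
    unfolding f_def e_def by simp
qed

text \<open>The level \<open>15/16\<close> leaves strict room: off the bad events the error is at
  most \<open>15/16 * \<epsilon>\<close>, which contradicts the non-strict bound
  \<open>\<epsilon> \<le> \<bar>error n \<omega>\<bar>\<close>.\<close>

lemma deviation:
  assumes n: "n \<ge> 1" and \<epsilon>: "\<epsilon> > 0"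
    and u: "u = sqrt (real n) * \<epsilon> / \<sigma>" and large: "130 + 128 * enn2real (entropy_integral (G ` \<Theta>) \<xi> (1/4)) \<le> u"
  shows "prob {\<omega>\<in>space M. \<epsilon> \<le> \<bar>error n \<omega>\<bar>}
    \<le> exp (- (u / 64)\<^sup>2) + prob (space M - Aev n) + prob (space M - Bev n)"
proof -
  obtain \<Theta>' where \<Theta>': "\<Theta>' \<subseteq> \<Theta>" "countable \<Theta>'" "\<Theta>' \<noteq> {}"
    and red_pop: "(INF \<theta>\<in>\<Theta>. val_pop \<theta>) = (INF \<theta>\<in>\<Theta>'. val_pop \<theta>)"
    and red: "\<And>n. n \<ge> 1 \<Longrightarrow> \<exists>N\<in>null_sets M. \<forall>\<omega>\<in>space M - N.
      (INF \<theta>\<in>\<Theta>. val_emp n \<omega> \<theta>) = (INF \<theta>\<in>\<Theta>'. val_emp n \<omega> \<theta>)"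
    using countable_reduction by metis
  obtain N where N: "N \<in> null_sets M"
    "\<And>\<omega>. \<omega> \<in> space M - N \<Longrightarrow> (INF \<theta>\<in>\<Theta>. val_emp n \<omega> \<theta>) = (INF \<theta>\<in>\<Theta>'. val_emp n \<omega> \<theta>)"
    using red[OF n] by blast
  obtain T where T: "countable T" "T \<subseteq> {- U..U}" "{- U..U} \<subseteq> closure T"
    using Topology_Euclidean_Space.separable[of "{- U..U}"] by blast
  define I where "I = \<Theta>' \<times> T"
  have I: "countable I" "I \<subseteq> \<Theta> \<times> {- U..U}"
    using \<Theta>' T by (auto simp: I_def)
  define D where "D = {\<omega>\<in>space M. (\<exists>i\<in>I. 15/16 * \<epsilon> < \<bar>(\<Sum>j=1..n. loss (G (fst i)) (snd i) (Z j \<omega>)) / real n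
        - (\<integral>z. loss (G (fst i)) (snd i) z \<partial>PZ)\<bar>) \<and> (\<Sum>j=1..n. (XI (Z j \<omega>))\<^sup>2) \<le> 2 * real n * \<sigma>\<^sup>2}"
  have D: "D \<in> events"
  proof -
    have "{\<omega>\<in>space M. 15/16 * \<epsilon> < \<bar>(\<Sum>j=1..n. loss (G (fst i)) (snd i) (Z j \<omega>)) / real n
        - (\<integral>z. loss (G (fst i)) (snd i) z \<partial>PZ)\<bar>} \<in> events" if "i \<in> I" for i
    proof -
      have "fst i \<in> \<Theta>" using that I(2) by (auto simp: mem_Times_iff)
      then have "loss (G (fst i)) (snd i) \<in> borel_measurable PZ"
        unfolding loss_def[abs_def] using G_measurable_PZ[of "fst i"] by measurable
      note [measurable] = sum_Z_measurable[OF this, of n]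
      show ?thesis by measurable
    qed
    then have "{\<omega>\<in>space M. \<exists>i\<in>I. 15/16 * \<epsilon> < \<bar>(\<Sum>j=1..n. loss (G (fst i)) (snd i) (Z j \<omega>)) / real n
        - (\<integral>z. loss (G (fst i)) (snd i) z \<partial>PZ)\<bar>} \<in> events"
      using I(1) by (rule sets.sets_Collect_countable_Ex')
    moreover have "{\<omega>\<in>space M. (\<Sum>j=1..n. (XI (Z j \<omega>))\<^sup>2) \<le> 2 * real n * \<sigma>\<^sup>2} \<in> events"
    proof -
      have "(\<lambda>z. (XI z)\<^sup>2) \<in> borel_measurable PZ"
        using xi_map_measurable by measurable
      note [measurable] = sum_Z_measurable[OF this, of n]
      show ?thesis by measurable
    qed
    ultimately show ?thesis
      unfolding D_def by (intro sets.sets_Collect_conj)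
  qed
  have sub: "{\<omega>\<in>space M. \<epsilon> \<le> \<bar>error n \<omega>\<bar>} \<subseteq> ((D \<union> (space M - Aev n)) \<union> (space M - Bev n)) \<union> N"
  proof
    fix \<omega> assume "\<omega> \<in> {\<omega>\<in>space M. \<epsilon> \<le> \<bar>error n \<omega>\<bar>}"
    then have \<omega>: "\<omega> \<in> space M" and err: "\<epsilon> \<le> \<bar>error n \<omega>\<bar>" by auto
    show "\<omega> \<in> ((D \<union> (space M - Aev n)) \<union> (space M - Bev n)) \<union> N"
    proof (rule ccontr)
      assume not: "\<omega> \<notin> ((D \<union> (space M - Aev n)) \<union> (space M - Bev n)) \<union> N"
      then have A: "\<omega> \<in> Aev n" and B: "\<omega> \<in> Bev n" and nN: "\<omega> \<in> space M - N" and nD: "\<omega> \<notin> D"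
        using \<omega> by auto
      have "(\<Sum>j=1..n. (XI (Z j \<omega>))\<^sup>2) \<le> 2 * real n * \<sigma>\<^sup>2"
        using B n unfolding Bev_eq by (simp add: field_simps)
      then have small: "\<bar>(\<Sum>j=1..n. loss (G \<theta>) x (Z j \<omega>)) / real n - (\<integral>z. loss (G \<theta>) x z \<partial>PZ)\<bar> \<le> 15/16 * \<epsilon>"
        if "\<theta> \<in> \<Theta>'" "x \<in> T" for \<theta> x
        using nD \<omega> that unfolding D_def I_def by (auto simp: not_less)
      have "\<bar>val_emp n \<omega> \<theta> - val_pop \<theta>\<bar> \<le> 15/16 * \<epsilon>" if "\<theta> \<in> \<Theta>'" for \<theta>
        using that \<Theta>'(1) by (intro val_close[OF _ n A T(3,2) small]) auto
      then have "\<bar>(INF \<theta>\<in>\<Theta>'. val_emp n \<omega> \<theta>) - (INF \<theta>\<in>\<Theta>'. val_pop \<theta>)\<bar> \<le> 15/16 * \<epsilon>"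
        using \<Theta>' val_emp_ge[OF _ n, of _ \<omega>] val_pop_ge by (intro Inf_close bdd_belowI2) auto
      then show False
        using err \<epsilon> N(2)[OF nN] red_pop by (simp add: error_def)
    qed
  qed
  have ev: "space M - Aev n \<in> events" "space M - Bev n \<in> events" "N \<in> events"
    using Aev_event Bev_event N(1) by auto
  have "prob {\<omega>\<in>space M. \<epsilon> \<le> \<bar>error n \<omega>\<bar>} \<le> prob (((D \<union> (space M - Aev n)) \<union> (space M - Bev n)) \<union> N)"
    using D ev by (intro finite_measure_mono[OF sub]) auto
  also have "\<dots> \<le> prob ((D \<union> (space M - Aev n)) \<union> (space M - Bev n)) + prob N"
    using D ev by (intro measure_Un_le) auto
  also have "prob N = 0"
    using N(1) by (rule measure_eq_0_null_sets)
  also have "prob ((D \<union> (space M - Aev n)) \<union> (space M - Bev n)) + 0 \<le> prob (D \<union> (space M - Aev n)) + prob (space M - Bev n)"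
    using D ev by (simp add: measure_Un_le)
  also have "prob (D \<union> (space M - Aev n)) \<le> prob D + prob (space M - Aev n)"
    using D ev by (intro measure_Un_le) auto
  also have "prob D \<le> exp (- (u / 64)\<^sup>2)"
    unfolding D_def by (rule uniform_deviation[OF n \<epsilon> I u large])
  finally show ?thesis by simp
qed

end

section \<open>Comparison with the stated rate, and tightness\<close>

lemma rate_f_bounds:
  assumes t: "t > 0" and n: "n \<ge> 1"
  shows "0 \<le> rate_f n t" "rate_f n t \<le> 3/10"
proof -
  have "0 \<le> t / (5 * t + 28)" using t by simp
  then show "0 \<le> rate_f n t" by (simp add: rate_f_def le_max_iff_disj)
  have "ln (1 + t / (5 * t + 17)) \<le> t / (5 * t + 17)"
    using t by (intro ln_add_one_self_le_self) auto
  also have "\<dots> \<le> 1/5"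
    using t by (simp add: field_simps)
  finally have "3 * sqrt (real n) * ln (1 + t / (5 * t + 17)) \<le> 3 * sqrt (real n) * (1/5)"
    by (intro mult_left_mono) auto
  also have "\<dots> \<le> 3/10 * (2 * (sqrt (2 * real n) + 1))"
  proof -
    have "sqrt (real n) \<le> sqrt (2 * real n)" by simp
    then show ?thesis by argo
  qed
  finally have "3 * sqrt (real n) * ln (1 + t / (5 * t + 17)) / (2 * (sqrt (2 * real n) + 1)) \<le> 3/10"
    by (subst pos_divide_le_eq) (auto intro!: add_nonneg_pos mult_pos_pos)
  moreover have "t / (5 * t + 28) \<le> 3/10"
    using t by (simp add: field_simps)
  ultimately show "rate_f n t \<le> 3/10"
    by (simp add: rate_f_def)
qed

context saa_problem
begin

lemma deviation_inequality:
  assumes n: "n \<ge> 1" and t: "t > 0"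
    and large: "\<epsilon> > \<sigma> / sqrt (real n)
      * (2 + 32 * (t + 1) * (4 * enn2real (entropy_integral (G ` \<Theta>) \<xi> (1/4)) + 5 * sqrt (ln 2)))"
  shows "prob {\<omega>\<in>space M. \<bar>error n \<omega>\<bar> \<ge> \<epsilon>}
    \<le> exp (- t * sqrt (real n) * \<epsilon> / (16 * (t + 1) * \<sigma>) * rate_f n t)
      + prob (space M - Aev n) + prob (space M - Bev n)"
proof -
  define J where "J = enn2real (entropy_integral (G ` \<Theta>) \<xi> (1/4))"
  define u where "u = sqrt (real n) * \<epsilon> / \<sigma>"
  have J: "0 \<le> J" by (simp add: J_def)
  have sn: "sqrt (real n) > 0" using n by simp
  \<comment> \<open>Since \<open>5 * 8/10 = 4\<close>, the bracket in the hypothesis on \<epsilon>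
    is at least \<open>2 + 32 * (4 * J + 4)\<close>, the required
    \<open>130 + 128 * J\<close>.\<close>
  have "(8/10)\<^sup>2 \<le> ln (2::real)"
    using ln2_ge_two_thirds by (simp add: power2_eq_square)
  then have ln2: "8/10 \<le> sqrt (ln 2)"
    by (rule real_le_rsqrt)
  have "1 * (4 * J + 5 * sqrt (ln 2)) \<le> (t + 1) * (4 * J + 5 * sqrt (ln 2))"
    using t J ln2 by (intro mult_right_mono) auto
  note * = this
  have *: "130 + 128 * J \<le> 2 + 32 * (t + 1) * (4 * J + 5 * sqrt (ln 2))"
  proof -
    define s P where "s = sqrt (ln 2)" and "P = (t + 1) * (4 * J + 5 * sqrt (ln 2))"
    have "1 * (4 * J + 5 * s) \<le> P" "8/10 \<le> s"
      using * ln2 by (simp_all only: s_def P_def)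
    then have "130 + 128 * J \<le> 2 + 32 * P" by argo
    then show ?thesis by (simp only: P_def mult.assoc)
  qed
  have "\<sigma> / sqrt (real n) * (130 + 128 * J) \<le> \<epsilon>"
    using mult_left_mono[OF *, of "\<sigma> / sqrt (real n)"] large sigma_pos sn unfolding J_def[symmetric] by simp
  then have u: "130 + 128 * J \<le> u"
    using sigma_pos sn by (simp add: u_def field_simps)
  then have u0: "130 \<le> u" using J by linarith
  then have "0 < u * \<sigma> / sqrt (real n)" using sigma_pos sn by simp
  then have \<epsilon>: "\<epsilon> > 0" using sigma_pos sn by (simp add: u_def)
  have "t * sqrt (real n) * \<epsilon> / (16 * (t + 1) * \<sigma>) * rate_f n t = (t / (t + 1) * rate_f n t) * (u / 16)"
    using sigma_pos t by (simp add: u_def field_simps)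
  also have "\<dots> \<le> (1 * (3/10)) * (u / 16)"
    \<comment> \<open>The linear exponent is thus at most \<open>3 * u / 160\<close>, which the
      quadratic \<open>u\<^sup>2 / 4096\<close> overtakes from \<open>u = 76.8\<close> on.\<close>
    using rate_f_bounds[OF t n] t u0 by (intro mult_right_mono mult_mono) auto
  also have "\<dots> \<le> u * (u / 4096)"
    using u0 by simp
  also have "\<dots> = (u / 64)\<^sup>2"
    by (simp add: power2_eq_square)
  finally have "exp (- (u / 64)\<^sup>2) \<le> exp (- t * sqrt (real n) * \<epsilon> / (16 * (t + 1) * \<sigma>) * rate_f n t)"
    by simp
  then show ?thesis
    using deviation[OF n \<epsilon> u_def] u unfolding J_def by linarith
qed

lemma Aev_compl_tendsto: "(\<lambda>n. prob (space M - Aev n)) \<longlonglongrightarrow> 0"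
proof -
  let ?P = "\<lambda>n. {\<omega>\<in>space M. E\<xi> + \<delta> < (\<Sum>j=1..n. \<xi> (Z j \<omega>)) / real n}"
  let ?Q = "\<lambda>n. {\<omega>\<in>space M. Efs + \<delta> < (\<Sum>j=1..n. fs (\<xi> (Z j \<omega>))) / real n}"
  have ev: "?P n \<in> events" "?Q n \<in> events" for n
  proof -
    note [measurable] = sum_Z_measurable[OF xi_measurable(2), of n] sum_Z_measurable[OF fs_xi_measurable, of n]
    show "?P n \<in> events" "?Q n \<in> events" by measurable
  qed
  show ?thesis
  proof (rule tendsto_sandwich[OF _ _ tendsto_const])
    have "(\<lambda>n. prob (?P n) + prob (?Q n)) \<longlonglongrightarrow> 0 + 0"
      using xi_pos by (intro tendsto_add weak_law_upper xi_integrable fs_xi_integrable0 \<delta>)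
        (auto intro: fs_nonneg less_imp_le)
    then show "(\<lambda>n. prob (?P n) + prob (?Q n)) \<longlonglongrightarrow> 0" by simp
    show "\<forall>\<^sub>F n in sequentially. prob (space M - Aev n) \<le> prob (?P n) + prob (?Q n)"
    proof (intro always_eventually allI)
      fix n
      have "prob (space M - Aev n) \<le> prob (?P n \<union> ?Q n)"
        using ev by (intro finite_measure_mono) (auto simp: A_event_def not_le)
      also have "\<dots> \<le> prob (?P n) + prob (?Q n)"
        by (rule measure_Un_le[OF ev])
      finally show "prob (space M - Aev n) \<le> prob (?P n) + prob (?Q n)" .
    qed
  qed simp
qed

lemma Bev_compl_tendsto: "(\<lambda>n. prob (space M - Bev n)) \<longlonglongrightarrow> 0"
proof -
  have "space M - Bev n = {\<omega>\<in>space M. (\<integral>z. (XI z)\<^sup>2 \<partial>PZ) + \<sigma>\<^sup>2 < (\<Sum>j=1..n. (XI (Z j \<omega>))\<^sup>2) / real n}" for n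
    unfolding Bev_eq sigma_square[symmetric] by (auto simp: not_le)
  then show ?thesis
    using weak_law_upper[OF xi_map_integrable, of "\<sigma>\<^sup>2"] sigma_pos by simp
qed

lemma error_tight: "tight (\<lambda>n. distr M borel (\<lambda>\<omega>. sqrt (real (Suc n)) * error (Suc n) \<omega>))"
proof (rule tight_distr)
  show "(\<lambda>\<omega>. sqrt (real (Suc n)) * error (Suc n) \<omega>) \<in> borel_measurable M" for n
    using error_measurable[of "Suc n"] by simp
  fix e :: real assume e: "e > 0"
  \<comment> \<open>The first entry makes \<open>deviation\<close> applicable, the second brings its
    Gaussian term below \<open>e / 3\<close>; \<open>u / 64 \<ge> 1\<close> allows its square to be
    bounded below by \<open>u / 64\<close>. As \<open>u\<close> does not depend on \<open>n\<close>,
    the level \<open>u * \<sigma>\<close> for the scaled error is uniform.\<close>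
  define u where "u = max (130 + 128 * enn2real (entropy_integral (G ` \<Theta>) \<xi> (1/4))) (64 * (\<bar>ln (e / 3)\<bar> + 1))"
  have u: "130 + 128 * enn2real (entropy_integral (G ` \<Theta>) \<xi> (1/4)) \<le> u" "64 * (\<bar>ln (e / 3)\<bar> + 1) \<le> u"
    by (auto simp: u_def)
  then have u0: "u \<ge> 130"
    using enn2real_nonneg[of "entropy_integral (G ` \<Theta>) \<xi> (1/4)"] by linarith
  have "- ln (e / 3) \<le> \<bar>ln (e / 3)\<bar>" by (rule abs_ge_minus_self)
  also have "\<dots> < u / 64"
    using u(2) by (simp add: field_simps)
  finally have "- ln (e / 3) < u / 64" .
  also have "\<dots> = 1 * (u / 64)" by simp
  also have "\<dots> \<le> (u / 64) * (u / 64)"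
    using u0 by (intro mult_right_mono) auto
  finally have "exp (- (u / 64)\<^sup>2) < exp (ln (e / 3))"
    by (simp add: power2_eq_square)
  then have small: "exp (- (u / 64)\<^sup>2) < e / 3"
    using e by simp
  have "\<forall>\<^sub>F n in sequentially. prob (space M - Aev (Suc n)) < e / 3"
    using e by (intro order_tendstoD(2)[OF LIMSEQ_Suc[OF Aev_compl_tendsto]]) simp
  moreover have "\<forall>\<^sub>F n in sequentially. prob (space M - Bev (Suc n)) < e / 3"
    using e by (intro order_tendstoD(2)[OF LIMSEQ_Suc[OF Bev_compl_tendsto]]) simp
  ultimately have "\<forall>\<^sub>F n in sequentially. prob {\<omega>\<in>space M. u * \<sigma> \<le> \<bar>sqrt (real (Suc n)) * error (Suc n) \<omega>\<bar>} < e"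
  proof eventually_elim
    case (elim n)
    define \<epsilon> where "\<epsilon> = u * \<sigma> / sqrt (real (Suc n))"
    have s: "sqrt (real (Suc n)) > 0" by simp
    have \<epsilon>: "\<epsilon> > 0" and u_eq: "u = sqrt (real (Suc n)) * \<epsilon> / \<sigma>"
      using u0 sigma_pos s by (auto simp: \<epsilon>_def simp del: of_nat_Suc)
    have "u * \<sigma> \<le> \<bar>sqrt (real (Suc n)) * error (Suc n) \<omega>\<bar> \<longleftrightarrow> \<epsilon> \<le> \<bar>error (Suc n) \<omega>\<bar>" for \<omega>
      unfolding \<epsilon>_def abs_mult pos_divide_le_eq[OF s] by (simp add: mult.commute del: of_nat_Suc)
    then have "prob {\<omega>\<in>space M. u * \<sigma> \<le> \<bar>sqrt (real (Suc n)) * error (Suc n) \<omega>\<bar>}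
        = prob {\<omega>\<in>space M. \<epsilon> \<le> \<bar>error (Suc n) \<omega>\<bar>}"
      by simp
    also have "\<dots> \<le> exp (- (u / 64)\<^sup>2) + prob (space M - Aev (Suc n)) + prob (space M - Bev (Suc n))"
      by (rule deviation[OF _ \<epsilon> u_eq u(1)]) simp
    finally show ?case
      using elim small by linarith
  qed
  then show "\<exists>c. \<forall>\<^sub>F n in sequentially. prob {\<omega>\<in>space M. c \<le> \<bar>sqrt (real (Suc n)) * error (Suc n) \<omega>\<bar>} < e"
    by blast
qed

lemma risk_error:
  assumes "n \<ge> 1"
  shows "(INF \<theta>\<in>\<Theta>. risk_functional M \<Phi> (emp_cdf n (\<lambda>j. G \<theta> (Z j \<omega>))))
      - (INF \<theta>\<in>\<Theta>. risk_functional M \<Phi> (cdf (distr M borel (\<lambda>\<omega>'. G \<theta> (Z 1 \<omega>'))))) = error n \<omega>"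
  unfolding error_def using assms risk_emp risk_pop by (simp cong: INF_cong_simp)

end

lemma entropy_integral_mono: "\<delta> \<le> \<delta>' \<Longrightarrow> entropy_integral H C \<delta> \<le> entropy_integral H C \<delta>'"
  unfolding entropy_integral_eq by (intro nn_integral_mono) (auto simp: indicator_def)

theorem theorem4p6:
  fixes M :: "'a measure"
    and \<Theta> :: "(real ^ 'm) set"
    and Z :: "nat \<Rightarrow> 'a \<Rightarrow> real ^ 'd"
    and PZ :: "(real ^ 'd) measure"
    and G :: "real ^ 'm \<Rightarrow> real ^ 'd \<Rightarrow> real"
    and \<Phi> :: "real \<Rightarrow> ennreal"
    and \<xi> :: "real ^ 'd \<Rightarrow> real"
    and x0 \<delta> :: real
  assumes "\<Theta> \<noteq> {}" and "compact \<Theta>"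
    and "prob_space M" and "complete_measure M" and "atomless M"
    and "iid M Z PZ"
    and "divergence_function \<Phi>"
    and A1: "\<forall>\<theta>\<in>\<Theta>. G \<theta> \<in> borel_measurable borel"
    and A2': "positive_envelope (G ` \<Theta>) \<xi>" "(\<lambda>\<omega>. \<xi> (Z 1 \<omega>)) \<in> orlicz_heart M \<Phi>"
    and A3'': "\<exists>\<Theta>' (N :: nat \<Rightarrow> (nat \<Rightarrow> real ^ 'd) set). \<Theta>' \<subseteq> \<Theta> \<and> countable \<Theta>' \<and> \<Theta>' \<noteq> {} \<and>
        (\<forall>n\<ge>1. N n \<in> null_sets (Pi\<^sub>M {1..n} (\<lambda>_. PZ))) \<and>
        (\<forall>n\<ge>1. \<forall>\<theta>\<in>\<Theta>. \<forall>z \<in> space (Pi\<^sub>M {1..n} (\<lambda>_. PZ)) - N n.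
           (INF \<eta>\<in>\<Theta>'. \<integral>\<omega>. \<bar>G \<eta> (Z 1 \<omega>) - G \<theta> (Z 1 \<omega>)\<bar> \<partial>M) = 0 \<and>
           (INF \<eta>\<in>\<Theta>'. MAX j\<in>{1..n}. \<bar>G \<theta> (z j) - G \<eta> (z j)\<bar>) = 0)"
    and "1 < x0" and "x0 < 2" and "\<Phi> x0 < \<infinity>" and "\<delta> > 0"
    and "xi_map \<Phi> PZ x0 \<xi> \<delta> \<in> borel_measurable PZ"
    and "integrable PZ (\<lambda>z. (xi_map \<Phi> PZ x0 \<xi> \<delta> z)\<^sup>2)"
    and "\<forall>z. lsc_on \<Theta> (\<lambda>\<theta>. G \<theta> z)"
    and "entropy_integral (G ` \<Theta>) \<xi> (1/2) < \<infinity>"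
  shows "(\<forall>\<epsilon>>0. \<forall>t>0. \<forall>n\<ge>1.
            real n \<ge> 2 * (l2_norm PZ (xi_map \<Phi> PZ x0 \<xi> \<delta>))\<^sup>2 \<longrightarrow>
            \<epsilon> > l2_norm PZ (xi_map \<Phi> PZ x0 \<xi> \<delta>) / sqrt (real n)
                  * (2 + 32 * (t + 1) * (4 * enn2real (entropy_integral (G ` \<Theta>) \<xi> (1/4)) + 5 * sqrt (ln 2))) \<longrightarrow>
            measure M {\<omega>\<in>space M.
               \<bar>(INF \<theta>\<in>\<Theta>. risk_functional M \<Phi> (emp_cdf n (\<lambda>j. G \<theta> (Z j \<omega>))))
                - (INF \<theta>\<in>\<Theta>. risk_functional M \<Phi> (cdf (distr M borel (\<lambda>\<omega>'. G \<theta> (Z 1 \<omega>')))))\<bar> \<ge> \<epsilon>}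
            \<le> exp (- t * sqrt (real n) * \<epsilon> / (16 * (t + 1) * l2_norm PZ (xi_map \<Phi> PZ x0 \<xi> \<delta>)) * rate_f n t)
              + measure M (space M - A_event M \<Phi> Z PZ \<xi> \<delta> n)
              + measure M (space M - B_event M Z PZ (\<lambda>z. 2 * xi_map \<Phi> PZ x0 \<xi> \<delta> z) n))
       \<and> (let X = (\<lambda>n \<omega>. sqrt (real n) *
               ((INF \<theta>\<in>\<Theta>. risk_functional M \<Phi> (emp_cdf n (\<lambda>j. G \<theta> (Z j \<omega>))))
                - (INF \<theta>\<in>\<Theta>. risk_functional M \<Phi> (cdf (distr M borel (\<lambda>\<omega>'. G \<theta> (Z 1 \<omega>'))))))) in
            (\<forall>n\<ge>1. X n \<in> borel_measurable M) \<and> tight (\<lambda>n. distr M borel (X (Suc n))))"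
proof -
  \<comment> \<open>Chaining starts at scale 1/4, so \<open>saa_problem\<close> asks for a finite
    entropy integral up to there.\<close>
  have "entropy_integral (G ` \<Theta>) \<xi> (1/4) \<le> entropy_integral (G ` \<Theta>) \<xi> (1/2)"
    by (rule entropy_integral_mono) simp
  then have ent: "entropy_integral (G ` \<Theta>) \<xi> (1/4) < \<infinity>"
    using \<open>entropy_integral (G ` \<Theta>) \<xi> (1/2) < \<infinity>\<close> by (rule order.strict_trans1)
  interpret saa_problem \<Phi> M Z PZ \<Theta> G \<xi> x0 \<delta>
    by (intro saa_problem.intro divergence_prob.intro divergence_fun.intro iid_sample.intro
        iid_sample_axioms.intro saa_problem_axioms.intro) (fact assms ent bspec[OF A1])+
  have meas: "(\<lambda>\<omega>. sqrt (real n) * error n \<omega>) \<in> borel_measurable M" if "n \<ge> 1" for n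
    using error_measurable[OF that] by simp
  show ?thesis
    unfolding Let_def
  proof (intro conjI allI impI)
    fix \<epsilon> t :: real and n :: nat
    assume "t > 0" and n: "n \<ge> 1"
      and "\<epsilon> > \<sigma> / sqrt (real n) * (2 + 32 * (t + 1) * (4 * enn2real (entropy_integral (G ` \<Theta>) \<xi> (1/4)) + 5 * sqrt (ln 2)))"
    then show "prob {\<omega>\<in>space M.
               \<bar>(INF \<theta>\<in>\<Theta>. risk_functional M \<Phi> (emp_cdf n (\<lambda>j. G \<theta> (Z j \<omega>))))
                - (INF \<theta>\<in>\<Theta>. risk_functional M \<Phi> (cdf (distr M borel (\<lambda>\<omega>'. G \<theta> (Z 1 \<omega>')))))\<bar> \<ge> \<epsilon>}
            \<le> exp (- t * sqrt (real n) * \<epsilon> / (16 * (t + 1) * \<sigma>) * rate_f n t)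
              + prob (space M - Aev n) + prob (space M - Bev n)"
      unfolding risk_error[OF n] by (intro deviation_inequality)
  next
    fix n :: nat assume n: "n \<ge> 1"
    show "(\<lambda>\<omega>. sqrt (real n) *
               ((INF \<theta>\<in>\<Theta>. risk_functional M \<Phi> (emp_cdf n (\<lambda>j. G \<theta> (Z j \<omega>))))
                - (INF \<theta>\<in>\<Theta>. risk_functional M \<Phi> (cdf (distr M borel (\<lambda>\<omega>'. G \<theta> (Z 1 \<omega>'))))))) \<in> borel_measurable M"
      unfolding risk_error[OF n] by (rule meas[OF n])
  next
    have Suc: "1 \<le> Suc n" for n by simp
    show "tight (\<lambda>n. distr M borel (\<lambda>\<omega>. sqrt (real (Suc n)) *
               ((INF \<theta>\<in>\<Theta>. risk_functional M \<Phi> (emp_cdf (Suc n) (\<lambda>j. G \<theta> (Z j \<omega>))))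
                - (INF \<theta>\<in>\<Theta>. risk_functional M \<Phi> (cdf (distr M borel (\<lambda>\<omega>'. G \<theta> (Z 1 \<omega>'))))))))"
      unfolding risk_error[OF Suc] by (rule error_tight)
  qed
qed

end
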